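(* The \textsc{Unsplittable Flow} problem (as defined in the context) is in XP when parameterized by the combined parameter $\mathrm{tw}+\Delta+\ell$, where $\mathrm{tw}$ is the treewidth of the input graph, $\Delta$ its maximum degree, and $\ell$ the length bound on admissible flow routes. That is, it can be solved in time $|\mathbb{I}|^{f(\mathrm{tw},\Delta,\ell)}$ for some computable function $f$, where $|\mathbb{I}|$ is the instance size.
   Context: \textsc{Unsplittable Flow} (decision version): an instance $\mathbb{I}$ consists of a simple undirected graph $G=(V,E)$; a capacity function $\gamma:E\to\mathbb{N}$, encoded in unary; a set $\mathcal{T}$ of tasks, each task being a tuple $(s,t,d,w)\in V\times V\times\mathbb{N}\times\mathbb{N}$ with endpoints $s,t$, demand $d$ and profit $w$; a profit target $\tau\in\mathbb{N}$; and an integer length bound $\ell$. For a subset $T'\subseteq\mathcal{T}$, a flow routing assigns to each task $(s,t,d,w)\in T'$ an $s$-$t$ path in $G$ of length at most $\ell$ such that for every edge $e\in E$ the sum of the demands of the tasks in $T'$ whose assigned path uses $e$ is at most $\gamma(e)$. The question is whether there is a subset $T'$ admitting a flow routing whose total profit $\sum_{(s,t,d,w)\in T'} w$ is at least $\tau$. The instance size $|\mathbb{I}|$ is the total size of all components (so it upper-bounds the maximum capacity). *)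

theory Defs
  imports Main "HOL-Library.Log_Nat"
begin

text \<open>
  Model of computation: a first-order, call-by-value functional language over binary trees with
  natural numbers at the leaves.  Functions take one argument; a program is a list of function
  bodies, and its main function is the first one.  Variables are de Bruijn indices.

  Every evaluation step costs one unit, and additions and subtractions are charged in addition the
  bit lengths of their operands (logarithmic cost criterion).  Constructing and destructing a pair
  has unit cost because values are immutable and can be shared.  Under this cost measure the
  language and Turing machines simulate each other with polynomial overhead, so that membership
  in XP does not depend on the choice between them.
\<close>

datatype val = VNum nat | VPair val val

datatype expr =
    Var nat
  | Const nat
  | MkPair expr expr
  | Fst expr
  | Snd expr
  | Add expr expr
  | Sub expr expr
  | Cond expr expr expr
  | LetIn expr expr
  | Call nat expr

type_synonym program = "expr list"

inductive eval :: "program \<Rightarrow> val list \<Rightarrow> expr \<Rightarrow> val \<Rightarrow> nat \<Rightarrow> bool"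
  for P :: program where
  eval_Var: "i < length \<rho> \<Longrightarrow> eval P \<rho> (Var i) (\<rho> ! i) 1"
| eval_Const: "eval P \<rho> (Const n) (VNum n) 1"
| eval_MkPair: "eval P \<rho> a v t \<Longrightarrow> eval P \<rho> b w u \<Longrightarrow>
    eval P \<rho> (MkPair a b) (VPair v w) (1 + t + u)"
| eval_Fst: "eval P \<rho> a (VPair v w) t \<Longrightarrow> eval P \<rho> (Fst a) v (1 + t)"
| eval_Snd: "eval P \<rho> a (VPair v w) t \<Longrightarrow> eval P \<rho> (Snd a) w (1 + t)"
| eval_Add: "eval P \<rho> a (VNum m) t \<Longrightarrow> eval P \<rho> b (VNum n) u \<Longrightarrow>
    eval P \<rho> (Add a b) (VNum (m + n)) (1 + floorlog 2 m + floorlog 2 n + t + u)"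
| eval_Sub: "eval P \<rho> a (VNum m) t \<Longrightarrow> eval P \<rho> b (VNum n) u \<Longrightarrow>
    eval P \<rho> (Sub a b) (VNum (m - n)) (1 + floorlog 2 m + floorlog 2 n + t + u)"
| eval_Cond_True: "eval P \<rho> c v t \<Longrightarrow> v \<noteq> VNum 0 \<Longrightarrow> eval P \<rho> a w u \<Longrightarrow>
    eval P \<rho> (Cond c a b) w (1 + t + u)"
| eval_Cond_False: "eval P \<rho> c (VNum 0) t \<Longrightarrow> eval P \<rho> b w u \<Longrightarrow>
    eval P \<rho> (Cond c a b) w (1 + t + u)"
| eval_LetIn: "eval P \<rho> a v t \<Longrightarrow> eval P (v # \<rho>) b w u \<Longrightarrow>
    eval P \<rho> (LetIn a b) w (1 + t + u)"
| eval_Call: "eval P \<rho> a v t \<Longrightarrow> i < length P \<Longrightarrow> eval P [v] (P ! i) w u \<Longrightarrow>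
    eval P \<rho> (Call i a) w (1 + t + u)"

definition runs :: "program \<Rightarrow> val \<Rightarrow> val \<Rightarrow> nat \<Rightarrow> bool" where
  "runs P x v t \<longleftrightarrow> P \<noteq> [] \<and> eval P [x] (P ! 0) v t"

lemma eval_deterministic:
  "eval P \<rho> e v t \<Longrightarrow> eval P \<rho> e v' t' \<Longrightarrow> v' = v \<and> t' = t"
proof (induction arbitrary: v' t' rule: eval.induct)
  case (eval_Var i \<rho>)
  from eval_Var.prems show ?case by cases auto
next
  case (eval_Const \<rho> n)
  from eval_Const.prems show ?case by cases auto
next
  case (eval_MkPair \<rho> a v t b w u)
  from eval_MkPair.prems show ?case by cases (use eval_MkPair.IH in blast)
next
  case (eval_Fst \<rho> a v w t)
  from eval_Fst.prems show ?case by cases (use eval_Fst.IH in blast)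
next
  case (eval_Snd \<rho> a v w t)
  from eval_Snd.prems show ?case by cases (use eval_Snd.IH in blast)
next
  case (eval_Add \<rho> a m t b n u)
  from eval_Add.prems show ?case by cases (use eval_Add.IH in blast)
next
  case (eval_Sub \<rho> a m t b n u)
  from eval_Sub.prems show ?case by cases (use eval_Sub.IH in blast)
next
  case (eval_Cond_True \<rho> c v t a w u b)
  from eval_Cond_True.prems show ?case
    by cases (use eval_Cond_True.IH eval_Cond_True.hyps in blast)+
next
  case (eval_Cond_False \<rho> c t b w u a)
  from eval_Cond_False.prems show ?case by cases (use eval_Cond_False.IH in blast)+
next
  case (eval_LetIn \<rho> a v t b w u)
  from eval_LetIn.prems show ?case by cases (use eval_LetIn.IH in blast)
next
  case (eval_Call \<rho> a v t i w u)
  from eval_Call.prems show ?case by cases (use eval_Call.IH in blast)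
qed

corollary runs_deterministic: "runs P x v t \<Longrightarrow> runs P x v' t' \<Longrightarrow> v' = v \<and> t' = t"
  unfolding runs_def using eval_deterministic by blast

text \<open>Numbers at the leaves count with their binary length.\<close>

primrec vsize :: "val \<Rightarrow> nat" where
  "vsize (VNum n) = 1 + floorlog 2 n"
| "vsize (VPair v w) = 1 + vsize v + vsize w"

primrec enc_list :: "('a \<Rightarrow> val) \<Rightarrow> 'a list \<Rightarrow> val" where
  "enc_list enc [] = VNum 0"
| "enc_list enc (x # xs) = VPair (enc x) (enc_list enc xs)"

definition enc_unary :: "nat \<Rightarrow> val" where
  "enc_unary k = enc_list VNum (replicate k 0)"

definition computable :: "(nat list \<Rightarrow> nat) \<Rightarrow> bool" where
  "computable f \<longleftrightarrow> (\<exists>P. \<forall>ks. \<exists>t. runs P (enc_list VNum ks) (VNum (f ks)) t)"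

text \<open>
  A parameterized decision problem is given by the relation \<open>enc\<close> between instances and their
  encodings (an instance may have several, depending on the order in which its sets are listed),
  the set of yes-instances \<open>Q\<close>, and the combined parameter \<open>\<kappa>\<close>, which is the list of the
  individual parameters.  The size of an instance is the size of its encoding.
\<close>

definition in_XP :: "('i \<Rightarrow> val \<Rightarrow> bool) \<Rightarrow> ('i \<Rightarrow> bool) \<Rightarrow> ('i \<Rightarrow> nat list) \<Rightarrow> bool" where
  "in_XP enc Q \<kappa> \<longleftrightarrow>
    (\<exists>P f. computable f \<and>
      (\<forall>I x. enc I x \<longrightarrow>
        (\<exists>t. runs P x (VNum (if Q I then 1 else 0)) t \<and> t \<le> vsize x ^ f (\<kappa> I))))"


definition simple_graph :: "'v set \<Rightarrow> 'v set set \<Rightarrow> bool" where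
  "simple_graph V E \<longleftrightarrow> finite V \<and> (\<forall>e\<in>E. \<exists>u\<in>V. \<exists>v\<in>V. u \<noteq> v \<and> e = {u, v})"

definition path_edges :: "'v list \<Rightarrow> 'v set set" where
  "path_edges p = {{p ! i, p ! Suc i} | i. Suc i < length p}"

definition path_length :: "'v list \<Rightarrow> nat" where
  "path_length p = length p - 1"

definition is_path :: "'v set \<Rightarrow> 'v set set \<Rightarrow> 'v \<Rightarrow> 'v \<Rightarrow> 'v list \<Rightarrow> bool" where
  "is_path V E s t p \<longleftrightarrow>
    p \<noteq> [] \<and> hd p = s \<and> last p = t \<and> distinct p \<and> set p \<subseteq> V \<and> path_edges p \<subseteq> E"

definition max_degree :: "'v set \<Rightarrow> 'v set set \<Rightarrow> nat" where
  "max_degree V E = Max (insert 0 ((\<lambda>v. card {e \<in> E. v \<in> e}) ` V))"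

definition is_tree :: "'n set \<Rightarrow> 'n set set \<Rightarrow> bool" where
  "is_tree N F \<longleftrightarrow> simple_graph N F \<and> N \<noteq> {} \<and> (\<forall>x\<in>N. \<forall>y\<in>N. \<exists>!p. is_path N F x y p)"

text \<open>
  In the last condition \<open>is_path\<close> keeps the path inside the set of nodes whose bags contain \<open>v\<close>,
  so these nodes induce a connected subgraph of the tree.
\<close>

definition tree_decomposition ::
  "'v set \<Rightarrow> 'v set set \<Rightarrow> 'n set \<Rightarrow> 'n set set \<Rightarrow> ('n \<Rightarrow> 'v set) \<Rightarrow> bool" where
  "tree_decomposition V E N F B \<longleftrightarrow>
    is_tree N F \<and>
    (\<Union>x\<in>N. B x) = V \<and>
    (\<forall>e\<in>E. \<exists>x\<in>N. e \<subseteq> B x) \<and>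
    (\<forall>v\<in>V. \<forall>x\<in>{x \<in> N. v \<in> B x}. \<forall>y\<in>{x \<in> N. v \<in> B x}.
      \<exists>p. is_path {x \<in> N. v \<in> B x} F x y p)"

definition decomposition_width :: "'n set \<Rightarrow> ('n \<Rightarrow> 'v set) \<Rightarrow> nat" where
  "decomposition_width N B = Max ((\<lambda>x. card (B x)) ` N) - 1"

text \<open>
  Natural numbers suffice as tree nodes, since trees are finite.  By truncated subtraction the
  graph without vertices has treewidth 0.
\<close>

definition treewidth :: "'v set \<Rightarrow> 'v set set \<Rightarrow> nat" where
  "treewidth V E = (LEAST k. \<exists>(N :: nat set) F B.
    tree_decomposition V E N F B \<and> decomposition_width N B = k)"


type_synonym task = "nat \<times> nat \<times> nat \<times> nat"

record uf_instance =
  verts :: "nat set"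
  edges :: "nat set set"
  capacity :: "nat set \<Rightarrow> nat"
  tasks :: "task set"
  target :: nat
  length_bound :: nat

definition valid_instance :: "uf_instance \<Rightarrow> bool" where
  "valid_instance I \<longleftrightarrow>
    simple_graph (verts I) (edges I) \<and>
    finite (tasks I) \<and>
    (\<forall>(s, t, d, w)\<in>tasks I. s \<in> verts I \<and> t \<in> verts I)"

definition flow_routing :: "uf_instance \<Rightarrow> task set \<Rightarrow> (task \<Rightarrow> nat list) \<Rightarrow> bool" where
  "flow_routing I T' r \<longleftrightarrow>
    (\<forall>(s, t, d, w)\<in>T'.
      is_path (verts I) (edges I) s t (r (s, t, d, w)) \<and>
      path_length (r (s, t, d, w)) \<le> length_bound I) \<and>
    (\<forall>e\<in>edges I. (\<Sum>(s, t, d, w)\<in>{T \<in> T'. e \<in> path_edges (r T)}. d) \<le> capacity I e)"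

definition unsplittable_flow :: "uf_instance \<Rightarrow> bool" where
  "unsplittable_flow I \<longleftrightarrow>
    (\<exists>T' \<subseteq> tasks I. (\<exists>r. flow_routing I T' r) \<and> (\<Sum>(s, t, d, w)\<in>T'. w) \<ge> target I)"

text \<open>
  The vertices, edges and tasks are listed without repetition in an arbitrary order, and each edge
  is given by its end points in either order together with its capacity in unary.  All other
  numbers are in binary.
\<close>

definition encodes_instance :: "uf_instance \<Rightarrow> val \<Rightarrow> bool" where
  "encodes_instance I x \<longleftrightarrow>
    valid_instance I \<and>
    (\<exists>vs es ts.
      distinct vs \<and> set vs = verts I \<and>
      distinct (map (\<lambda>(u, v). {u, v}) es) \<and> (\<lambda>(u, v). {u, v}) ` set es = edges I \<and>
      distinct ts \<and> set ts = tasks I \<and>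
      x = VPair (enc_list VNum vs)
         (VPair (enc_list (\<lambda>(u, v).
             VPair (VNum u) (VPair (VNum v) (enc_unary (capacity I {u, v})))) es)
         (VPair (enc_list (\<lambda>(s, t, d, w).
             VPair (VNum s) (VPair (VNum t) (VPair (VNum d) (VNum w)))) ts)
         (VPair (VNum (target I)) (VNum (length_bound I))))))"

end

theory Submission
  imports Defs "HOL-Library.FuncSet"
begin

text \<open>
  No tree decomposition is computed. The vertex set is split recursively: a set \<open>C\<close> with few
  boundary edges is split by removing a small set \<open>S\<close> of its vertices, and the pieces are the
  singletons of \<open>S\<close> and the components of \<open>C - S\<close>. Give each vertex of \<open>C\<close> the number of boundary edges
  of \<open>C\<close> at it as its weight. Some bag of a tree decomposition of width tw is balanced: each connected
  set that avoids it has at most half of the weight. Hence, for \<open>K = 2 * (tw + 1) * (\<Delta> + 1)\<close>, every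
  \<open>C\<close> with at most \<open>K\<close> boundary edges can be split into pieces with at most \<open>K\<close> boundary edges each,
  and the smallest number of vertices and boundary edges that permits a split is found by brute force.
  
  For each set \<open>C\<close> of the recursion, the program tabulates the possible edge usages by tasks that start
  in \<open>C\<close>, each with its maximum profit. Usage matters only on edges that are within distance \<open>\<ell>\<close> of
  both \<open>C\<close> and its complement. These are within distance \<open>\<ell>\<close> of an end point of a boundary edge, so
  their number is bounded in terms of tw, \<open>\<Delta>\<close> and \<open>\<ell>\<close>. As capacities are unary, this bounds the number
  of table entries by a power of the instance size. Tables of disjoint sets are joined by adding
  usages and discarding those that exceed a capacity.
\<close>

text \<open>The constant in K makes the bound on boundaries reproduce itself. A component of
  \<open>C - S\<close> inherits at most half of the boundary edges of \<open>C\<close>, because the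
  bag is balanced, and its other boundary edges are among the at most (tw + 1) * \<Delta> edges at
  \<open>S\<close>; both parts are at most K / 2. A singleton has at most \<Delta> \<le> K boundary
  edges. The program knows neither tw nor K. It raises its bound until a split exists, and existence
  at K ends the search at some n \<le> K, so that the pieces again obey K. A split need not be even
  in the number of vertices, and the recursion may be deep. Two nonempty pieces are enough: the
  number of recursive calls is then linear in the number of vertices, and the size of a table
  depends on the boundary but not on the depth. Every task belongs to the set that contains its
  start vertex. Hence disjoint vertex sets have disjoint task sets, even though a route may leave
  its set.\<close>

section \<open>Evaluation as a function\<close>

primrec vfst :: "val \<Rightarrow> val option" where
  "vfst (VNum n) = None"
| "vfst (VPair v w) = Some v"

primrec vsnd :: "val \<Rightarrow> val option" where
  "vsnd (VNum n) = None"
| "vsnd (VPair v w) = Some w"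

primrec vnum :: "val \<Rightarrow> nat option" where
  "vnum (VNum n) = Some n"
| "vnum (VPair v w) = None"

text \<open>
  The value of an expression as a function, where \<open>F\<close> supplies the results of calls and, in
  \<open>cd\<close>, \<open>G\<close> their costs. With \<open>fnP P\<close> and \<open>ctP P\<close> for \<open>F\<close> and \<open>G\<close> the bodies of a program
  become equations for the simplifier, and values can be computed separately from costs.
\<close>

fun vd :: "(nat \<Rightarrow> val \<Rightarrow> val option) \<Rightarrow> val list \<Rightarrow> expr \<Rightarrow> val option" where
  "vd F \<rho> (Var i) = (if i < length \<rho> then Some (\<rho> ! i) else None)"
| "vd F \<rho> (Const n) = Some (VNum n)"
| "vd F \<rho> (MkPair a b) =
    Option.bind (vd F \<rho> a) (\<lambda>v. Option.bind (vd F \<rho> b) (\<lambda>w. Some (VPair v w)))"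
| "vd F \<rho> (Fst a) = Option.bind (vd F \<rho> a) vfst"
| "vd F \<rho> (Snd a) = Option.bind (vd F \<rho> a) vsnd"
| "vd F \<rho> (Add a b) = Option.bind (Option.bind (vd F \<rho> a) vnum)
    (\<lambda>m. Option.bind (Option.bind (vd F \<rho> b) vnum) (\<lambda>n. Some (VNum (m + n))))"
| "vd F \<rho> (Sub a b) = Option.bind (Option.bind (vd F \<rho> a) vnum)
    (\<lambda>m. Option.bind (Option.bind (vd F \<rho> b) vnum) (\<lambda>n. Some (VNum (m - n))))"
| "vd F \<rho> (Cond c a b) =
    Option.bind (vd F \<rho> c) (\<lambda>v. if v = VNum 0 then vd F \<rho> b else vd F \<rho> a)"
| "vd F \<rho> (LetIn a b) = Option.bind (vd F \<rho> a) (\<lambda>v. vd F (v # \<rho>) b)"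
| "vd F \<rho> (Call i a) = Option.bind (vd F \<rho> a) (F i)"

fun obits :: "val option \<Rightarrow> nat" where
  "obits (Some (VNum n)) = floorlog 2 n"
| "obits _ = 0"

fun cd :: "(nat \<Rightarrow> val \<Rightarrow> val option) \<Rightarrow> (nat \<Rightarrow> val \<Rightarrow> nat) \<Rightarrow> val list \<Rightarrow> expr \<Rightarrow> nat" where
  "cd F G \<rho> (Var i) = 1"
| "cd F G \<rho> (Const n) = 1"
| "cd F G \<rho> (MkPair a b) = 1 + cd F G \<rho> a + cd F G \<rho> b"
| "cd F G \<rho> (Fst a) = 1 + cd F G \<rho> a"
| "cd F G \<rho> (Snd a) = 1 + cd F G \<rho> a"
| "cd F G \<rho> (Add a b) =
    1 + obits (vd F \<rho> a) + obits (vd F \<rho> b) + cd F G \<rho> a + cd F G \<rho> b"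
| "cd F G \<rho> (Sub a b) =
    1 + obits (vd F \<rho> a) + obits (vd F \<rho> b) + cd F G \<rho> a + cd F G \<rho> b"
| "cd F G \<rho> (Cond c a b) =
    1 + cd F G \<rho> c + (if vd F \<rho> c = Some (VNum 0) then cd F G \<rho> b else cd F G \<rho> a)"
| "cd F G \<rho> (LetIn a b) = 1 + cd F G \<rho> a + cd F G (the (vd F \<rho> a) # \<rho>) b"
| "cd F G \<rho> (Call i a) = 1 + cd F G \<rho> a + G i (the (vd F \<rho> a))"

definition call_eval :: "program \<Rightarrow> nat \<Rightarrow> val \<Rightarrow> val \<Rightarrow> nat \<Rightarrow> bool" where
  "call_eval P i v w t \<longleftrightarrow> i < length P \<and> eval P [v] (P ! i) w t"

definition fnP :: "program \<Rightarrow> nat \<Rightarrow> val \<Rightarrow> val option" where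
  "fnP P i v = (if \<exists>w t. call_eval P i v w t then Some (THE w. \<exists>t. call_eval P i v w t) else None)"

text \<open>Unspecified where the call has no result, which is why \<open>ctP_unfold\<close> asks
  for a value first.\<close>

definition ctP :: "program \<Rightarrow> nat \<Rightarrow> val \<Rightarrow> nat" where
  "ctP P i v = (THE t. \<exists>w. call_eval P i v w t)"

lemma call_eval_deterministic:
  "call_eval P i v w t \<Longrightarrow> call_eval P i v w' t' \<Longrightarrow> w' = w \<and> t' = t"
  unfolding call_eval_def by (elim conjE) (rule eval_deterministic)

lemma call_eval_fnP:
  assumes "call_eval P i v w t"
  shows "fnP P i v = Some w" "ctP P i v = t"
proof -
  have "(THE w. \<exists>t. call_eval P i v w t) = w"
    by (rule the_equality) (use assms call_eval_deterministic[OF assms] in blast)+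
  moreover have "(THE t. \<exists>w. call_eval P i v w t) = t"
    by (rule the_equality) (use assms call_eval_deterministic[OF assms] in blast)+
  moreover have "\<exists>w t. call_eval P i v w t" using assms by blast
  ultimately show "fnP P i v = Some w" "ctP P i v = t"
    unfolding fnP_def ctP_def by simp_all
qed

lemma fnP_call_eval:
  assumes "fnP P i v = Some w"
  shows "call_eval P i v w (ctP P i v)"
proof -
  obtain w' t' where "call_eval P i v w' t'"
    using assms unfolding fnP_def by (metis option.distinct(1))
  with call_eval_fnP[OF this] assms show ?thesis by simp
qed

lemma vfst_Some: "vfst u = Some v \<longleftrightarrow> (\<exists>w. u = VPair v w)"
  by (cases u) auto
lemma vsnd_Some: "vsnd u = Some v \<longleftrightarrow> (\<exists>w. u = VPair w v)"
  by (cases u) auto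
lemma vnum_Some: "vnum u = Some n \<longleftrightarrow> u = VNum n"
  by (cases u) auto

text \<open>Runs are never constructed by hand: once simplification finds a value, this yields an
  evaluation and its exact cost. Termination comes from the inductions that establish the
  values.\<close>

lemma vd_sound:
  "vd (fnP P) \<rho> e = Some v \<Longrightarrow> eval P \<rho> e v (cd (fnP P) (ctP P) \<rho> e)"
proof (induction e arbitrary: \<rho> v)
  case (Var i)
  then show ?case by (auto split: if_splits simp del: One_nat_def intro: eval_Var)
next
  case (Const n)
  then show ?case by (auto simp del: One_nat_def intro: eval_Const)
next
  case (MkPair a b)
  then obtain x y where "vd (fnP P) \<rho> a = Some x" "vd (fnP P) \<rho> b = Some y" "v = VPair x y"
    by (auto simp: bind_eq_Some_conv)
  then show ?case using eval_MkPair MkPair.IH by (metis cd.simps(3))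
next
  case (Fst a)
  then obtain y where "vd (fnP P) \<rho> a = Some (VPair v y)"
    by (auto simp: bind_eq_Some_conv vfst_Some)
  then show ?case using eval_Fst Fst.IH by (metis cd.simps(4))
next
  case (Snd a)
  then obtain y where "vd (fnP P) \<rho> a = Some (VPair y v)"
    by (auto simp: bind_eq_Some_conv vsnd_Some)
  then show ?case using eval_Snd Snd.IH by (metis cd.simps(5))
next
  case (Add a b)
  then obtain m n where mn: "vd (fnP P) \<rho> a = Some (VNum m)" "vd (fnP P) \<rho> b = Some (VNum n)"
    "v = VNum (m + n)" by (auto simp: bind_eq_Some_conv vnum_Some)
  show ?case using eval_Add[OF Add.IH(1)[OF mn(1)] Add.IH(2)[OF mn(2)]] mn
    by (simp only: cd.simps obits.simps)
next
  case (Sub a b)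
  then obtain m n where mn: "vd (fnP P) \<rho> a = Some (VNum m)" "vd (fnP P) \<rho> b = Some (VNum n)"
    "v = VNum (m - n)" by (auto simp: bind_eq_Some_conv vnum_Some)
  show ?case using eval_Sub[OF Sub.IH(1)[OF mn(1)] Sub.IH(2)[OF mn(2)]] mn
    by (simp only: cd.simps obits.simps)
next
  case (Cond c a b)
  then obtain u where u: "vd (fnP P) \<rho> c = Some u"
    "(if u = VNum 0 then vd (fnP P) \<rho> b else vd (fnP P) \<rho> a) = Some v"
    by (auto simp: bind_eq_Some_conv)
  show ?case
  proof (cases "u = VNum 0")
    case True
    with u show ?thesis
      using eval_Cond_False[OF Cond.IH(1)[OF u(1)[unfolded True]] Cond.IH(3)] by simp
  next
    case False
    with u show ?thesis
      using eval_Cond_True[OF Cond.IH(1)[OF u(1)] False Cond.IH(2)] by simp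
  qed
next
  case (LetIn a b)
  then obtain x where x: "vd (fnP P) \<rho> a = Some x" "vd (fnP P) (x # \<rho>) b = Some v"
    by (auto simp: bind_eq_Some_conv)
  show ?case using eval_LetIn[OF LetIn.IH(1)[OF x(1)] LetIn.IH(2)[OF x(2)]] x(1) by simp
next
  case (Call i a)
  then obtain u where u: "vd (fnP P) \<rho> a = Some u" "fnP P i u = Some v"
    by (auto simp: bind_eq_Some_conv)
  have "i < length P" "eval P [u] (P ! i) v (ctP P i u)"
    using fnP_call_eval[OF u(2)] by (auto simp: call_eval_def)
  from eval_Call[OF Call.IH[OF u(1)] this] show ?case using u(1) by simp
qed

lemma vd_complete: "eval P \<rho> e v t \<Longrightarrow> vd (fnP P) \<rho> e = Some v"
proof (induction rule: eval.induct)
  case (eval_Call \<rho> a v t i w u)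
  then have "fnP P i v = Some w" by (auto intro!: call_eval_fnP simp: call_eval_def)
  with eval_Call show ?case by simp
qed auto

text \<open>Divergent calls are included: by \<open>vd_complete\<close> a result of the call would
  be a value of the body, so a body without a value means a call without a result.\<close>

lemma fnP_unfold: "i < length P \<Longrightarrow> fnP P i v = vd (fnP P) [v] (P ! i)"
proof (cases "vd (fnP P) [v] (P ! i)")
  case None
  moreover assume "i < length P"
  ultimately show ?thesis
    using vd_complete[of P "[v]" "P ! i"] fnP_call_eval[of P i v]
    by (cases "fnP P i v") (simp_all add: call_eval_def)
next
  case (Some w)
  moreover assume "i < length P"
  ultimately show ?thesis
    using vd_sound[OF Some] call_eval_fnP(1)[of P i v w] by (simp add: call_eval_def)
qed

lemma ctP_unfold:
  "i < length P \<Longrightarrow> fnP P i v = Some w \<Longrightarrow> ctP P i v = cd (fnP P) (ctP P) [v] (P ! i)"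
  by (metis call_eval_def call_eval_fnP(2) fnP_unfold vd_sound)

lemma runs_fnP: "P \<noteq> [] \<Longrightarrow> fnP P 0 x = Some v \<Longrightarrow> runs P x v (ctP P 0 x)"
  using fnP_call_eval unfolding runs_def call_eval_def by blast

section \<open>The program\<close>

text \<open>The language can test only for zero. With truncated subtraction,
  \<open>(a - b) + (b - a)\<close> vanishes exactly for equal numbers. Each argument is evaluated
  twice, hence the factors 2 in \<open>cd_NeqE\<close>.\<close>

definition NeqE :: "expr \<Rightarrow> expr \<Rightarrow> expr" where
  "NeqE a b = Cond (Add (Sub a b) (Sub b a)) (Const 1) (Const 0)"

definition neq_cost :: "nat \<Rightarrow> nat \<Rightarrow> nat" where
  "neq_cost m n = 5 + 2 * floorlog 2 m + 2 * floorlog 2 n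
    + floorlog 2 (m - n) + floorlog 2 (n - m)"

lemma vd_NeqE [simp]:
  "vd F \<rho> (NeqE a b) = Option.bind (Option.bind (vd F \<rho> a) vnum)
    (\<lambda>m. Option.bind (Option.bind (vd F \<rho> b) vnum) (\<lambda>n. Some (VNum (of_bool (m \<noteq> n)))))"
  by (cases "Option.bind (vd F \<rho> a) vnum"; cases "Option.bind (vd F \<rho> b) vnum")
    (auto simp: NeqE_def)

lemma cd_NeqE [simp]:
  "vd F \<rho> a = Some (VNum m) \<Longrightarrow> vd F \<rho> b = Some (VNum n) \<Longrightarrow>
    cd F G \<rho> (NeqE a b) = neq_cost m n + 2 * cd F G \<rho> a + 2 * cd F G \<rho> b"
  by (simp add: NeqE_def neq_cost_def)

datatype fname = Main | Mem | Diff | Touch | Expand | Iter | Len | Comps | Comps2 | Pieces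
  | Cut | Cutok | Check | Search | Split | Split2 | Caps | Zero | Vadd | Vle | Veq | Ins | Try
  | Join1 | Join | Bump | Walk | Wloop | Leaf | Vmask | Mask | Mvec | Solve | SolveAll | Any

definition names :: "fname list" where
  "names = [Main, Mem, Diff, Touch, Expand, Iter, Len, Comps, Comps2, Pieces,
    Cut, Cutok, Check, Search, Split, Split2, Caps, Zero, Vadd, Vle, Veq, Ins, Try,
    Join1, Join, Bump, Walk, Wloop, Leaf, Vmask, Mask, Mvec, Solve, SolveAll, Any]"

fun ix :: "fname \<Rightarrow> nat" where
  "ix Main = 0" | "ix Mem = 1" | "ix Diff = 2" | "ix Touch = 3" | "ix Expand = 4"
| "ix Iter = 5" | "ix Len = 6" | "ix Comps = 7" | "ix Comps2 = 8" | "ix Pieces = 9"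
| "ix Cut = 10" | "ix Cutok = 11" | "ix Check = 12" | "ix Search = 13" | "ix Split = 14"
| "ix Split2 = 15" | "ix Caps = 16" | "ix Zero = 17" | "ix Vadd = 18" | "ix Vle = 19"
| "ix Veq = 20" | "ix Ins = 21" | "ix Try = 22" | "ix Join1 = 23" | "ix Join = 24"
| "ix Bump = 25" | "ix Walk = 26" | "ix Wloop = 27" | "ix Leaf = 28" | "ix Vmask = 29"
| "ix Mask = 30" | "ix Mvec = 31" | "ix Solve = 32" | "ix SolveAll = 33" | "ix Any = 34"

lemma ix: "ix f < length names" "names ! ix f = f"
  by (cases f; simp add: names_def)+

notation MkPair (infixr ",," 65)
notation VPair (infixr ";;" 65)

text \<open>
  Several arguments are passed as a right-nested tuple: \<open>Xi\<close> is component \<open>i\<close>, and \<open>Li\<close> is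
  component \<open>i\<close> if it is the last one.
\<close>

abbreviation X0 where "X0 \<equiv> Fst (Var 0)"
abbreviation X1 where "X1 \<equiv> Fst (Snd (Var 0))"
abbreviation X2 where "X2 \<equiv> Fst (Snd (Snd (Var 0)))"
abbreviation X3 where "X3 \<equiv> Fst (Snd (Snd (Snd (Var 0))))"
abbreviation X4 where "X4 \<equiv> Fst (Snd (Snd (Snd (Snd (Var 0)))))"
abbreviation X5 where "X5 \<equiv> Fst (Snd (Snd (Snd (Snd (Snd (Var 0))))))"
abbreviation X6 where "X6 \<equiv> Fst (Snd (Snd (Snd (Snd (Snd (Snd (Var 0)))))))"
abbreviation X7 where "X7 \<equiv> Fst (Snd (Snd (Snd (Snd (Snd (Snd (Snd (Var 0))))))))"
abbreviation X8 where "X8 \<equiv> Fst (Snd (Snd (Snd (Snd (Snd (Snd (Snd (Snd (Var 0)))))))))"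
abbreviation L0 where "L0 \<equiv> Var 0"
abbreviation L1 where "L1 \<equiv> Snd (Var 0)"
abbreviation L2 where "L2 \<equiv> Snd (Snd (Var 0))"
abbreviation L3 where "L3 \<equiv> Snd (Snd (Snd (Var 0)))"
abbreviation L4 where "L4 \<equiv> Snd (Snd (Snd (Snd (Var 0))))"
abbreviation L5 where "L5 \<equiv> Snd (Snd (Snd (Snd (Snd (Var 0)))))"
abbreviation L6 where "L6 \<equiv> Snd (Snd (Snd (Snd (Snd (Snd (Var 0))))))"
abbreviation L8 where "L8 \<equiv> Snd (Snd (Snd (Snd (Snd (Snd (Snd (Snd (Var 0))))))))"
abbreviation L9 where "L9 \<equiv> Snd (Snd (Snd (Snd (Snd (Snd (Snd (Snd (Snd (Var 0)))))))))"
abbreviation cl :: "fname \<Rightarrow> expr \<Rightarrow> expr" where "cl f \<equiv> Call (ix f)"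
abbreviation "zr \<equiv> Const 0"
abbreviation "on \<equiv> Const 1"

text \<open>
  A table is a list of pairs of a usage vector, aligned with the list of edges, and a profit.
  Argument orders that are hard to read off:
  \<open>Search (found, j, S, n, es, C, rest)\<close> extends \<open>S\<close> by at most \<open>j\<close> vertices of \<open>rest\<close> so that
  removing them splits \<open>C\<close> into at least two pieces with at most \<open>n\<close> boundary edges each, and
  returns \<open>found\<close> at once if it is nonzero;
  \<open>Walk (n, c, t, d, w, caps, es, u, acc)\<close> inserts \<open>u\<close> plus the usage of each walk from \<open>c\<close> to
  \<open>t\<close> of length at most \<open>n\<close>;
  \<open>Solve (vs, es, caps, ts, l, C)\<close> computes the table of the tasks that start in \<open>C\<close>.
\<close>

fun body :: "fname \<Rightarrow> expr" where
  "body Mem = Cond L1 (Cond (NeqE X0 (Fst L1)) (cl Mem (X0 ,, Snd L1)) on) zr"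
| "body Diff = Cond L1 (Cond (cl Mem (Fst L1 ,, X0)) (cl Diff (X0 ,, Snd L1))
      (Fst L1 ,, cl Diff (X0 ,, Snd L1))) zr"
| "body Touch = Cond L2
      (Cond (Add (Cond (NeqE (Fst (Fst L2)) X0) zr (cl Mem (Fst (Snd (Fst L2)) ,, X1)))
                 (Cond (NeqE (Fst (Snd (Fst L2))) X0) zr (cl Mem (Fst (Fst L2) ,, X1))))
        on (cl Touch (X0 ,, X1 ,, Snd L2)))
      (cl Mem (X0 ,, X1))"
| "body Expand = Cond L2 (Cond (cl Touch (Fst L2 ,, X0 ,, X1))
      (Fst L2 ,, cl Expand (X0 ,, X1 ,, Snd L2)) (cl Expand (X0 ,, X1 ,, Snd L2))) zr"
| "body Iter = Cond X0 (cl Iter (Sub X0 on ,, cl Expand (X1 ,, X2 ,, L3) ,, X2 ,, L3)) X1"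
| "body Len = Cond L0 (Add on (cl Len (Snd L0))) zr"
| "body Comps = Cond L1
      (cl Comps2 (cl Iter (cl Len L1 ,, (Fst L1 ,, zr) ,, X0 ,, L1) ,, X0 ,, L1)) zr"
| "body Comps2 = X0 ,, cl Comps (X1 ,, cl Diff (X0 ,, L2))"
| "body Pieces = Cond L2 ((Fst L2 ,, zr) ,, cl Pieces (X0 ,, X1 ,, Snd L2)) (cl Comps (X0 ,, X1))"
| "body Cut = Cond L1 (Add (NeqE (cl Mem (Fst (Fst L1) ,, X0)) (cl Mem (Fst (Snd (Fst L1)) ,, X0)))
      (cl Cut (X0 ,, Snd L1))) zr"
| "body Cutok = Cond L2 (Cond (Sub (cl Cut (Fst L2 ,, X1)) X0) zr
      (cl Cutok (X0 ,, X1 ,, Snd L2))) on"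
| "body Check = Cond (Snd L2) (Cond (cl Cutok (X0 ,, X1 ,, L2)) L2 zr) zr"
| "body Search = Cond X0 X0 (Cond (Cond L6 X1 zr)
      (cl Search (cl Search (zr ,, Sub X1 on ,, (Fst L6 ,, X2) ,, X3 ,, X4 ,, X5 ,, Snd L6)
         ,, X1 ,, X2 ,, X3 ,, X4 ,, X5 ,, Snd L6))
      (cl Check (X3 ,, X4 ,, cl Pieces (X4 ,, cl Diff (X2 ,, X5) ,, X2))))"
| "body Split = cl Split2 (cl Search (zr ,, X0 ,, zr ,, X0 ,, X1 ,, L2 ,, L2) ,, X0 ,, X1 ,, L2)"
| "body Split2 = Cond X0 X0 (cl Split (Add X1 on ,, X2 ,, L3))"
| "body Caps = Cond L0 (cl Len (Snd (Snd (Fst L0))) ,, cl Caps (Snd L0)) zr"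
| "body Zero = Cond L0 (zr ,, cl Zero (Snd L0)) zr"
| "body Vadd = Cond X0 (Add (Fst X0) (Fst L1) ,, cl Vadd (Snd X0 ,, Snd L1)) zr"
| "body Vle = Cond X0 (Cond (Sub (Fst X0) (Fst L1)) zr (cl Vle (Snd X0 ,, Snd L1))) on"
| "body Veq = Cond X0 (Cond (NeqE (Fst X0) (Fst L1)) zr (cl Veq (Snd X0 ,, Snd L1))) on"
| "body Ins = Cond L2 (Cond (cl Veq (X0 ,, Fst (Fst L2)))
      ((X0 ,, Add X1 (Sub (Snd (Fst L2)) X1)) ,, Snd L2)
      (Fst L2 ,, cl Ins (X0 ,, X1 ,, Snd L2))) ((X0 ,, X1) ,, zr)"
| "body Try = Cond (cl Vle (X0 ,, X2)) (cl Ins (X0 ,, X1 ,, L3)) L3"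
| "body Join1 = Cond L4 (cl Join1 (X0 ,, X1 ,, X2 ,,
      cl Try (cl Vadd (X0 ,, Fst (Fst L4)) ,, Add X1 (Snd (Fst L4)) ,, X2 ,, X3) ,, Snd L4)) X3"
| "body Join = Cond L3 (cl Join (X0 ,,
      cl Join1 (Fst (Fst L3) ,, Snd (Fst L3) ,, X0 ,, X1 ,, X2) ,, X2 ,, Snd L3)) X1"
| "body Bump = Cond X3
      (Cond (Add (NeqE X0 (Fst (Fst X3))) (NeqE X1 (Fst (Snd (Fst X3))))) (Fst L4) (Add (Fst L4) X2)
       ,, cl Bump (X0 ,, X1 ,, X2 ,, Snd X3 ,, Snd L4)) zr"
| "body Walk = Cond X0
      (cl Wloop (X6 ,, Sub X0 on ,, X1 ,, X2 ,, X3 ,, X4 ,, X5 ,, X6 ,, X7 ,,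
        Cond (NeqE X1 X2) L8 (cl Try (X7 ,, X4 ,, X5 ,, L8))))
      (Cond (NeqE X1 X2) L8 (cl Try (X7 ,, X4 ,, X5 ,, L8)))"
| "body Wloop = Cond X0
      (cl Wloop (Snd X0 ,, X1 ,, X2 ,, X3 ,, X4 ,, X5 ,, X6 ,, X7 ,, X8 ,,
        Cond (NeqE (Fst (Fst X0)) X2)
          (Cond (NeqE (Fst (Snd (Fst X0))) X2) L9
            (cl Walk (X1 ,, Fst (Fst X0) ,, X3 ,, X4 ,, X5 ,, X6 ,, X7 ,,
              cl Bump (Fst (Fst X0) ,, Fst (Snd (Fst X0)) ,, X4 ,, X7 ,, X8) ,, L9)))
          (cl Walk (X1 ,, Fst (Snd (Fst X0)) ,, X3 ,, X4 ,, X5 ,, X6 ,, X7 ,,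
            cl Bump (Fst (Fst X0) ,, Fst (Snd (Fst X0)) ,, X4 ,, X7 ,, X8) ,, L9))))
      L9"
| "body Leaf = Cond L5
      (cl Leaf (X0 ,, X1 ,, X2 ,, X3 ,,
        Cond (cl Mem (Fst (Fst L5) ,, X0))
          (cl Join (X2 ,, zr ,, X4 ,,
            cl Walk (X3 ,, Fst (Fst L5) ,, Fst (Snd (Fst L5)) ,, Fst (Snd (Snd (Fst L5)))
              ,, Snd (Snd (Snd (Fst L5))) ,, X2 ,, X1 ,, cl Zero X1 ,, ((cl Zero X1 ,, zr) ,, zr))))
          X4
        ,, Snd L5)) X4"
| "body Vmask = Cond L1
      (Cond (Fst X0) (Fst L1) zr ,, cl Vmask (Snd X0 ,, Snd L1)) zr"
| "body Mask = Cond L2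
      (cl Mask (X0 ,, cl Ins (cl Vmask (X0 ,, Fst (Fst L2)) ,, Snd (Fst L2) ,, X1) ,, Snd L2)) X1"
| "body Mvec = Cond L1
      (Cond (cl Mem (Fst (Fst L1) ,, X0)) on (cl Mem (Fst (Snd (Fst L1)) ,, X0))
       ,, cl Mvec (X0 ,, Snd L1)) zr"
| "body Solve = cl Mask (cl Mvec (cl Iter (X4 ,, cl Diff (L5 ,, X0) ,, X1 ,, X0) ,, X1) ,, zr ,,
      Cond (Cond L5 (Snd L5) zr)
        (cl SolveAll (X0 ,, X1 ,, X2 ,, X3 ,, X4 ,, cl Split (zr ,, X1 ,, L5)))
        (cl Leaf (L5 ,, X1 ,, X2 ,, X4 ,, ((cl Zero X1 ,, zr) ,, zr) ,, X3)))"
| "body SolveAll = Cond L5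
      (cl Join (X2 ,, zr ,, cl SolveAll (X0 ,, X1 ,, X2 ,, X3 ,, X4 ,, Snd L5) ,,
        cl Solve (X0 ,, X1 ,, X2 ,, X3 ,, X4 ,, Fst L5)))
      ((cl Zero X1 ,, zr) ,, zr)"
| "body Any = Cond L1 (Cond (Sub X0 (Snd (Fst L1))) (cl Any (X0 ,, Snd L1)) on) zr"
| "body Main = cl Any (X3 ,, cl Solve (X0 ,, X1 ,, cl Caps X1 ,, X2 ,, L4 ,, X0))"

definition prog :: program where
  "prog = map body names"

text \<open>
  Lemmas \<open>fn_Foo\<close> and \<open>ct_Foo\<close> below give the value and a cost bound of function \<open>Foo\<close>.
\<close>

abbreviation fn :: "fname \<Rightarrow> val \<Rightarrow> val option" where "fn f \<equiv> fnP prog (ix f)"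
abbreviation ct :: "fname \<Rightarrow> val \<Rightarrow> nat" where "ct f \<equiv> ctP prog (ix f)"

lemma fn_unfold: "fn f v = vd (fnP prog) [v] (body f)"
  using fnP_unfold[of "ix f" prog v] ix[of f] by (simp add: prog_def del: body.simps ix.simps)

lemma ct_unfold: "fn f v = Some w \<Longrightarrow> ct f v = cd (fnP prog) (ctP prog) [v] (body f)"
  using ctP_unfold[of "ix f" prog v w] ix[of f] by (simp add: prog_def del: body.simps ix.simps)

section \<open>Values of the functions on lists and graphs\<close>

declare ix.simps [simp del] body.simps [simp del]

abbreviation en :: "nat list \<Rightarrow> val" where "en \<equiv> enc_list VNum"
abbreviation bl :: "bool \<Rightarrow> val" where "bl b \<equiv> VNum (of_bool b)"

lemma fn_Mem [simp]: "fn Mem (VNum x ;; en A) = Some (bl (x \<in> set A))"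
proof (induction A)
  case Nil
  show ?case by (subst fn_unfold) (simp add: body.simps)
next
  case (Cons a A)
  then show ?case by (subst fn_unfold) (simp add: body.simps)
qed

lemma fn_Diff [simp]: "fn Diff (en S ;; en A) = Some (en (filter (\<lambda>x. x \<notin> set S) A))"
  by (induction A) (subst fn_unfold, simp add: body.simps)+

text \<open>The capacities stay inside the encoding, so that the input list can be passed around
  unchanged; only \<open>Caps\<close> reads them.\<close>

abbreviation ee :: "(nat \<Rightarrow> nat \<Rightarrow> nat) \<Rightarrow> (nat \<times> nat) list \<Rightarrow> val" where
  "ee k \<equiv> enc_list (\<lambda>(u, v). VNum u ;; VNum v ;; enc_unary (k u v))"
abbreviation te :: "task list \<Rightarrow> val" where
  "te \<equiv> enc_list (\<lambda>(s, t, d, w). VNum s ;; VNum t ;; VNum d ;; VNum w)"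

definition adj :: "('a \<times> 'a) list \<Rightarrow> 'a \<Rightarrow> 'a \<Rightarrow> bool" where
  "adj es a b \<longleftrightarrow> (a, b) \<in> set es \<or> (b, a) \<in> set es"

text \<open>One round of breadth-first search. Filtering \<open>A\<close> instead of extending
  \<open>R\<close> keeps the result free of repetitions and no longer than \<open>A\<close>, so all
  iterates stay within the budget.\<close>

definition expd :: "('a \<times> 'a) list \<Rightarrow> 'a list \<Rightarrow> 'a list \<Rightarrow> 'a list" where
  "expd es A R = filter (\<lambda>v. v \<in> set R \<or> (\<exists>w \<in> set R. adj es v w)) A"

definition ecut :: "('a \<times> 'a) list \<Rightarrow> 'a set \<Rightarrow> nat" where
  "ecut es X = length (filter (\<lambda>(a, b). (a \<in> X) \<noteq> (b \<in> X)) es)"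

lemma enc_list_eq_0 [simp]: "enc_list f A = VNum 0 \<longleftrightarrow> A = []"
  by (cases A) auto

lemma fn_Touch [simp]:
  "fn Touch (VNum v ;; en R ;; ee k es) = Some (bl (v \<in> set R \<or> (\<exists>w \<in> set R. adj es v w)))"
proof (induction es)
  case Nil
  show ?case by (subst fn_unfold) (simp add: body.simps adj_def)
next
  case (Cons e es)
  obtain a b where e: "e = (a, b)" by force
  show ?case by (subst fn_unfold) (auto simp: body.simps e Cons.IH adj_def)
qed

lemma fn_Expand [simp]: "fn Expand (en R ;; ee k es ;; en A) = Some (en (expd es A R))"
  by (induction A) (subst fn_unfold, simp add: body.simps expd_def)+

lemma fn_Iter [simp]:
  "fn Iter (VNum n ;; en R ;; ee k es ;; en A) = Some (en ((expd es A ^^ n) R))"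
proof (induction n arbitrary: R)
  case (Suc n)
  show ?case by (subst fn_unfold) (simp add: body.simps Suc.IH funpow_swap1)
qed (subst fn_unfold, simp add: body.simps)

lemma fn_Len [simp]: "fn Len (enc_list f A) = Some (VNum (length A))"
  by (induction A) (subst fn_unfold, simp add: body.simps)+

lemma fn_Cut [simp]: "fn Cut (en X ;; ee k es) = Some (VNum (ecut es (set X)))"
proof (induction es)
  case (Cons e es)
  obtain a b where e: "e = (a, b)" by force
  show ?case by (subst fn_unfold) (simp add: body.simps e Cons.IH ecut_def)
qed (subst fn_unfold, simp add: body.simps ecut_def)

lemma fn_Cutok [simp]:
  "fn Cutok (VNum n ;; ee k es ;; enc_list en ps) = Some (bl (\<forall>p \<in> set ps. ecut es (set p) \<le> n))"
  by (induction ps) (subst fn_unfold, simp add: body.simps)+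

lemma fn_Check [simp]:
  assumes "ps \<noteq> []"
  shows "fn Check (VNum n ;; ee k es ;; enc_list en ps) =
    Some (if length ps \<ge> 2 \<and> (\<forall>p \<in> set ps. ecut es (set p) \<le> n) then enc_list en ps else VNum 0)"
proof -
  obtain p qs where "ps = p # qs" using assms by (cases ps) auto
  then show ?thesis
    using fn_Cutok[of n k es "p # qs"]
    by (cases qs; subst fn_unfold) (auto simp: body.simps simp del: fn_Cutok)
qed

lemma fn_Len_unary [simp]: "fn Len (enc_unary n) = Some (VNum n)"
  by (simp add: enc_unary_def)

lemma fn_Caps [simp]: "fn Caps (ee k es) = Some (en (map (\<lambda>(u, v). k u v) es))"
proof (induction es)
  case (Cons e es)
  obtain a b where e: "e = (a, b)" by force
  show ?case by (subst fn_unfold) (simp add: body.simps e Cons.IH)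
qed (subst fn_unfold, simp add: body.simps)

lemma fn_Zero [simp]: "fn Zero (enc_list f es) = Some (en (replicate (length es) 0))"
  by (induction es) (subst fn_unfold, simp add: body.simps)+

lemma fn_Mvec [simp]:
  "fn Mvec (en R ;; ee k es) = Some (en (map (\<lambda>(a, b). of_bool (a \<in> set R \<or> b \<in> set R)) es))"
proof (induction es)
  case (Cons e es)
  obtain a b where e: "e = (a, b)" by force
  show ?case by (subst fn_unfold) (simp add: body.simps e Cons.IH)
qed (subst fn_unfold, simp add: body.simps)

section \<open>Cost bounds\<close>

text \<open>
  A single number \<open>B\<close> bounds the lengths of all lists and the numbers of bits of all numbers that
  occur in a run, so that costs are bounded by powers of \<open>B\<close>; the exponents are generous.
\<close>

locale budget =
  fixes B :: nat
  assumes B: "100 \<le> B"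
begin

lemma B_pow: "100 * B ^ k \<le> B ^ Suc k"
  using B by simp

text \<open>Given to \<open>linarith\<close>, these absorb the numeric constants and lower powers
  that each cost recurrence leaves behind.\<close>

lemma B_pows:
  "100 * B \<le> B ^ 2" "100 * B ^ 2 \<le> B ^ 3" "100 * B ^ 3 \<le> B ^ 4" "100 * B ^ 4 \<le> B ^ 5"
  "100 * B ^ 5 \<le> B ^ 6" "100 * B ^ 6 \<le> B ^ 7" "100 * B ^ 7 \<le> B ^ 8" "100 * B ^ 8 \<le> B ^ 9"
  "100 * B ^ 9 \<le> B ^ 10" "100 * B ^ 10 \<le> B ^ 11" "100 * B ^ 11 \<le> B ^ 12"
  "100 * B ^ 12 \<le> B ^ 13" "100 * B ^ 13 \<le> B ^ 14" "100 * B ^ 14 \<le> B ^ 15"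
  "100 * B ^ 15 \<le> B ^ 16" "100 * B ^ 16 \<le> B ^ 17" "100 * B ^ 17 \<le> B ^ 18"
  using B_pow[of 1] B_pow[of 2] B_pow[of 3] B_pow[of 4] B_pow[of 5] B_pow[of 6] B_pow[of 7] B_pow[of 8] 
    B_pow[of 9] B_pow[of 10] B_pow[of 11] B_pow[of 12] B_pow[of 13] B_pow[of 14] B_pow[of 15] B_pow[of 16] B_pow[of 17]
  by (simp_all only: Suc_1 Suc_numeral add_num_simps power_one_right)

text \<open>A loop costs one more power of \<open>B\<close> than its body; the summand 1 is the
  final call, on the empty list or the counter 0.\<close>

lemma loop_le: "n < B \<Longrightarrow> B ^ k * (n + 1) \<le> B ^ Suc k"
  by (simp add: mult.commute flip: power_Suc2) (metis Suc_leI mult.commute mult_le_mono2 mult_Suc)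

abbreviation sn :: "nat \<Rightarrow> bool" where "sn n \<equiv> n < 2 ^ B"
definition sl :: "nat list \<Rightarrow> bool" where
  "sl A \<longleftrightarrow> length A < B \<and> (\<forall>x \<in> set A. sn x)"
definition se :: "(nat \<times> nat) list \<Rightarrow> bool" where
  "se es \<longleftrightarrow> length es < B \<and> (\<forall>(a, b) \<in> set es. sn a \<and> sn b)"

lemma sl_simps [simp]: "sl (a # A) \<longleftrightarrow> sn a \<and> Suc (length A) < B \<and> sl A" "sl []"
  using B by (auto simp: sl_def)
lemma se_simps [simp]:
  "se ((a, b) # es) \<longleftrightarrow> sn a \<and> sn b \<and> Suc (length es) < B \<and> se es" "se []"
  using B by (auto simp: se_def)
lemma sl_length: "sl A \<Longrightarrow> length A < B" by (simp add: sl_def)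
lemma se_length: "se es \<Longrightarrow> length es < B" by (simp add: se_def)
lemma sl_filter: "sl A \<Longrightarrow> sl (filter P A)"
  unfolding sl_def by (auto intro: le_less_trans[OF length_filter_le])
lemma sl_expd: "sl A \<Longrightarrow> sl (expd es A R)"
  unfolding expd_def by (rule sl_filter)

lemma less_B_small: "n \<le> B \<Longrightarrow> sn n"
  by (meson le_less_trans less_exp)

lemma bits_le: "sn n \<Longrightarrow> floorlog 2 n \<le> B"
  by (rule floorlog_leI) auto

lemma bits_0_1 [simp]: "floorlog 2 0 = 0" "floorlog 2 (Suc 0) = 1"
  by (simp_all add: floorlog_def)

lemma neq_cost_le: "sn m \<Longrightarrow> sn n \<Longrightarrow> neq_cost m n \<le> 5 + 6 * B"
  using bits_le[of m] bits_le[of n] bits_le[of "m - n"] bits_le[of "n - m"]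
  by (simp add: neq_cost_def less_imp_diff_less)

lemma ct_Mem_aux: "sn x \<Longrightarrow> sl A \<Longrightarrow> ct Mem (VNum x ;; en A) \<le> B ^ 2 * (length A + 1)"
proof (induction A)
  case Nil
  show ?case using B B_pows(1) by (subst ct_unfold[OF fn_Mem]) (simp add: body.simps)
next
  case (Cons a A)
  have "ct Mem (VNum x ;; en (a # A)) \<le> 30 + neq_cost x a + ct Mem (VNum x ;; en A)"
    by (subst ct_unfold[OF fn_Mem]) (simp add: body.simps)
  then show ?case using B B_pows(1) Cons neq_cost_le[of x a] by (simp add: algebra_simps)
qed

lemma ct_Mem: "sn x \<Longrightarrow> sl A \<Longrightarrow> ct Mem (VNum x ;; en A) \<le> B ^ 3"
  using ct_Mem_aux[of x A] loop_le[of "length A" 2] sl_length[of A] by simp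

lemma ct_Diff: "sl S \<Longrightarrow> sl A \<Longrightarrow> ct Diff (en S ;; en A) \<le> B ^ 5"
proof -
  assume S: "sl S"
  have "sl A \<Longrightarrow> ct Diff (en S ;; en A) \<le> B ^ 4 * (length A + 1)"
  proof (induction A)
    case Nil
    show ?case using B B_pows by (subst ct_unfold[OF fn_Diff]) (simp add: body.simps)
  next
    case (Cons a A)
    have "ct Diff (en S ;; en (a # A)) \<le> 40 + ct Mem (VNum a ;; en S) + ct Diff (en S ;; en A)"
      by (subst ct_unfold[OF fn_Diff]) (simp add: body.simps)
    then show ?case using B B_pows Cons ct_Mem[of a S] S by (simp add: algebra_simps)
  qed
  then show "sl A \<Longrightarrow> ct Diff (en S ;; en A) \<le> B ^ 5"
    using loop_le[of "length A" 4] sl_length[of A] by simp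
qed

end

context budget begin

lemma bits_of_bool [simp]: "floorlog 2 (of_bool b) = of_bool b"
  by (cases b) simp_all

text \<open>In the step, \<open>ys\<close> is any shorter list with entries from \<open>xs\<close>
  rather than a suffix: the size conditions on \<open>xs\<close> carry over to such lists without
  further bookkeeping.\<close>

lemma list_cost:
  assumes "length xs < B" "c [] \<le> B ^ k"
    "\<And>x ys. x \<in> set xs \<Longrightarrow> set ys \<subseteq> set xs \<Longrightarrow> length ys < length xs \<Longrightarrow> c (x # ys) \<le> B ^ k + c ys"
  shows "c xs \<le> B ^ Suc k"
proof -
  have "set ys \<subseteq> set xs \<Longrightarrow> length ys \<le> length xs \<Longrightarrow> c ys \<le> B ^ k * (length ys + 1)" for ys
  proof (induction ys)
    case (Cons y ys)
    then show ?case using assms(3)[of y ys] by (simp add: algebra_simps)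
  qed (use assms(2) in simp)
  from this[of xs] loop_le[OF assms(1), of k] show ?thesis by simp
qed

lemma sl_subset: "sl A \<Longrightarrow> set S \<subseteq> set A \<Longrightarrow> length S \<le> length A \<Longrightarrow> sl S"
  by (auto simp: sl_def)

lemma ct_Touch:
  assumes "sn v" "sl R" "se es"
  shows "ct Touch (VNum v ;; en R ;; ee k es) \<le> B ^ 5"
proof (rule list_cost[of es "\<lambda>es. ct Touch (VNum v ;; en R ;; ee k es)" 4, simplified])
  show "length es < B" using assms se_length by blast
  show "ct Touch (VNum v ;; en R ;; VNum 0) \<le> B ^ 4"
    using B B_pows ct_Mem[of v R] assms ct_unfold[OF fn_Touch[of v R k "[]"]] by (simp add: body.simps)
next
  fix x :: "nat \<times> nat" and ys :: "(nat \<times> nat) list"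
  assume x: "x \<in> set es"
  obtain a b where e: "x = (a, b)" by force
  have sm: "sn a" "sn b" using x e assms(3) by (auto simp: se_def)
  have "ct Touch (VNum v ;; en R ;; ee k (x # ys)) \<le> 80 + neq_cost a v + neq_cost b v
    + ct Mem (VNum a ;; en R) + ct Mem (VNum b ;; en R) + ct Touch (VNum v ;; en R ;; ee k ys)"
    unfolding e by (subst ct_unfold[OF fn_Touch]) (simp add: body.simps)
  then show "ct Touch (VNum v ;; en R ;; (case x of (u, v) \<Rightarrow> VNum u ;; VNum v ;; enc_unary (k u v)) ;; ee k ys)
      \<le> B ^ 4 + ct Touch (VNum v ;; en R ;; ee k ys)"
    using B B_pows ct_Mem[OF sm(1) assms(2)] ct_Mem[OF sm(2) assms(2)] sm assms(1)
      neq_cost_le[of a v] neq_cost_le[of b v] by (simp add: e)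
qed

lemma ct_Expand:
  assumes "sl A" "sl R" "se es"
  shows "ct Expand (en R ;; ee k es ;; en A) \<le> B ^ 7"
proof (rule list_cost[of A "\<lambda>A. ct Expand (en R ;; ee k es ;; en A)" 6, simplified])
  show "length A < B" using assms sl_length by blast
  show "ct Expand (en R ;; ee k es ;; VNum 0) \<le> B ^ 6"
    using B B_pows ct_unfold[OF fn_Expand[of R k es "[]"]] by (simp add: body.simps)
next
  fix x ys
  assume x: "x \<in> set A"
  have "ct Expand (en R ;; ee k es ;; en (x # ys)) \<le> 80 + ct Touch (VNum x ;; en R ;; ee k es) +
     ct Expand (en R ;; ee k es ;; en ys)"
    by (subst ct_unfold[OF fn_Expand]) (simp add: body.simps)
  then show "ct Expand (en R ;; ee k es ;; VNum x ;; en ys)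
      \<le> B ^ 6 + ct Expand (en R ;; ee k es ;; en ys)"
    using B B_pows ct_Touch[of x R es k] assms x by (simp add: sl_def)
qed

lemma ct_Iter_aux:
  assumes "sl A" "se es"
  shows "sl R \<Longrightarrow> n < B \<Longrightarrow> ct Iter (VNum n ;; en R ;; ee k es ;; en A) \<le> B ^ 8 * (n + 1)"
proof (induction n arbitrary: R)
  case 0
  show ?case using B B_pows by (subst ct_unfold[OF fn_Iter]) (simp add: body.simps)
next
  case (Suc n)
  have "ct Iter (VNum (Suc n) ;; en R ;; ee k es ;; en A) \<le> 40 + floorlog 2 (Suc n)
      + ct Expand (en R ;; ee k es ;; en A) + ct Iter (VNum n ;; en (expd es A R) ;; ee k es ;; en A)"
    by (subst ct_unfold[OF fn_Iter]) (simp add: body.simps)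
  also have "ct Iter (VNum n ;; en (expd es A R) ;; ee k es ;; en A) \<le> B ^ 8 * (n + 1)"
    using Suc sl_expd[OF assms(1)] by simp
  finally show ?case using ct_Expand[OF assms(1) Suc.prems(1) assms(2), of k] B B_pows
      bits_le[OF less_B_small[of "Suc n"]] Suc.prems(2) by (simp add: algebra_simps)
qed

lemma ct_Iter:
  assumes "sl A" "se es" "sl R" "n < B"
  shows "ct Iter (VNum n ;; en R ;; ee k es ;; en A) \<le> B ^ 9"
  using ct_Iter_aux[OF assms(1,2,3,4), of k] loop_le[OF assms(4), of 8] by simp

lemma ct_Len:
  fixes f :: "'x \<Rightarrow> val"
  assumes "length A < B"
  shows "ct Len (enc_list f A) \<le> B ^ 3"
proof (rule list_cost[of A "\<lambda>A. ct Len (enc_list f A)" 2, simplified])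
  show "ct Len (VNum 0) \<le> B\<^sup>2"
    using B B_pows ct_unfold[OF fn_Len[of f "[]"]] by (simp add: body.simps)
next
  fix x and ys :: "'x list" assume "length ys < length A"
  then have sm: "sn (length ys)" using assms by (intro less_B_small) simp
  have "ct Len (enc_list f (x # ys)) \<le> 20 + floorlog 2 (length ys) + ct Len (enc_list f ys)"
    by (subst ct_unfold[OF fn_Len]) (simp add: body.simps)
  then show "ct Len (f x ;; enc_list f ys) \<le> B\<^sup>2 + ct Len (enc_list f ys)"
    using B B_pows(1) bits_le[OF sm] by simp
qed (rule assms)

lemma ecut_le: "ecut es X \<le> length es"
  by (simp add: ecut_def)

lemma ct_Cut:
  assumes "sl X" "se es"
  shows "ct Cut (en X ;; ee k es) \<le> B ^ 5"
proof (rule list_cost[of es "\<lambda>es. ct Cut (en X ;; ee k es)" 4, simplified])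
  show "length es < B" using assms se_length by blast
  show "ct Cut (en X ;; VNum 0) \<le> B ^ 4"
    using B B_pows ct_unfold[OF fn_Cut[of X k "[]"]] by (simp add: body.simps)
next
  fix x :: "nat \<times> nat" and ys :: "(nat \<times> nat) list"
  assume x: "x \<in> set es" and l: "length ys < length es"
  obtain a b where e: "x = (a, b)" by force
  have sm: "sn a" "sn b" using x e assms(2) by (auto simp: se_def)
  have sc: "sn (ecut ys (set X))"
    using ecut_le[of ys "set X"] l assms(2) by (intro less_B_small) (simp add: se_def)
  have b1: "sn (of_bool b)" for b using less_B_small[of "of_bool b"] B by (cases b) auto
  have "ct Cut (en X ;; ee k (x # ys)) \<le> 81 + neq_cost (of_bool (a \<in> set X)) (of_bool (b \<in> set X))
    + 2 * ct Mem (VNum a ;; en X) + 2 * ct Mem (VNum b ;; en X) + floorlog 2 (ecut ys (set X))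
    + ct Cut (en X ;; ee k ys)"
    unfolding e by (subst ct_unfold[OF fn_Cut]) (simp add: body.simps)
  then show "ct Cut (en X ;; (case x of (u, v) \<Rightarrow> VNum u ;; VNum v ;; enc_unary (k u v)) ;; ee k ys)
      \<le> B ^ 4 + ct Cut (en X ;; ee k ys)"
    using B B_pows ct_Mem[OF sm(1) assms(1)] ct_Mem[OF sm(2) assms(1)]
      neq_cost_le[OF b1 b1, of "a \<in> set X" "b \<in> set X"] bits_le[OF sc] by (simp add: e)
qed

lemma ct_Cutok:
  assumes "length ps < B" "\<forall>p \<in> set ps. sl p" "se es" "n < B"
  shows "ct Cutok (VNum n ;; ee k es ;; enc_list en ps) \<le> B ^ 7"
proof (rule list_cost[of ps "\<lambda>ps. ct Cutok (VNum n ;; ee k es ;; enc_list en ps)" 6, simplified])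
  show "ct Cutok (VNum n ;; ee k es ;; VNum 0) \<le> B ^ 6"
    using B B_pows ct_unfold[OF fn_Cutok[of n k es "[]"]] by (simp add: body.simps)
next
  fix x and ys :: "nat list list"
  assume x: "x \<in> set ps"
  have sc: "sn (ecut es (set x))" "sn n"
    using ecut_le[of es "set x"] assms(3,4) by (auto intro!: less_B_small simp: se_def)
  have "ct Cutok (VNum n ;; ee k es ;; enc_list en (x # ys)) \<le> 80 + ct Cut (en x ;; ee k es)
    + floorlog 2 n + floorlog 2 (ecut es (set x)) + ct Cutok (VNum n ;; ee k es ;; enc_list en ys)"
    by (subst ct_unfold[OF fn_Cutok]) (simp add: body.simps)
  then show "ct Cutok (VNum n ;; ee k es ;; en x ;; enc_list en ys)
      \<le> B ^ 6 + ct Cutok (VNum n ;; ee k es ;; enc_list en ys)"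
    using B B_pows ct_Cut[of x es k] assms x bits_le[OF sc(1)] bits_le[OF sc(2)] by simp
qed (rule assms(1))

lemma ct_Check:
  assumes "ps \<noteq> []" "length ps < B" "\<forall>p \<in> set ps. sl p" "se es" "n < B"
  shows "ct Check (VNum n ;; ee k es ;; enc_list en ps) \<le> B ^ 8"
proof -
  obtain p qs where ps: "ps = p # qs" using assms by (cases ps) auto
  have "ct Check (VNum n ;; ee k es ;; enc_list en ps)
      \<le> 80 + ct Cutok (VNum n ;; ee k es ;; enc_list en ps)"
    using fn_Cutok[of n k es ps] 
    by (subst ct_unfold[OF fn_Check[OF assms(1)]]) (simp add: body.simps ps del: fn_Cutok)
  then show ?thesis using ct_Cutok[OF assms(2-5), of k] B B_pows by simp
qed

lemma ct_Caps:
  assumes "length es < B" "\<forall>(u, v) \<in> set es. k u v < B"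
  shows "ct Caps (ee k es) \<le> B ^ 5"
proof (rule list_cost[of es "\<lambda>es. ct Caps (ee k es)" 4, simplified])
  show "ct Caps (VNum 0) \<le> B ^ 4"
    using B B_pows ct_unfold[OF fn_Caps[of k "[]"]] by (simp add: body.simps)
next
  fix x :: "nat \<times> nat" and ys :: "(nat \<times> nat) list"
  assume x: "x \<in> set es"
  obtain a b where e: "x = (a, b)" by force
  have "ct Caps (ee k (x # ys)) \<le> 30 + ct Len (enc_unary (k a b)) + ct Caps (ee k ys)"
    unfolding e by (subst ct_unfold[OF fn_Caps]) (simp add: body.simps)
  then show "ct Caps ((case x of (u, v) \<Rightarrow> VNum u ;; VNum v ;; enc_unary (k u v)) ;; ee k ys)
      \<le> B ^ 4 + ct Caps (ee k ys)"
    using B B_pows assms(2) x ct_Len[of "replicate (k a b) 0" VNum] e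
    by (auto simp: enc_unary_def)
qed (rule assms(1))

lemma ct_Zero:
  fixes f :: "'x \<Rightarrow> val"
  assumes "length es < B"
  shows "ct Zero (enc_list f es) \<le> B ^ 3"
proof (rule list_cost[of es "\<lambda>es. ct Zero (enc_list f es)" 2, simplified])
  show "ct Zero (VNum 0) \<le> B\<^sup>2"
    using B B_pows ct_unfold[OF fn_Zero[of f "[]"]] by (simp add: body.simps)
next
  fix x and ys :: "'x list"
  have "ct Zero (enc_list f (x # ys)) \<le> 30 + ct Zero (enc_list f ys)"
    by (subst ct_unfold[OF fn_Zero]) (simp add: body.simps)
  then show "ct Zero (f x ;; enc_list f ys) \<le> B\<^sup>2 + ct Zero (enc_list f ys)"
    using B B_pows(1) by simp
qed (rule assms)

lemma ct_Mvec:
  assumes "sl R" "se es"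
  shows "ct Mvec (en R ;; ee k es) \<le> B ^ 5"
proof (rule list_cost[of es "\<lambda>es. ct Mvec (en R ;; ee k es)" 4, simplified])
  show "length es < B" using assms se_length by blast
  show "ct Mvec (en R ;; VNum 0) \<le> B ^ 4"
    using B B_pows ct_unfold[OF fn_Mvec[of R k "[]"]] by (simp add: body.simps)
next
  fix x :: "nat \<times> nat" and ys :: "(nat \<times> nat) list"
  assume x: "x \<in> set es"
  obtain a b where e: "x = (a, b)" by force
  have sm: "sn a" "sn b" using x e assms(2) by (auto simp: se_def)
  have "ct Mvec (en R ;; ee k (x # ys)) \<le> 80
    + ct Mem (VNum a ;; en R) + ct Mem (VNum b ;; en R) + ct Mvec (en R ;; ee k ys)"
    unfolding e by (subst ct_unfold[OF fn_Mvec]) (simp add: body.simps)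
  then show "ct Mvec (en R ;; (case x of (u, v) \<Rightarrow> VNum u ;; VNum v ;; enc_unary (k u v)) ;; ee k ys)
      \<le> B ^ 4 + ct Mvec (en R ;; ee k ys)"
    using B B_pows ct_Mem[OF sm(1) assms(1)] ct_Mem[OF sm(2) assms(1)] by (simp add: e)
qed

end

section \<open>Tables\<close>

type_synonym tab = "(nat list \<times> nat) list"

abbreviation tb :: "tab \<Rightarrow> val" where
  "tb \<equiv> enc_list (\<lambda>(u, p). en u ;; VNum p)"

abbreviation vadd :: "nat list \<Rightarrow> nat list \<Rightarrow> nat list" where "vadd \<equiv> map2 (+)"
abbreviation vle :: "nat list \<Rightarrow> nat list \<Rightarrow> bool" where "vle \<equiv> list_all2 (\<le>)"
abbreviation vmask :: "nat list \<Rightarrow> nat list \<Rightarrow> nat list" where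
  "vmask \<equiv> map2 (\<lambda>m x. if m = 0 then 0 else x)"

text \<open>The pair has to match in its listed orientation; \<open>wloop\<close> passes each edge
  as listed, whichever end point the walk leaves from.\<close>

definition bump :: "nat \<Rightarrow> nat \<Rightarrow> nat \<Rightarrow> (nat \<times> nat) list \<Rightarrow> nat list \<Rightarrow> nat list" where
  "bump a b d = map2 (\<lambda>e x. if e = (a, b) then x + d else x)"

primrec ins :: "nat list \<Rightarrow> nat \<Rightarrow> tab \<Rightarrow> tab" where
  "ins u p [] = [(u, p)]"
| "ins u p (x # xs) = (if u = fst x then (u, max p (snd x)) # xs else x # ins u p xs)"

definition tryins :: "nat list \<Rightarrow> nat list \<Rightarrow> nat \<Rightarrow> tab \<Rightarrow> tab" where
  "tryins cs u p T = (if vle u cs then ins u p T else T)"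

primrec join1 :: "nat list \<Rightarrow> nat list \<times> nat \<Rightarrow> tab \<Rightarrow> tab \<Rightarrow> tab" where
  "join1 cs x [] acc = acc"
| "join1 cs x (y # T) acc = join1 cs x T (tryins cs (vadd (fst x) (fst y)) (snd x + snd y) acc)"

primrec join :: "nat list \<Rightarrow> tab \<Rightarrow> tab \<Rightarrow> tab \<Rightarrow> tab" where
  "join cs T2 [] acc = acc"
| "join cs T2 (x # T) acc = join cs T2 T (join1 cs x T2 acc)"

primrec mask :: "nat list \<Rightarrow> tab \<Rightarrow> tab \<Rightarrow> tab" where
  "mask mv [] acc = acc"
| "mask mv (x # T) acc = mask mv T (ins (vmask mv (fst x)) (snd x) acc)"

abbreviation walk_arg :: "(nat \<Rightarrow> nat \<Rightarrow> nat) \<Rightarrow> (nat \<times> nat) list \<Rightarrow> nat list \<Rightarrow> nat \<Rightarrow> nat \<Rightarrow> nat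
    \<Rightarrow> nat \<Rightarrow> nat \<Rightarrow> nat list \<Rightarrow> tab \<Rightarrow> val" where
  "walk_arg k es cs t d w n c u acc \<equiv>
    VNum n ;; VNum c ;; VNum t ;; VNum d ;; VNum w ;; en cs ;; ee k es ;; en u ;; tb acc"

text \<open>
  \<open>wset n c u\<close> contains \<open>u\<close> plus the usage of each walk from \<open>c\<close> to \<open>t\<close> of length at most \<open>n\<close>.
  Walks can replace paths because shortcutting a walk to a path does not increase the usage.
\<close>

context
  fixes es :: "(nat \<times> nat) list" and cs :: "nat list" and t d w :: nat
begin

primrec wloop :: "(nat \<Rightarrow> nat list \<Rightarrow> tab \<Rightarrow> tab) \<Rightarrow> nat \<Rightarrow> nat list \<Rightarrow> (nat \<times> nat) list \<Rightarrow> tab \<Rightarrow> tab" where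
  "wloop f c u [] acc = acc"
| "wloop f c u (e # fs) acc = wloop f c u fs
    (if fst e = c then f (snd e) (bump (fst e) (snd e) d es u) acc
     else if snd e = c then f (fst e) (bump (fst e) (snd e) d es u) acc else acc)"

primrec walk :: "nat \<Rightarrow> nat \<Rightarrow> nat list \<Rightarrow> tab \<Rightarrow> tab" where
  "walk 0 c u acc = (if c = t then tryins cs u w acc else acc)"
| "walk (Suc n) c u acc =
    wloop (walk n) c u es (if c = t then tryins cs u w acc else acc)"

primrec wset :: "nat \<Rightarrow> nat \<Rightarrow> nat list \<Rightarrow> nat list set" where
  "wset 0 c u = (if c = t then {u} else {})"
| "wset (Suc n) c u = (if c = t then {u} else {}) \<union>
    {v. \<exists>(a, b) \<in> set es. (a = c \<and> v \<in> wset n b (bump a b d es u)) \<or>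
      (a \<noteq> c \<and> b = c \<and> v \<in> wset n a (bump a b d es u))}"

end

text \<open>The functions on vectors recurse on one of their two lists; with equal lengths they
  neither get stuck nor drop entries.\<close>

definition wt :: "nat \<Rightarrow> tab \<Rightarrow> bool" where
  "wt m T \<longleftrightarrow> (\<forall>x \<in> set T. length (fst x) = m)"

lemma wt_simps [simp]: "wt m []" "wt m (x # T) \<longleftrightarrow> length (fst x) = m \<and> wt m T"
  by (auto simp: wt_def)

lemma length_bump [simp]: "length (bump a b d es u) = min (length es) (length u)"
  by (simp add: bump_def)

lemma wt_ins [simp]: "length u = m \<Longrightarrow> wt m T \<Longrightarrow> wt m (ins u p T)"
  by (induction T) auto
lemma wt_tryins [simp]: "length u = m \<Longrightarrow> wt m T \<Longrightarrow> wt m (tryins cs u p T)"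
  by (simp add: tryins_def)
lemma wt_join1 [simp]: "length (fst x) = m \<Longrightarrow> wt m T \<Longrightarrow> wt m acc \<Longrightarrow> wt m (join1 cs x T acc)"
  by (induction T arbitrary: acc) auto
lemma wt_join [simp]: "wt m T2 \<Longrightarrow> wt m T \<Longrightarrow> wt m acc \<Longrightarrow> wt m (join cs T2 T acc)"
  by (induction T arbitrary: acc) auto
lemma wt_mask [simp]: "length mv = m \<Longrightarrow> wt m T \<Longrightarrow> wt m acc \<Longrightarrow> wt m (mask mv T acc)"
  by (induction T arbitrary: acc) auto

lemma wt_wloop:
  assumes "\<And>c u acc. length u = length es \<Longrightarrow> wt (length es) acc \<Longrightarrow> wt (length es) (f c u acc)"
  shows "length u = length es \<Longrightarrow> wt (length es) acc \<Longrightarrow> wt (length es) (wloop es d f c u fs acc)"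
  by (induction fs arbitrary: acc) (auto simp: assms)

lemma wt_walk [simp]:
  "length u = length es \<Longrightarrow> wt (length es) acc \<Longrightarrow> wt (length es) (walk es cs t d w n c u acc)"
  by (induction n arbitrary: c u acc) (auto intro!: wt_wloop)

section \<open>Values of the functions on tables\<close>

lemma fn_Vadd [simp]: "length a = length b \<Longrightarrow> fn Vadd (en a ;; en b) = Some (en (vadd a b))"
  by (induction a b rule: list_induct2) (subst fn_unfold, simp add: body.simps)+

lemma fn_Vle [simp]: "length a = length b \<Longrightarrow> fn Vle (en a ;; en b) = Some (bl (vle a b))"
  by (induction a b rule: list_induct2) (subst fn_unfold, simp add: body.simps)+

lemma fn_Veq [simp]: "length a = length b \<Longrightarrow> fn Veq (en a ;; en b) = Some (bl (a = b))"
  by (induction a b rule: list_induct2) (subst fn_unfold, simp add: body.simps)+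

lemma fn_Vmask [simp]: "length a = length b \<Longrightarrow> fn Vmask (en a ;; en b) = Some (en (vmask a b))"
  by (induction a b rule: list_induct2) (subst fn_unfold, simp add: body.simps)+

text \<open>\<open>Ins\<close> computes the maximum of \<open>p\<close> and \<open>q\<close> as
  \<open>p + (q - p)\<close> with truncated subtraction.\<close>

lemma fn_Ins [simp]:
  "length u = m \<Longrightarrow> wt m T \<Longrightarrow> fn Ins (en u ;; VNum p ;; tb T) = Some (tb (ins u p T))"
proof (induction T)
  case (Cons x T)
  obtain v q where x: "x = (v, q)" by force
  from Cons show ?case by (subst fn_unfold) (simp add: body.simps x max_def)
qed (subst fn_unfold, simp add: body.simps)

lemma fn_Try [simp]:
  "length u = m \<Longrightarrow> length cs = m \<Longrightarrow> wt m T \<Longrightarrow>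
    fn Try (en u ;; VNum p ;; en cs ;; tb T) = Some (tb (tryins cs u p T))"
  by (subst fn_unfold) (simp add: body.simps tryins_def)

lemma fn_Join1 [simp]:
  "length u = m \<Longrightarrow> length cs = m \<Longrightarrow> wt m acc \<Longrightarrow> wt m T \<Longrightarrow>
    fn Join1 (en u ;; VNum p ;; en cs ;; tb acc ;; tb T) = Some (tb (join1 cs (u, p) T acc))"
proof (induction T arbitrary: acc)
  case (Cons x T)
  obtain v q where x: "x = (v, q)" by force
  from Cons show ?case by (subst fn_unfold) (simp add: body.simps x)
qed (subst fn_unfold, simp add: body.simps)

lemma fn_Join [simp]:
  "length cs = m \<Longrightarrow> wt m acc \<Longrightarrow> wt m T2 \<Longrightarrow> wt m T \<Longrightarrow>
    fn Join (en cs ;; tb acc ;; tb T2 ;; tb T) = Some (tb (join cs T2 T acc))"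
proof (induction T arbitrary: acc)
  case (Cons x T)
  obtain v q where x: "x = (v, q)" by force
  from Cons show ?case by (subst fn_unfold) (simp add: body.simps x)
qed (subst fn_unfold, simp add: body.simps)

lemma fn_Mask [simp]:
  "length mv = m \<Longrightarrow> wt m acc \<Longrightarrow> wt m T \<Longrightarrow>
    fn Mask (en mv ;; tb acc ;; tb T) = Some (tb (mask mv T acc))"
proof (induction T arbitrary: acc)
  case (Cons x T)
  obtain v q where x: "x = (v, q)" by force
  from Cons show ?case by (subst fn_unfold) (simp add: body.simps x)
qed (subst fn_unfold, simp add: body.simps)

lemma fn_Bump [simp]:
  "length u = length es \<Longrightarrow>
    fn Bump (VNum a ;; VNum b ;; VNum d ;; ee k es ;; en u) = Some (en (bump a b d es u))"
proof (induction u es rule: list_induct2)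
  case (Cons x u e es)
  obtain v q where x: "e = (v, q)" by force
  from Cons show ?case by (subst fn_unfold) (auto simp: body.simps x bump_def)
qed (subst fn_unfold, simp add: body.simps bump_def)

text \<open>\<open>Walk\<close> and \<open>Wloop\<close> call each other. Here the inner
  \<open>Walk\<close> is an arbitrary \<open>f\<close>, so that the induction over the edges is
  finished before the induction over the length of walks in \<open>fn_Walk\<close> supplies
  \<open>walk\<close> for \<open>f\<close>.\<close>

lemma fn_Wloop:
  assumes IH: "\<And>c u acc. length u = length es \<Longrightarrow> wt (length es) acc \<Longrightarrow>
      fn Walk (walk_arg k es cs t d w n c u acc)
      = Some (tb (f c u acc))"
    and wt: "\<And>c u acc. length u = length es \<Longrightarrow> wt (length es) acc \<Longrightarrow> wt (length es) (f c u acc)"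
    and u: "length u = length es"
  shows "wt (length es) acc \<Longrightarrow> fn Wloop (ee k fs ;; walk_arg k es cs t d w n c u acc) = Some (tb (wloop es d f c u fs acc))"
proof (induction fs arbitrary: acc)
  case (Cons e fs)
  obtain a b where e: "e = (a, b)" by force
  from Cons show ?case by (subst fn_unfold) (simp add: body.simps e IH wt u)
qed (subst fn_unfold, simp add: body.simps)

lemma fn_Walk [simp]:
  "length cs = length es \<Longrightarrow> length u = length es \<Longrightarrow> wt (length es) acc \<Longrightarrow>
    fn Walk (walk_arg k es cs t d w n c u acc)
      = Some (tb (walk es cs t d w n c u acc))"
proof (induction n arbitrary: c u acc)
  case 0
  then show ?case by (subst fn_unfold) (simp add: body.simps)
next
  case (Suc n)
  from Suc.prems show ?case
    by (subst fn_unfold) (simp add: body.simps fn_Wloop[OF Suc.IH wt_walk])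
qed

text \<open>
  \<open>T\<close> is \<open>acc\<close> with the entries \<open>S\<close> inserted, up to entries dominated by a larger profit.
\<close>

definition tabrel :: "tab \<Rightarrow> (nat list \<times> nat) set \<Rightarrow> tab \<Rightarrow> bool" where
  "tabrel acc S T \<longleftrightarrow> (distinct (map fst acc) \<longrightarrow> distinct (map fst T)) \<and>
    set T \<subseteq> set acc \<union> S \<and> (\<forall>(u, p) \<in> set acc \<union> S. \<exists>p' \<ge> p. (u, p') \<in> set T)"

lemma tabrel_refl [simp]: "tabrel T {} T"
  by (auto simp: tabrel_def)

lemma tabrel_trans:
  assumes "tabrel acc S T" "tabrel T S' T'"
  shows "tabrel acc (S \<union> S') T'"
  unfolding tabrel_def
proof (intro conjI ballI)
  show "distinct (map fst acc) \<longrightarrow> distinct (map fst T')" "set T' \<subseteq> set acc \<union> (S \<union> S')"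
    using assms by (auto simp: tabrel_def)
  fix x assume x: "x \<in> set acc \<union> (S \<union> S')"
  obtain u p where up: "x = (u, p)" by force
  have "\<exists>p1\<ge>p. (u, p1) \<in> set T \<union> S'"
    using x assms(1) unfolding up tabrel_def by fastforce
  then obtain p1 where p1: "p1 \<ge> p" "(u, p1) \<in> set T \<union> S'" by blast
  then obtain p2 where "p2 \<ge> p1" "(u, p2) \<in> set T'"
    using assms(2) unfolding tabrel_def by fastforce
  then show "case x of (u, p) \<Rightarrow> \<exists>p'\<ge>p. (u, p') \<in> set T'"
    using p1 up by (auto intro: le_trans)
qed

lemma tabrel_ins: "tabrel T {(u, p)} (ins u p T)"
proof -
  have key: "fst ` set (ins u p T) = insert u (fst ` set T)" for T
    by (induction T) auto
  have "distinct (map fst T) \<Longrightarrow> distinct (map fst (ins u p T))"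
  proof (induction T)
    case (Cons x T)
    then show ?case using key[of T] by auto
  qed simp
  moreover have "set (ins u p T) \<subseteq> set T \<union> {(u, p)}"
    by (induction T) (auto simp: max_def)
  moreover have "(v, q) \<in> set T \<Longrightarrow> \<exists>q' \<ge> q. (v, q') \<in> set (ins u p T)" for v q
  proof (induction T)
    case (Cons x T)
    then show ?case by (cases "u = fst x") (auto intro: max.cobounded2)
  qed simp
  moreover have "\<exists>q' \<ge> p. (u, q') \<in> set (ins u p T)"
  proof (induction T)
    case (Cons x T)
    then show ?case by (cases "u = fst x") (auto intro: max.cobounded1)
  qed auto
  ultimately show ?thesis unfolding tabrel_def by blast
qed

lemma tabrel_tryins: "tabrel T (if vle u cs then {(u, p)} else {}) (tryins cs u p T)"
  by (simp add: tryins_def tabrel_ins)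

lemma tabrel_join1:
  "tabrel acc {(vadd (fst x) v, snd x + q) | v q. (v, q) \<in> set T \<and> vle (vadd (fst x) v) cs}
    (join1 cs x T acc)"
proof (induction T arbitrary: acc)
  case (Cons y T)
  have eq: "{(vadd (fst x) v, snd x + q) | v q. (v, q) \<in> set (y # T) \<and> vle (vadd (fst x) v) cs} =
     (if vle (vadd (fst x) (fst y)) cs then {(vadd (fst x) (fst y), snd x + snd y)} else {}) \<union>
     {(vadd (fst x) v, snd x + q) | v q. (v, q) \<in> set T \<and> vle (vadd (fst x) v) cs}"
    by (cases y) auto
  show ?case unfolding eq join1.simps by (rule tabrel_trans[OF tabrel_tryins Cons.IH])
qed simp

definition joinset :: "nat list \<Rightarrow> tab \<Rightarrow> tab \<Rightarrow> (nat list \<times> nat) set" where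
  "joinset cs T2 T = {(vadd u v, p + q) | u p v q.
    (u, p) \<in> set T \<and> (v, q) \<in> set T2 \<and> vle (vadd u v) cs}"

lemma tabrel_join: "tabrel acc (joinset cs T2 T) (join cs T2 T acc)"
proof (induction T arbitrary: acc)
  case (Cons x T)
  have eq: "joinset cs T2 (x # T) =
     {(vadd (fst x) v, snd x + q) | v q. (v, q) \<in> set T2 \<and> vle (vadd (fst x) v) cs} \<union>
     joinset cs T2 T"
    unfolding joinset_def by (cases x) auto
  show ?case unfolding eq join.simps by (rule tabrel_trans[OF tabrel_join1 Cons.IH])
qed (simp add: joinset_def)

lemma tabrel_mask: "tabrel acc ((\<lambda>(u, p). (vmask mv u, p)) ` set T) (mask mv T acc)"
proof (induction T arbitrary: acc)
  case (Cons x T)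
  have eq: "(\<lambda>(u, p). (vmask mv u, p)) ` set (x # T) =
     {(vmask mv (fst x), snd x)} \<union> (\<lambda>(u, p). (vmask mv u, p)) ` set T"
    by (cases x) auto
  show ?case unfolding eq mask.simps by (rule tabrel_trans[OF tabrel_ins Cons.IH])
qed simp

definition walkset :: "nat list \<Rightarrow> nat \<Rightarrow> nat list set \<Rightarrow> (nat list \<times> nat) set" where
  "walkset cs w V = {(u, w) | u. u \<in> V \<and> vle u cs}"

lemma walkset_Un: "walkset cs w (V \<union> V') = walkset cs w V \<union> walkset cs w V'"
  by (auto simp: walkset_def)

lemma tabrel_wloop:
  assumes "\<And>c u acc. tabrel acc (walkset cs w (W c u)) (f c u acc)"
  shows "tabrel acc (walkset cs w {v. \<exists>(a, b) \<in> set fs. (a = c \<and> v \<in> W b (bump a b d es u)) \<or>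
      (a \<noteq> c \<and> b = c \<and> v \<in> W a (bump a b d es u))}) (wloop es d f c u fs acc)"
proof (induction fs arbitrary: acc)
  case Nil
  show ?case by (simp add: walkset_def)
next
  case (Cons e fs)
  obtain a b where e: "e = (a, b)" by force
  let ?S = "\<lambda>fs. {v. \<exists>(a, b) \<in> set fs. (a = c \<and> v \<in> W b (bump a b d es u)) \<or>
      (a \<noteq> c \<and> b = c \<and> v \<in> W a (bump a b d es u))}"
  let ?S1 = "if a = c then W b (bump a b d es u) else if b = c then W a (bump a b d es u) else {}"
  have eq: "?S (e # fs) = ?S1 \<union> ?S fs" by (auto simp: e)
  have 0: "walkset cs w {} = {}" by (simp add: walkset_def)
  have "tabrel acc (walkset cs w ?S1) (if fst e = c then f (snd e) (bump (fst e) (snd e) d es u) acc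
     else if snd e = c then f (fst e) (bump (fst e) (snd e) d es u) acc else acc)"
    using assms by (simp add: e 0)
  from tabrel_trans[OF this Cons.IH] show ?case unfolding eq walkset_Un wloop.simps .
qed

lemma tabrel_walk: "tabrel acc (walkset cs w (wset es t d n c u)) (walk es cs t d w n c u acc)"
proof (induction n arbitrary: c u acc)
  case 0
  then show ?case using tabrel_tryins[of acc u cs w] by (auto simp: walkset_def tryins_def)
next
  case (Suc n)
  have 1: "tabrel acc (walkset cs w (if c = t then {u} else {}))
      (if c = t then tryins cs u w acc else acc)" for acc
    using tabrel_tryins[of acc u cs w] by (auto simp: walkset_def tryins_def)
  show ?case unfolding walk.simps wset.simps walkset_Un
    by (rule tabrel_trans[OF 1 tabrel_wloop[OF Suc.IH]])
qed

text \<open>Distinct keys from a finite set are what bounds the length of tables, see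
  \<open>kt_length\<close>; no length is tracked through the operations.\<close>

definition kt :: "nat list set \<Rightarrow> nat \<Rightarrow> tab \<Rightarrow> bool" where
  "kt K W T \<longleftrightarrow> distinct (map fst T) \<and> fst ` set T \<subseteq> K \<and> (\<forall>x \<in> set T. snd x \<le> W)"

lemma fn_Wloop_walk [simp]:
  "length cs = length es \<Longrightarrow> length u = length es \<Longrightarrow> wt (length es) acc \<Longrightarrow>
    fn Wloop (ee k fs ;; walk_arg k es cs t d w n c u acc) = Some (tb (wloop es d (walk es cs t d w n) c u fs acc))"
  by (rule fn_Wloop[OF fn_Walk wt_walk])

lemma kt_tabrel:
  assumes "tabrel acc S T" "kt K W acc" "\<And>u p. (u, p) \<in> S \<Longrightarrow> u \<in> K \<and> p \<le> W"
  shows "kt K W T"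
  unfolding kt_def
proof (intro conjI)
  show "distinct (map fst T)" using assms(1,2) by (simp add: tabrel_def kt_def)
  have T: "set T \<subseteq> set acc \<union> S" using assms(1) by (simp add: tabrel_def)
  show "fst ` set T \<subseteq> K"
  proof
    fix u assume "u \<in> fst ` set T"
    then obtain p where "(u, p) \<in> set acc \<union> S" using T by force
    then show "u \<in> K" using assms(2,3) by (force simp: kt_def)
  qed
  show "\<forall>x \<in> set T. snd x \<le> W"
  proof
    fix x assume "x \<in> set T"
    then have "x \<in> set acc \<union> S" using T by blast
    then show "snd x \<le> W" using assms(2) assms(3)[of "fst x" "snd x"] by (auto simp: kt_def)
  qed
qed

lemma ktD: "kt K W T \<Longrightarrow> (u, p) \<in> set T \<Longrightarrow> u \<in> K \<and> p \<le> W"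
  unfolding kt_def by (metis fst_conv image_subset_iff snd_conv)

lemma kt_mono: "kt K W T \<Longrightarrow> K \<subseteq> K' \<Longrightarrow> W \<le> W' \<Longrightarrow> kt K' W' T"
  by (force simp: kt_def)

lemma kt_Nil [simp]: "kt K W []"
  by (simp add: kt_def)

section \<open>Costs of the functions on tables\<close>

context budget begin

text \<open>Entries of keys are below \<open>B\<close>. The sum of two may exceed all capacities,
  but it still has few bits when the capacity check inspects it.\<close>

lemma two_B: "2 * B \<le> 2 ^ B"
proof -
  have "2 * n \<le> 2 ^ n" if "2 \<le> n" for n :: nat
    using that by (induction n rule: dec_induct) auto
  then show ?thesis using B by simp
qed

definition keyset :: "nat \<Rightarrow> nat list set \<Rightarrow> bool" where
  "keyset m K \<longleftrightarrow> finite K \<and> card K < B \<and> m < B \<and> (\<forall>u \<in> K. length u = m \<and> (\<forall>x \<in> set u. x < B))"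

definition st :: "nat \<Rightarrow> tab \<Rightarrow> bool" where
  "st m T \<longleftrightarrow> (\<forall>x \<in> set T. length (fst x) = m \<and> sl (fst x) \<and> sn (snd x))"

lemma keyset_sl: "keyset m K \<Longrightarrow> u \<in> K \<Longrightarrow> sl u"
  by (auto simp: keyset_def sl_def intro: less_B_small less_imp_le)
lemma keyset_length: "keyset m K \<Longrightarrow> u \<in> K \<Longrightarrow> length u = m"
  by (auto simp: keyset_def)

lemma kt_length: "kt K W T \<Longrightarrow> keyset m K \<Longrightarrow> length T < B"
  using card_mono[of K "fst ` set T"] distinct_card[of "map fst T"]
  by (auto simp: kt_def keyset_def)

lemma kt_st: "kt K W T \<Longrightarrow> keyset m K \<Longrightarrow> sn W \<Longrightarrow> st m T"
  unfolding kt_def st_def using keyset_sl keyset_length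
  by (metis image_subset_iff le_less_trans)

lemma kt_wt: "kt K W T \<Longrightarrow> keyset m K \<Longrightarrow> wt m T"
  unfolding kt_def wt_def using keyset_length by (metis image_subset_iff)

lemma st_Cons [simp]: "st m (x # T) \<longleftrightarrow> length (fst x) = m \<and> sl (fst x) \<and> sn (snd x) \<and> st m T"
  by (auto simp: st_def)
lemma st_wt: "st m T \<Longrightarrow> wt m T" by (auto simp: st_def wt_def)

lemma vec_cost:
  assumes "length a = length b" "length a < B" "c [] [] \<le> B ^ 2"
    "\<And>x y a' b'. x \<in> set a \<Longrightarrow> y \<in> set b \<Longrightarrow> length a' = length b' \<Longrightarrow> c (x # a') (y # b') \<le> B ^ 2 + c a' b'"
  shows "c a b \<le> B ^ 3"
proof -
  have "set a' \<subseteq> set a \<Longrightarrow> set b' \<subseteq> set b \<Longrightarrow> c a' b' \<le> B ^ 2 * (length a' + 1)"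
    if "length a' = length b'" for a' b'
    using that
  proof (induction a' b' rule: list_induct2)
    case (Cons x a' y b')
    then show ?case using assms(4)[of x y a' b'] by (simp add: algebra_simps)
  qed (use assms(3) in simp)
  from this[of a b] assms(1) loop_le[OF assms(2), of 2] show ?thesis by simp
qed

lemma ct_Vadd:
  assumes "length a = length b" "sl a" "sl b"
  shows "ct Vadd (en a ;; en b) \<le> B ^ 3"
proof (rule vec_cost[where c = "\<lambda>a b. ct Vadd (en a ;; en b)"])
  show "ct Vadd (en [] ;; en []) \<le> B\<^sup>2"
    using B B_pows ct_unfold[OF fn_Vadd[of "[]" "[]"]] by (simp add: body.simps)
next
  fix x y :: nat and a' b' :: "nat list"
  assume xy: "x \<in> set a" "y \<in> set b" and l: "length a' = length b'"
  have "ct Vadd (en (x # a') ;; en (y # b')) \<le> 40 + floorlog 2 x + floorlog 2 y + ct Vadd (en a' ;; en b')"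
    using l by (subst ct_unfold[OF fn_Vadd]) (simp_all add: body.simps)
  then show "ct Vadd (en (x # a') ;; en (y # b')) \<le> B\<^sup>2 + ct Vadd (en a' ;; en b')"
    using B B_pows(1) bits_le[of x] bits_le[of y] xy assms(2,3)
    by (simp add: sl_def)
qed (use assms in \<open>auto simp: sl_def\<close>)

lemma ct_Vle:
  assumes "length a = length b" "sl a" "sl b"
  shows "ct Vle (en a ;; en b) \<le> B ^ 3"
proof (rule vec_cost[where c = "\<lambda>a b. ct Vle (en a ;; en b)"])
  show "ct Vle (en [] ;; en []) \<le> B\<^sup>2"
    using B B_pows ct_unfold[OF fn_Vle[of "[]" "[]"]] by (simp add: body.simps)
next
  fix x y :: nat and a' b' :: "nat list"
  assume xy: "x \<in> set a" "y \<in> set b" and l: "length a' = length b'"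
  have "ct Vle (en (x # a') ;; en (y # b')) \<le> 40 + floorlog 2 x + floorlog 2 y + ct Vle (en a' ;; en b')"
    using l by (subst ct_unfold[OF fn_Vle]) (simp_all add: body.simps)
  then show "ct Vle (en (x # a') ;; en (y # b')) \<le> B\<^sup>2 + ct Vle (en a' ;; en b')"
    using B B_pows(1) bits_le[of x] bits_le[of y] xy assms(2,3)
    by (simp add: sl_def)
qed (use assms in \<open>auto simp: sl_def\<close>)

lemma ct_Veq:
  assumes "length a = length b" "sl a" "sl b"
  shows "ct Veq (en a ;; en b) \<le> B ^ 3"
proof (rule vec_cost[where c = "\<lambda>a b. ct Veq (en a ;; en b)"])
  show "ct Veq (en [] ;; en []) \<le> B\<^sup>2"
    using B B_pows ct_unfold[OF fn_Veq[of "[]" "[]"]] by (simp add: body.simps)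
next
  fix x y :: nat and a' b' :: "nat list"
  assume xy: "x \<in> set a" "y \<in> set b" and l: "length a' = length b'"
  have "ct Veq (en (x # a') ;; en (y # b')) \<le> 50 + neq_cost x y + ct Veq (en a' ;; en b')"
    using l by (subst ct_unfold[OF fn_Veq]) (simp_all add: body.simps)
  then show "ct Veq (en (x # a') ;; en (y # b')) \<le> B\<^sup>2 + ct Veq (en a' ;; en b')"
    using B B_pows(1) neq_cost_le[of x y] xy assms(2,3)
    by (simp add: sl_def)
qed (use assms in \<open>auto simp: sl_def\<close>)

lemma ct_Vmask:
  assumes "length a = length b" "sl b"
  shows "ct Vmask (en a ;; en b) \<le> B ^ 3"
proof (rule vec_cost[where c = "\<lambda>a b. ct Vmask (en a ;; en b)"])
  show "ct Vmask (en [] ;; en []) \<le> B\<^sup>2"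
    using B B_pows ct_unfold[OF fn_Vmask[of "[]" "[]"]] by (simp add: body.simps)
next
  fix x y :: nat and a' b' :: "nat list"
  assume xy: "x \<in> set a" "y \<in> set b" and l: "length a' = length b'"
  have "ct Vmask (en (x # a') ;; en (y # b')) \<le> 40 + ct Vmask (en a' ;; en b')"
    using l by (subst ct_unfold[OF fn_Vmask]) (simp_all add: body.simps)
  then show "ct Vmask (en (x # a') ;; en (y # b')) \<le> B\<^sup>2 + ct Vmask (en a' ;; en b')"
    using B B_pows(1) by simp
qed (use assms in \<open>auto simp: sl_def\<close>)

lemma ct_Ins:
  assumes "length u = m" "sl u" "sn p" "st m T" "length T < B"
  shows "ct Ins (en u ;; VNum p ;; tb T) \<le> B ^ 5"
proof -
  have "st m T \<Longrightarrow> ct Ins (en u ;; VNum p ;; tb T) \<le> B ^ 4 * (length T + 1)"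
  proof (induction T)
    case Nil
    show ?case using B B_pows ct_unfold[OF fn_Ins[of u _ "[]" p]] assms(1) by (simp add: body.simps)
  next
    case (Cons x T)
    obtain v q where x: "x = (v, q)" by force
    have w: "wt m (x # T)" using Cons.prems by (rule st_wt)
    have "ct Ins (en u ;; VNum p ;; tb (x # T)) \<le> 60 + ct Veq (en u ;; en v) + 2 * floorlog 2 p +
      floorlog 2 q + floorlog 2 (q - p) + ct Ins (en u ;; VNum p ;; tb T)"
      using w assms(1) by (subst ct_unfold[OF fn_Ins[OF assms(1) w]]) (simp_all add: body.simps x)
    moreover have "ct Veq (en u ;; en v) \<le> B ^ 3" using ct_Veq Cons.prems assms x by simp
    moreover have "floorlog 2 (q - p) \<le> B" "floorlog 2 p \<le> B" "floorlog 2 q \<le> B"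
      using Cons.prems assms x by (auto intro!: bits_le simp: less_imp_diff_less)
    ultimately show ?case using B B_pows Cons by (simp add: algebra_simps)
  qed
  then show ?thesis using assms loop_le[of "length T" 4] by simp
qed

lemma ct_Try:
  assumes "length u = m" "sl u" "sn p" "st m T" "length T < B" "length cs = m" "sl cs"
  shows "ct Try (en u ;; VNum p ;; en cs ;; tb T) \<le> B ^ 6"
proof -
  have "ct Try (en u ;; VNum p ;; en cs ;; tb T) \<le> 60 + ct Vle (en u ;; en cs) + ct Ins (en u ;; VNum p ;; tb T)"
    using assms st_wt by (subst ct_unfold[OF fn_Try[of u m]]) (simp_all add: body.simps)
  then show ?thesis using B B_pows ct_Vle[of u cs] ct_Ins[OF assms(1-5)] assms by simp
qed

lemma kt_tryins:
  "kt K W T \<Longrightarrow> (vle u cs \<Longrightarrow> u \<in> K) \<Longrightarrow> p \<le> W \<Longrightarrow> kt K W (tryins cs u p T)"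
  by (erule kt_tabrel[OF tabrel_tryins[of T u cs p]]) (auto split: if_splits)

lemma sl_vadd:
  assumes "keyset m K" "u \<in> K" "v \<in> K"
  shows "sl (vadd u v)" "length (vadd u v) = m"
proof -
  have "x + y < 2 ^ B" if "(x, y) \<in> set (zip u v)" for x y
  proof -
    have "x < B" "y < B"
      using assms set_zip_leftD[OF that] set_zip_rightD[OF that] unfolding keyset_def by blast+
    then show ?thesis using two_B by linarith
  qed
  then show "sl (vadd u v)"
    using assms by (auto simp: sl_def keyset_def)
  show "length (vadd u v) = m" using assms by (simp add: keyset_def)
qed

lemma ct_Join1:
  assumes K: "keyset m K" and cs: "sl cs" "length cs = m" and u: "u \<in> K" "p \<le> W" and W: "sn (2 * W)"
  shows "kt K (2 * W) acc \<Longrightarrow>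
    (\<And>v q. (v, q) \<in> set T \<Longrightarrow> v \<in> K \<and> q \<le> W \<and> (vle (vadd u v) cs \<longrightarrow> vadd u v \<in> K)) \<Longrightarrow>
    ct Join1 (en u ;; VNum p ;; en cs ;; tb acc ;; tb T) \<le> B ^ 7 * (length T + 1) \<and>
    kt K (2 * W) (join1 cs (u, p) T acc)"
proof (induction T arbitrary: acc)
  case Nil
  have "wt m acc" using Nil.prems(1) K kt_wt by blast
  then show ?case using B B_pows Nil cs K u keyset_length[OF K u(1)] 
      ct_unfold[OF fn_Join1[of u m cs acc "[]" p]] by (simp add: body.simps)
next
  case (Cons x T)
  obtain v q where x: "x = (v, q)" by force
  have v: "v \<in> K" "q \<le> W" "vle (vadd u v) cs \<longrightarrow> vadd u v \<in> K" using Cons.prems(2)[of v q] x by auto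
  have lu: "length u = m" "length v = m" "sl u" "sl v" "sl (vadd u v)" "length (vadd u v) = m"
    using keyset_length[OF K] keyset_sl[OF K] sl_vadd[OF K] u(1) v(1) by auto
  have wt: "wt m T" using Cons.prems(2) keyset_length[OF K] by (force simp: wt_def)
  have wa: "wt m acc" using Cons.prems(1) K kt_wt by blast
  let ?acc = "tryins cs (vadd u v) (p + q) acc"
  have kt: "kt K (2 * W) ?acc"
    using Cons.prems(1) v u(2) by (intro kt_tryins) auto
  have IH: "ct Join1 (en u ;; VNum p ;; en cs ;; tb ?acc ;; tb T) \<le> B ^ 7 * (length T + 1)"
     "kt K (2 * W) (join1 cs (u, p) T ?acc)"
    using Cons.IH[OF kt] Cons.prems(2) by auto
  have sm: "sn p" "sn q" "sn (p + q)" using u(2) v(2) W by auto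
  have "ct Join1 (en u ;; VNum p ;; en cs ;; tb acc ;; tb (x # T)) \<le> 80 + ct Vadd (en u ;; en v) +
     floorlog 2 p + floorlog 2 q + ct Try (en (vadd u v) ;; VNum (p + q) ;; en cs ;; tb acc) +
     ct Join1 (en u ;; VNum p ;; en cs ;; tb ?acc ;; tb T)"
    using lu cs wt wa by (subst ct_unfold[OF fn_Join1[of u m]]) (simp_all add: body.simps x)
  moreover have "ct Vadd (en u ;; en v) \<le> B ^ 3" using lu ct_Vadd by simp
  moreover have "ct Try (en (vadd u v) ;; VNum (p + q) ;; en cs ;; tb acc) \<le> B ^ 6"
    using kt_st[OF Cons.prems(1) K W] kt_length[OF Cons.prems(1) K] lu sm cs by (intro ct_Try) auto
  ultimately show ?case using IH B B_pows bits_le[OF sm(1)] bits_le[OF sm(2)]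
    by (simp add: algebra_simps x)
qed

lemma ct_Join_aux:
  assumes K: "keyset m K" and cs: "sl cs" "length cs = m" and W: "sn (2 * W)" and T2: "kt K W T2"
  shows "kt K (2 * W) acc \<Longrightarrow>
    (\<And>u p. (u, p) \<in> set T \<Longrightarrow> u \<in> K \<and> p \<le> W \<and>
      (\<forall>v \<in> fst ` set T2. vle (vadd u v) cs \<longrightarrow> vadd u v \<in> K)) \<Longrightarrow>
    ct Join (en cs ;; tb acc ;; tb T2 ;; tb T) \<le> B ^ 9 * (length T + 1) \<and>
    kt K (2 * W) (join cs T2 T acc)"
proof (induction T arbitrary: acc)
  case Nil
  have "wt m acc" "wt m T2" using Nil.prems(1) K kt_wt T2 by blast+
  then show ?case using B B_pows Nil cs K
      ct_unfold[OF fn_Join[of cs m acc T2 "[]"]] by (simp add: body.simps)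
next
  case (Cons x T)
  obtain u p where x: "x = (u, p)" by force
  have u: "u \<in> K" "p \<le> W" "\<forall>v \<in> fst ` set T2. vle (vadd u v) cs \<longrightarrow> vadd u v \<in> K"
    using Cons.prems(2)[of u p] x by auto
  have lu: "length u = m" using keyset_length[OF K u(1)] .
  have wt: "wt m T" using Cons.prems(2) keyset_length[OF K] by (force simp: wt_def)
  have wa: "wt m acc" "wt m T2" using Cons.prems(1) K kt_wt T2 by blast+
  let ?acc = "join1 cs (u, p) T2 acc"
  have 1: "ct Join1 (en u ;; VNum p ;; en cs ;; tb acc ;; tb T2) \<le> B ^ 7 * (length T2 + 1)"
    "kt K (2 * W) ?acc"
    using ct_Join1[OF K cs u(1,2) W Cons.prems(1), of T2] ktD[OF T2] u(3)
    by (metis fst_conv image_eqI)+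
  have IH: "ct Join (en cs ;; tb ?acc ;; tb T2 ;; tb T) \<le> B ^ 9 * (length T + 1)"
     "kt K (2 * W) (join cs T2 T ?acc)"
    using Cons.IH[OF 1(2)] Cons.prems(2) by auto
  have "ct Join (en cs ;; tb acc ;; tb T2 ;; tb (x # T)) \<le> 80 +
     ct Join1 (en u ;; VNum p ;; en cs ;; tb acc ;; tb T2) + ct Join (en cs ;; tb ?acc ;; tb T2 ;; tb T)"
    using lu cs wt wa by (subst ct_unfold[OF fn_Join[of cs m]]) (simp_all add: body.simps x)
  then show ?case using IH B B_pows 1(1) loop_le[OF kt_length[OF T2 K], of 7]
    by (simp add: algebra_simps x)
qed

lemma ct_Join:
  assumes "keyset m K" "sl cs" "length cs = m" "sn (2 * W)" "kt K W T2" "kt K W T"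
    "\<And>u v. u \<in> fst ` set T \<Longrightarrow> v \<in> fst ` set T2 \<Longrightarrow> vle (vadd u v) cs \<Longrightarrow> vadd u v \<in> K"
  shows "ct Join (en cs ;; VNum 0 ;; tb T2 ;; tb T) \<le> B ^ 10" "kt K (2 * W) (join cs T2 T [])"
proof -
  have *: "u \<in> K \<and> p \<le> W \<and> (\<forall>v \<in> fst ` set T2. vle (vadd u v) cs \<longrightarrow> vadd u v \<in> K)"
    if "(u, p) \<in> set T" for u p
    using that ktD[OF assms(6) that] assms(7)[of u] by (metis fst_conv image_eqI)
  show "ct Join (en cs ;; VNum 0 ;; tb T2 ;; tb T) \<le> B ^ 10" "kt K (2 * W) (join cs T2 T [])"
    using ct_Join_aux[OF assms(1-5) kt_Nil, of T] * loop_le[OF kt_length[OF assms(6,1)], of 9]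
    by auto
qed

lemma ct_Mask_aux:
  assumes K: "keyset m K" and mv: "length mv = m" and W: "sn W"
  shows "kt K W acc \<Longrightarrow> st m T \<Longrightarrow> (\<And>u p. (u, p) \<in> set T \<Longrightarrow> p \<le> W \<and> vmask mv u \<in> K) \<Longrightarrow>
    ct Mask (en mv ;; tb acc ;; tb T) \<le> B ^ 6 * (length T + 1)"
proof (induction T arbitrary: acc)
  case Nil
  have "wt m acc" using Nil.prems(1) K kt_wt by blast+
  then show ?case using B B_pows Nil mv
      ct_unfold[OF fn_Mask[of mv m acc "[]"]] by (simp add: body.simps)
next
  case (Cons x T)
  obtain u p where x: "x = (u, p)" by force
  have u: "p \<le> W" "vmask mv u \<in> K" using Cons.prems(3)[of u p] x by auto
  have wt: "wt m (x # T)" "wt m acc" using Cons.prems K kt_wt st_wt by blast+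
  let ?acc = "ins (vmask mv u) p acc"
  have kt: "kt K W ?acc" by (rule kt_tabrel[OF tabrel_ins Cons.prems(1)]) (use u in auto)
  have IH: "ct Mask (en mv ;; tb ?acc ;; tb T) \<le> B ^ 6 * (length T + 1)"
    using Cons.IH[OF kt] Cons.prems(2,3) by auto
  have "ct Mask (en mv ;; tb acc ;; tb (x # T)) \<le> 80 + ct Vmask (en mv ;; en u) +
     ct Ins (en (vmask mv u) ;; VNum p ;; tb acc) + ct Mask (en mv ;; tb ?acc ;; tb T)"
    using mv wt by (subst ct_unfold[OF fn_Mask[of mv m]]) (simp_all add: body.simps x)
  moreover have "ct Vmask (en mv ;; en u) \<le> B ^ 3" using Cons.prems(2) x mv by (intro ct_Vmask) auto
  moreover have "ct Ins (en (vmask mv u) ;; VNum p ;; tb acc) \<le> B ^ 5"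
    using kt_st[OF Cons.prems(1) K W] kt_length[OF Cons.prems(1) K] keyset_sl[OF K u(2)] u W
      keyset_length[OF K u(2)] by (intro ct_Ins) auto
  ultimately show ?case using IH B B_pows by (simp add: algebra_simps x)
qed

lemma ct_Mask:
  assumes "keyset m K" "length mv = m" "sn W" "st m T" "length T < B"
    "\<And>u p. (u, p) \<in> set T \<Longrightarrow> p \<le> W \<and> vmask mv u \<in> K"
  shows "ct Mask (en mv ;; VNum 0 ;; tb T) \<le> B ^ 7"
  using ct_Mask_aux[OF assms(1-3) kt_Nil assms(4,6)] loop_le[OF assms(5), of 6] by simp

lemma ct_Bump:
  assumes "length u = length es" "sn a" "sn b" "sn d" "sl u" "se es"
  shows "ct Bump (VNum a ;; VNum b ;; VNum d ;; ee k es ;; en u) \<le> B ^ 3"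
proof -
  have b1: "floorlog 2 (of_bool c) \<le> 1" for c by (cases c) auto
  have "sl u \<Longrightarrow> se es \<Longrightarrow> ct Bump (VNum a ;; VNum b ;; VNum d ;; ee k es ;; en u) \<le> B ^ 2 * (length u + 1)"
    using assms(1)
  proof (induction u es rule: list_induct2)
    case Nil
    show ?case using B B_pows ct_unfold[OF fn_Bump[of "[]" "[]" a b d k]] by (simp add: body.simps)
  next
    case (Cons x u e es)
    obtain v q where e: "e = (v, q)" by force
    have "ct Bump (VNum a ;; VNum b ;; VNum d ;; ee k (e # es) ;; en (x # u)) \<le> 100 +
       neq_cost a v + neq_cost b q + floorlog 2 x + floorlog 2 d +
       ct Bump (VNum a ;; VNum b ;; VNum d ;; ee k es ;; en u)"
      using Cons.hyps by (subst ct_unfold[OF fn_Bump]) (auto simp add: body.simps e)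
    then show ?case using B B_pows(1) Cons neq_cost_le[of a v] neq_cost_le[of b q] assms(2-4)
        bits_le[of x] bits_le[of d] by (simp add: algebra_simps e)
  qed
  then show ?thesis using assms loop_le[of "length u" 2] sl_length[of u] by simp
qed

lemma bump_bounds:
  assumes "\<forall>x \<in> set u. x + d \<le> M"
  shows "\<forall>x \<in> set (bump a b d es u). x \<le> M"
  using assms unfolding bump_def by (auto simp: set_zip) (metis add_leD1 nth_mem)+

text \<open>Each step of a walk tries all edges. The factor 2 lets every recursive call pay once
  more its own cost, which covers the round of the loop around it.\<close>

definition wcost :: "(nat \<times> nat) list \<Rightarrow> nat \<Rightarrow> nat" where
  "wcost es n = B ^ 7 * (2 * length es + 3) ^ (n + 1)"

context
  fixes es :: "(nat \<times> nat) list" and cs :: "nat list" and t d w :: nat and K W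
  assumes es: "se es" and cs: "length cs = length es" "sl cs"
    and sm: "sn t" "sn d" "sn W" "w \<le> W" and K: "keyset (length es) K"
begin

lemma kt_walk:
  "kt K W acc \<Longrightarrow> (\<And>v. v \<in> wset es t d n c u \<Longrightarrow> vle v cs \<Longrightarrow> v \<in> K) \<Longrightarrow>
    kt K W (walk es cs t d w n c u acc)"
  by (rule kt_tabrel[OF tabrel_walk]) (use sm in \<open>auto simp: walkset_def\<close>)

text \<open>Capacities are checked only when a walk reaches \<open>t\<close>, so on the way they do
  not bound the entries of \<open>u\<close>. The assumption on \<open>u\<close> reserves room for
  adding \<open>d\<close> in each of the remaining steps.\<close>

lemma ct_Wloop:
  assumes IH: "\<And>c u acc. length u = length es \<Longrightarrow> \<forall>x \<in> set u. x + n * d < 2 ^ B \<Longrightarrow> sn c \<Longrightarrow>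
      kt K W acc \<Longrightarrow> (\<And>v. v \<in> wset es t d n c u \<Longrightarrow> vle v cs \<Longrightarrow> v \<in> K) \<Longrightarrow>
      ct Walk (walk_arg k es cs t d w n c u acc) \<le> D"
    and u: "length u = length es" "\<forall>x \<in> set u. x + Suc n * d < 2 ^ B" "sn c"
    and V: "\<And>v. v \<in> wset es t d (Suc n) c u \<Longrightarrow> vle v cs \<Longrightarrow> v \<in> K"
  shows "set fs \<subseteq> set es \<Longrightarrow> kt K W acc \<Longrightarrow>
    ct Wloop (ee k fs ;; walk_arg k es cs t d w n c u acc) \<le> B ^ 6 + length fs * (B ^ 6 + D) \<and>
    kt K W (wloop es d (walk es cs t d w n) c u fs acc)"
proof (induction fs arbitrary: acc)
  case Nil
  have wt: "wt (length es) acc" using Nil.prems(2) K kt_wt by blast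
  show ?case
    using ct_unfold[OF fn_Wloop_walk[OF cs(1) u(1) wt, of k "[]" n c t d w]] B B_pows Nil by (simp add: body.simps)
next
  case (Cons e fs)
  obtain a b where e: "e = (a, b)" by force
  have wt: "wt (length es) acc" using Cons.prems(2) K kt_wt by blast
  let ?u = "bump a b d es u"
  let ?acc = "if a = c then walk es cs t d w n b ?u acc
     else if b = c then walk es cs t d w n a ?u acc else acc"
  have ab: "sn a" "sn b" "(a, b) \<in> set es" using Cons.prems(1) es e by (auto simp: se_def)
  have lu: "length ?u = length es" "\<forall>x \<in> set ?u. x + n * d < 2 ^ B"
  proof -
    \<comment> \<open>The form that \<open>bump_bounds\<close> needs. Going back from the truncated
      difference requires \<open>n * d < 2 ^ B\<close>, which follows from \<open>u(2)\<close> as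
      soon as \<open>u\<close> has an entry.\<close>
    have "\<forall>x \<in> set u. x + d \<le> 2 ^ B - 1 - n * d" using u(2) by auto
    from bump_bounds[OF this, of a b es] show "\<forall>x \<in> set ?u. x + n * d < 2 ^ B"
    proof (intro ballI)
      fix x assume x: "x \<in> set ?u"
      then have "u \<noteq> []" by (auto simp: bump_def)
      then have "n * d < 2 ^ B" using u(2) by (cases u) auto
      moreover have "x \<le> 2 ^ B - 1 - n * d"
        using \<open>\<forall>x \<in> set ?u. x \<le> 2 ^ B - 1 - n * d\<close> x by blast
      ultimately show "x + n * d < 2 ^ B" by linarith
    qed
  qed (simp add: u)
  have sub1: "wset es t d n b ?u \<subseteq> wset es t d (Suc n) c u" if "a = c" using that ab(3) by auto
  have sub2: "wset es t d n a ?u \<subseteq> wset es t d (Suc n) c u" if "a \<noteq> c" "b = c"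
    using that ab(3) by fastforce
  have kt: "kt K W ?acc"
    using Cons.prems(2) V sub1 sub2 by (auto intro!: kt_walk split: if_splits) (blast+)?
  have slu: "sl u" using u es unfolding sl_def se_def by auto
  have W1: "ct Walk (walk_arg k es cs t d w n b ?u acc) \<le> D"
    if "a = c" using IH[OF lu ab(2) Cons.prems(2)] V sub1[OF that] by blast
  have W2: "ct Walk (walk_arg k es cs t d w n a ?u acc) \<le> D"
    if "a \<noteq> c" "b = c" using IH[OF lu ab(1) Cons.prems(2)] V sub2[OF that] by blast
  have bm: "ct Bump (VNum a ;; VNum b ;; VNum d ;; ee k es ;; en u) \<le> B ^ 3"
    using ct_Bump u(1) ab(1,2) sm(2) slu es by blast
  have "ct Wloop (ee k (e # fs) ;; walk_arg k es cs t d w n c u acc) \<le> 400 + neq_cost a c + neq_cost b c + D +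
      ct Bump (VNum a ;; VNum b ;; VNum d ;; ee k es ;; en u) +
      ct Wloop (ee k fs ;; walk_arg k es cs t d w n c u ?acc)"
    using W1 W2 u(1) wt cs(1) kt_wt[OF kt K]
    by (subst ct_unfold[OF fn_Wloop_walk]) (auto simp: body.simps e)
  moreover have "ct Wloop (ee k fs ;; walk_arg k es cs t d w n c u ?acc) \<le> B ^ 6 + length fs * (B ^ 6 + D)"
    "kt K W (wloop es d (walk es cs t d w n) c u fs ?acc)"
    using Cons.IH[OF _ kt] Cons.prems(1) by auto
  moreover have "wloop es d (walk es cs t d w n) c u (e # fs) acc = wloop es d (walk es cs t d w n) c u fs ?acc"
    by (simp only: wloop.simps e fst_conv snd_conv)
  ultimately show ?case using bm B B_pows neq_cost_le[of a c] neq_cost_le[of b c] ab u(3)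
    by (simp del: wloop.simps)
qed

lemma ct_Walk:
  "length u = length es \<Longrightarrow> \<forall>x \<in> set u. x + n * d < 2 ^ B \<Longrightarrow> sn c \<Longrightarrow> n < B \<Longrightarrow>
    kt K W acc \<Longrightarrow> (\<And>v. v \<in> wset es t d n c u \<Longrightarrow> vle v cs \<Longrightarrow> v \<in> K) \<Longrightarrow>
    ct Walk (walk_arg k es cs t d w n c u acc) \<le> wcost es n"
proof (induction n arbitrary: c u acc)
  case 0
  have wt: "wt (length es) acc" using 0 K kt_wt by blast
  have slu: "sl u" using 0(1,2) es unfolding sl_def se_def by auto
  have "ct Walk (walk_arg k es cs t d w 0 c u acc)
    \<le> 90 + neq_cost c t + ct Try (en u ;; VNum w ;; en cs ;; tb acc)"
    using 0 wt cs by (subst ct_unfold[OF fn_Walk]) (auto simp: body.simps)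
  moreover have "ct Try (en u ;; VNum w ;; en cs ;; tb acc) \<le> B ^ 6"
    using kt_st[OF 0(5) K sm(3)] kt_length[OF 0(5) K] cs sm 0(1) slu by (intro ct_Try) auto
  ultimately have "ct Walk (walk_arg k es cs t d w 0 c u acc)
    \<le> B ^ 7 * 1" using B B_pows neq_cost_le[OF 0(3) sm(1)] by simp
  also have "\<dots> \<le> wcost es 0" unfolding wcost_def by (intro mult_le_mono2) simp
  finally show ?case .
next
  case (Suc n)
  have wt: "wt (length es) acc" using Suc.prems K kt_wt by blast
  have slu: "sl u" using Suc.prems(1,2) es unfolding sl_def se_def by auto
  let ?acc = "if c = t then tryins cs u w acc else acc"
  have kt: "kt K W ?acc" using Suc.prems(5,6) sm(4) by (auto intro!: kt_tryins)
  have cW: "ct Walk (walk_arg k es cs t d w n c u acc) \<le> wcost es n"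
    if "length u = length es" "\<forall>x \<in> set u. x + n * d < 2 ^ B" "sn c" "kt K W acc"
      "\<And>v. v \<in> wset es t d n c u \<Longrightarrow> vle v cs \<Longrightarrow> v \<in> K" for c u acc
    by (rule Suc.IH[OF that(1-3) _ that(4)]) (use that(5) Suc.prems(4) in simp_all)
  have lp: "ct Wloop (ee k es ;; walk_arg k es cs t d w n c u ?acc) \<le> B ^ 6 + length es * (B ^ 7 + wcost es n)"
  proof -
    have "B ^ 6 \<le> B ^ 7" using B_pows(5,6) by linarith
    then have "B ^ 6 + length es * (B ^ 6 + wcost es n) \<le> B ^ 6 + length es * (B ^ 7 + wcost es n)"
      by (intro add_left_mono mult_le_mono2 add_right_mono)
    moreover have "ct Wloop (ee k es ;; walk_arg k es cs t d w n c u ?acc) \<le> B ^ 6 + length es * (B ^ 6 + wcost es n)"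
      by (rule ct_Wloop[THEN conjunct1]) (rule cW Suc.prems(1,2,3,6) subset_refl kt; assumption)+
    ultimately show ?thesis by linarith
  qed
  have "ct Walk (walk_arg k es cs t d w (Suc n) c u acc)
    \<le> 200 + neq_cost c t + floorlog 2 (Suc n) + ct Try (en u ;; VNum w ;; en cs ;; tb acc) +
      ct Wloop (ee k es ;; walk_arg k es cs t d w n c u ?acc)"
    using Suc.prems(1) wt cs kt_wt[OF kt K] by (subst ct_unfold[OF fn_Walk]) (auto simp: body.simps)
  moreover have "ct Try (en u ;; VNum w ;; en cs ;; tb acc) \<le> B ^ 6"
    using kt_st[OF Suc.prems(5) K sm(3)] kt_length[OF Suc.prems(5) K] cs sm Suc.prems(1) slu
    by (intro ct_Try) auto
  ultimately have "ct Walk (walk_arg k es cs t d w (Suc n) c u acc)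
    \<le> B ^ 7 + length es * (B ^ 7 + wcost es n)"
    using B B_pows neq_cost_le[OF Suc.prems(3) sm(1)] lp
      bits_le[OF less_B_small[of "Suc n"]] Suc.prems(4) by linarith
  also have "\<dots> \<le> wcost es n + length es * (wcost es n + wcost es n)"
  proof -
    have "B ^ 7 * 1 \<le> wcost es n" unfolding wcost_def by (intro mult_le_mono2) simp
    then show ?thesis by (intro add_mono mult_le_mono2) auto
  qed
  also have "\<dots> \<le> wcost es (Suc n)"
  proof -
    have "wcost es (Suc n) = wcost es n * (2 * length es + 3)" by (simp add: wcost_def)
    moreover have "wcost es n + length es * (wcost es n + wcost es n) = wcost es n * (2 * length es + 1)"
      by (simp add: algebra_simps)
    ultimately show ?thesis by (simp add: algebra_simps)
  qed
  finally show ?case .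
qed

end
end

section \<open>Balanced bags\<close>

lemma path_edges_single [simp]: "path_edges [a] = {}"
  by (simp add: path_edges_def)
lemma path_edges_Cons2 [simp]: "path_edges (a # b # p) = insert {a, b} (path_edges (b # p))"
proof -
  have "{{(a # b # p) ! i, (a # b # p) ! Suc i} | i. Suc i < length (a # b # p)} =
    (\<lambda>i. {(a # b # p) ! i, (a # b # p) ! Suc i}) ` {i. i < Suc (length p)}"
    by auto
  also have "{i. i < Suc (length p)} = insert 0 (Suc ` {i. i < length p})"
    using less_Suc_eq_0_disj by auto
  finally show ?thesis unfolding path_edges_def by (auto simp: image_image)
qed

lemma is_path_single [simp]: "is_path V E s t [a] \<longleftrightarrow> a = s \<and> a = t \<and> a \<in> V"
  by (auto simp: is_path_def)
lemma is_path_Nil [simp]: "\<not> is_path V E s t []"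
  by (simp add: is_path_def)
lemma is_path_Cons2 [simp]: "is_path V E s t (a # b # p) \<longleftrightarrow>
    a = s \<and> a \<in> V \<and> {a, b} \<in> E \<and> a \<notin> set (b # p) \<and> is_path V E b t (b # p)"
  by (auto simp: is_path_def)

lemma is_path_suffix: "is_path V E s t (xs @ a # ys) \<Longrightarrow> is_path V E a t (a # ys)"
proof (induction xs arbitrary: s)
  case Nil
  then show ?case by (cases ys) auto
next
  case (Cons x xs)
  then show ?case by (cases xs) auto
qed

lemma path_edges_suffix: "path_edges (a # ys) \<subseteq> path_edges (xs @ a # ys)"
proof (induction xs)
  case (Cons x xs)
  then show ?case by (cases xs) auto
qed simp

lemma is_path_snoc:
  "is_path V E s t p \<Longrightarrow> {t, b} \<in> E \<Longrightarrow> b \<in> V \<Longrightarrow> b \<notin> set p \<Longrightarrow> is_path V E s b (p @ [b])"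
proof (induction p arbitrary: s)
  case (Cons a p)
  then show ?case by (cases p) auto
qed simp

lemma is_path_mono: "is_path V E s t p \<Longrightarrow> V \<subseteq> V' \<Longrightarrow> is_path V' E s t p"
  by (auto simp: is_path_def)

text \<open>If \<open>a\<close> already lies on the path, the suffix that starts at \<open>a\<close>
  serves. This is the shortcut by which walks become paths.\<close>

lemma is_path_extend:
  assumes "is_path V E b t p" "{a, b} \<in> E" "a \<in> V"
  shows "\<exists>q. is_path V E a t q \<and> length q \<le> Suc (length p) \<and> path_edges q \<subseteq> insert {a, b} (path_edges p)"
proof (cases "a \<in> set p")
  case True
  then obtain xs ys where p: "p = xs @ a # ys" by (meson split_list)
  show ?thesis
    using is_path_suffix[of V E b t xs a ys] path_edges_suffix[of a ys xs] assms(1) p by force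
next
  case False
  obtain p' where "p = b # p'" using assms(1) by (cases p) (auto simp: is_path_def)
  then show ?thesis using assms False by (intro exI[of _ "a # p"]) auto
qed

section \<open>Components of a tree after removal of a node\<close>

definition avoid :: "'n set set \<Rightarrow> 'n \<Rightarrow> ('n \<times> 'n) set" where
  "avoid F x = {(a, b). {a, b} \<in> F \<and> a \<noteq> x \<and> b \<noteq> x}\<^sup>*"

text \<open>For \<open>a\<close> different from \<open>x\<close> this is the component of
  \<open>a\<close> off \<open>x\<close>; since \<open>avoid\<close> is reflexive, the branch of
  \<open>x\<close> itself is just \<open>{x}\<close>.\<close>

definition branch :: "'n set set \<Rightarrow> 'n \<Rightarrow> 'n \<Rightarrow> 'n set" where
  "branch F x a = {b. (a, b) \<in> avoid F x}"

lemma avoid_sym: "(a, b) \<in> avoid F x \<Longrightarrow> (b, a) \<in> avoid F x"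
  unfolding avoid_def by (erule converse_rtrancl_induct) 
    (auto intro: rtrancl_into_rtrancl simp: insert_commute)

lemma avoid_trans: "(a, b) \<in> avoid F x \<Longrightarrow> (b, c) \<in> avoid F x \<Longrightarrow> (a, c) \<in> avoid F x"
  unfolding avoid_def by (rule rtrancl_trans)

lemma avoid_step: "{a, b} \<in> F \<Longrightarrow> a \<noteq> x \<Longrightarrow> b \<noteq> x \<Longrightarrow> (a, b) \<in> avoid F x"
  unfolding avoid_def by auto

lemma branch_eq: "(a, b) \<in> avoid F x \<Longrightarrow> branch F x a = branch F x b"
  unfolding branch_def using avoid_sym avoid_trans by fast

lemma branch_refl [simp]: "a \<in> branch F x a"
  by (simp add: branch_def avoid_def)

lemma avoid_neq: "(a, b) \<in> avoid F x \<Longrightarrow> a \<noteq> x \<Longrightarrow> b \<noteq> x"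
  unfolding avoid_def by (erule rtranclE) auto

lemma path_avoid: "is_path N F s t p \<Longrightarrow> x \<notin> set p \<Longrightarrow> (s, t) \<in> avoid F x"
proof (induction p arbitrary: s)
  case (Cons a p)
  show ?case
  proof (cases p)
    case Nil
    then have "t = s" using Cons.prems by auto
    then show ?thesis by (simp add: avoid_def)
  next
    case (Cons b q)
    then show ?thesis using Cons.prems Cons.IH[of b] avoid_step[of a b F x] avoid_trans by fastforce
  qed
qed simp

lemma avoid_path:
  assumes "(a, b) \<in> avoid F x" "b \<in> N" "b \<noteq> x" "\<Union>F \<subseteq> N"
  shows "\<exists>p. is_path (N - {x}) F a b p"
  using assms(1) unfolding avoid_def
proof (induction rule: converse_rtrancl_induct)
  case base
  then show ?case using assms by (intro exI[of _ "[b]"]) simp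
next
  case (step a c)
  then obtain p where "is_path (N - {x}) F c b p" by blast
  with step.hyps assms show ?case using is_path_extend[of "N - {x}" F c b p a] by blast
qed

text \<open>Together with \<open>branch_eq\<close>, every branch at \<open>x\<close> is the branch
  of a neighbour of \<open>x\<close>.\<close>

lemma first_step:
  assumes "is_path N F x a p" "x \<noteq> a"
  shows "\<exists>y. {x, y} \<in> F \<and> y \<in> N \<and> y \<noteq> x \<and> (y, a) \<in> avoid F x"
proof -
  obtain y q where p: "p = x # y # q"
    using assms by (cases p; cases "tl p") (auto simp: is_path_def)
  then have "is_path N F y a (y # q)" "x \<notin> set (y # q)" "{x, y} \<in> F"
    using assms by auto
  moreover from this(1) have "y \<in> N" by (cases q) auto
  ultimately show ?thesis using path_avoid by fastforce
qed

text \<open>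
  The vertices all of whose bags lie in the component of \<open>a\<close> in the tree without \<open>x\<close>.
\<close>

definition hanging :: "'v set \<Rightarrow> 'n set \<Rightarrow> 'n set set \<Rightarrow> ('n \<Rightarrow> 'v set) \<Rightarrow> 'n \<Rightarrow> 'n \<Rightarrow> 'v set" where
  "hanging V N F B x a = {v \<in> V. v \<notin> B x \<and> {y \<in> N. v \<in> B y} \<subseteq> branch F x a}"

text \<open>
  Connectedness by closed subsets, which needs no paths.
\<close>

definition connected_in :: "'v set set \<Rightarrow> 'v set \<Rightarrow> bool" where
  "connected_in E X \<longleftrightarrow>
    (\<forall>Y \<subseteq> X. Y \<noteq> {} \<longrightarrow> (\<forall>a \<in> Y. \<forall>b \<in> X. {a, b} \<in> E \<longrightarrow> b \<in> Y) \<longrightarrow> Y = X)"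

lemma simple_graph_Union: "simple_graph V E \<Longrightarrow> \<Union>E \<subseteq> V"
proof
  fix x assume "simple_graph V E" "x \<in> \<Union>E"
  then obtain e where "e \<in> E" "x \<in> e" "\<exists>u\<in>V. \<exists>v\<in>V. u \<noteq> v \<and> e = {u, v}"
    unfolding simple_graph_def by (elim UnionE conjE) (drule bspec, assumption+)
  then show "x \<in> V" by auto
qed

text \<open>A common node would have two paths to \<open>x\<close> in the tree: one whose last step
  leads from \<open>y\<close> to \<open>x\<close>, and one that avoids \<open>y\<close>.\<close>

lemma branches_disjoint:
  assumes tree: "is_tree N F" and xy: "{x, y} \<in> F" "x \<in> N" "y \<in> N" "x \<noteq> y"
  shows "branch F x y \<inter> branch F y x = {}"
proof (rule ccontr)
  assume "branch F x y \<inter> branch F y x \<noteq> {}"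
  then obtain z where z: "(z, y) \<in> avoid F x" "(z, x) \<in> avoid F y"
    unfolding branch_def using avoid_sym by fast
  have FN: "\<Union>F \<subseteq> N" using tree simple_graph_Union unfolding is_tree_def by blast
  obtain p q where p: "is_path (N - {x}) F z y p" and q: "is_path (N - {y}) F z x q"
    using avoid_path[OF z(1) xy(3) _ FN] avoid_path[OF z(2) xy(2) _ FN] xy(4) by auto
  have xp: "x \<notin> set p" and yq: "y \<notin> set q" and yp: "y \<in> set p" and zN: "z \<in> N"
    using p q unfolding is_path_def by (auto simp: subset_iff)
  have "is_path N F z x (p @ [x])"
    using is_path_snoc[OF is_path_mono[OF p] _ xy(2) xp] xy(1) by (simp add: insert_commute)
  moreover have "is_path N F z x q" using is_path_mono[OF q] by blast
  ultimately have "p @ [x] = q" using tree zN xy(2) unfolding is_tree_def by blast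
  then show False using yp yq by auto
qed

text \<open>
  Otherwise take a smallest heavy branch, at \<open>x\<close> say, and let \<open>y\<close> be the neighbour of \<open>x\<close> in it.
  A heavy branch at \<open>y\<close> must contain \<open>x\<close> by minimality; but then the two branches are disjoint and
  together carry more than the total weight.
\<close>

lemma balanced_node:
  fixes w :: "'v \<Rightarrow> nat"
  assumes td: "tree_decomposition V E N F B" and fin: "finite V"
  shows "\<exists>x \<in> N. \<forall>a \<in> N - {x}. 2 * sum w (hanging V N F B x a) \<le> sum w V"
proof (rule ccontr)
  assume "\<not> ?thesis"
  then have heavy: "\<exists>a \<in> N - {x}. sum w V < 2 * sum w (hanging V N F B x a)" if "x \<in> N" for x
    using that by (meson not_le)
  have tree: "is_tree N F" using td by (simp add: tree_decomposition_def)
  have FN: "\<Union>F \<subseteq> N" using tree simple_graph_Union unfolding is_tree_def by blast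
  have finN: "finite N" and N0: "N \<noteq> {}"
    using tree by (simp_all add: is_tree_def simple_graph_def)
  have brN: "branch F x a \<subseteq> N" if "a \<in> N" for x a
  proof
    fix b assume "b \<in> branch F x a"
    then have "(a, b) \<in> {(a, b). {a, b} \<in> F \<and> a \<noteq> x \<and> b \<noteq> x}\<^sup>*" by (simp add: branch_def avoid_def)
    then show "b \<in> N" by (cases rule: rtranclE) (use that FN in auto)
  qed
  define H where "H = {(x, a). x \<in> N \<and> a \<in> N - {x} \<and> sum w V < 2 * sum w (hanging V N F B x a)}"
  have "H \<noteq> {}" using heavy N0 unfolding H_def by blast
  then obtain x a where xa: "(x, a) \<in> H"
    and min: "\<And>x' a'. (x', a') \<in> H \<Longrightarrow> card (branch F x a) \<le> card (branch F x' a')"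
    using arg_min_natI[of "\<lambda>h. h \<in> H" _ "\<lambda>(x, a). card (branch F x a)"]
      arg_min_nat_le[of "\<lambda>h. h \<in> H" _ "\<lambda>(x, a). card (branch F x a)"]
    by (metis (no_types, lifting) equals0I case_prod_conv surj_pair)
  have x: "x \<in> N" "a \<in> N" "a \<noteq> x" "sum w V < 2 * sum w (hanging V N F B x a)"
    using xa by (auto simp: H_def)
  have "\<exists>p. is_path N F x a p" using tree x unfolding is_tree_def by blast
  then obtain y where y: "{x, y} \<in> F" "y \<in> N" "y \<noteq> x" "(y, a) \<in> avoid F x"
    using first_step[of N F x a] x by blast
  have bxa: "branch F x a = branch F x y" using branch_eq[OF y(4)] by simp
  obtain b where b: "b \<in> N" "b \<noteq> y" "sum w V < 2 * sum w (hanging V N F B y b)"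
    using heavy[OF y(2)] by blast
  show False
  proof (cases "x \<in> branch F y b")
    case True
    then have byb: "branch F y b = branch F y x" by (intro branch_eq) (simp add: branch_def)
    have "hanging V N F B x a \<inter> hanging V N F B y b = {}"
    proof (rule ccontr)
      assume "hanging V N F B x a \<inter> hanging V N F B y b \<noteq> {}"
      then obtain v where v: "v \<in> V" "{z \<in> N. v \<in> B z} \<subseteq> branch F x a" "{z \<in> N. v \<in> B z} \<subseteq> branch F y b"
        unfolding hanging_def by blast
      moreover obtain z where "z \<in> N" "v \<in> B z" using td v(1) unfolding tree_decomposition_def by blast
      ultimately show False using branches_disjoint[OF tree y(1) x(1) y(2)] y(3) bxa byb by blast
    qed
    then have "sum w (hanging V N F B x a) + sum w (hanging V N F B y b) =
        sum w (hanging V N F B x a \<union> hanging V N F B y b)"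
      using fin by (subst sum.union_disjoint) (auto simp: hanging_def)
    also have "\<dots> \<le> sum w V" using fin by (intro sum_mono2) (auto simp: hanging_def)
    finally show False using x(4) b(3) by linarith
  next
    case False
    have "\<exists>p. is_path N F y b p" using tree y b unfolding is_tree_def by blast
    then obtain c where c: "{y, c} \<in> F" "c \<in> N" "c \<noteq> y" "(c, b) \<in> avoid F y"
      using first_step[of N F y b] b by blast
    have byc: "branch F y b = branch F y c" using branch_eq[OF c(4)] by simp
    have cx: "c \<noteq> x" using False byc by auto
    \<comment> \<open>If the heavy branch at \<open>y\<close> misses \<open>x\<close>, it lies
      inside the branch at \<open>x\<close>. It also lacks \<open>y\<close>, so it is strictly
      smaller, against the choice of the branch at \<open>x\<close>.\<close>
    have "(y, z) \<in> avoid F x" if "z \<in> branch F y c" for z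
    proof -
      from that have "(c, z) \<in> {(a, b). {a, b} \<in> F \<and> a \<noteq> y \<and> b \<noteq> y}\<^sup>*"
        by (simp add: branch_def avoid_def)
      then show ?thesis
      proof (induction rule: rtrancl_induct)
        case base
        show ?case using c(1) cx y(3) by (intro avoid_step) auto
      next
        case (step u z)
        have "u \<in> branch F y c" "z \<in> branch F y c"
          using step.hyps by (auto simp: branch_def avoid_def intro: rtrancl_into_rtrancl)
        then have "u \<noteq> x" "z \<noteq> x" using False byc by auto
        then show ?case using avoid_trans[OF step.IH avoid_step] step.hyps by blast
      qed
    qed
    then have "branch F y b \<subseteq> branch F x a"
      unfolding bxa byc by (auto simp: branch_def[of F x])
    moreover have "y \<in> branch F x a" using bxa by simp
    moreover have "y \<notin> branch F y b" using avoid_neq b(2) unfolding branch_def by fast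
    ultimately have "branch F y b \<subset> branch F x a" by blast
    then have "card (branch F y b) < card (branch F x a)"
      using finite_subset[OF brN[OF x(2)] finN] by (intro psubset_card_mono)
    moreover have "(y, b) \<in> H" using y b by (simp add: H_def)
    ultimately show False using min[of y b] by simp
  qed
qed

text \<open>A connected set that avoids the bag of \<open>x\<close> hangs in a single branch: the
  bags of one of its vertices form a subtree without \<open>x\<close>, hence stay in one branch, and
  adjacent vertices share a bag.\<close>

theorem balanced_bag:
  fixes w :: "'v \<Rightarrow> nat"
  assumes td: "tree_decomposition V E N F B" and fin: "finite V"
  shows "\<exists>x \<in> N. \<forall>X \<subseteq> V. X \<inter> B x = {} \<longrightarrow> connected_in E X \<longrightarrow> 2 * sum w X \<le> sum w V"
proof -
  obtain x where x: "x \<in> N" "\<And>a. a \<in> N - {x} \<Longrightarrow> 2 * sum w (hanging V N F B x a) \<le> sum w V"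
    using balanced_node[OF td fin] by blast
  have "2 * sum w X \<le> sum w V" if X: "X \<subseteq> V" "X \<inter> B x = {}" "connected_in E X" for X
  proof (cases "X = {}")
    case False
    then obtain v0 where v0: "v0 \<in> X" by blast
    then obtain a where a: "a \<in> N" "v0 \<in> B a" using td X(1) unfolding tree_decomposition_def by blast
    have ax: "a \<noteq> x" using a X(2) v0 by blast
    have all: "{y \<in> N. v \<in> B y} \<subseteq> branch F x a" if v: "v \<in> X" "z \<in> N" "v \<in> B z" "z \<in> branch F x a" for v z
    proof
      fix y assume y: "y \<in> {y \<in> N. v \<in> B y}"
      obtain p where p: "is_path {y \<in> N. v \<in> B y} F z y p"
        using td v(1,2,3) y X(1) unfolding tree_decomposition_def by blast
      have "x \<notin> set p" using p v(1) X(2) unfolding is_path_def by blast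
      then have "(z, y) \<in> avoid F x" using path_avoid[OF p] by blast
      then show "y \<in> branch F x a" using v(4) avoid_trans unfolding branch_def by fast
    qed
    define Y where "Y = {v \<in> X. {y \<in> N. v \<in> B y} \<subseteq> branch F x a}"
    have "v0 \<in> Y" using all[OF v0 a branch_refl] v0 by (simp add: Y_def)
    moreover have "v \<in> Y" if uv: "u \<in> Y" "v \<in> X" "{u, v} \<in> E" for u v
    proof -
      obtain z where z: "z \<in> N" "{u, v} \<subseteq> B z"
        using td uv(3) unfolding tree_decomposition_def by blast
      then have "z \<in> branch F x a" using uv(1) by (auto simp: Y_def)
      then show ?thesis using all[OF uv(2) z(1)] z(2) uv(2) by (simp add: Y_def)
    qed
    moreover have "Y \<subseteq> X" by (auto simp: Y_def)
    ultimately have "Y = X" using X(3)[unfolded connected_in_def, rule_format, of Y] by blast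
    then have "X \<subseteq> hanging V N F B x a" using X by (auto simp: Y_def hanging_def)
    then have "sum w X \<le> sum w (hanging V N F B x a)"
      using fin by (intro sum_mono2) (auto simp: hanging_def)
    then show ?thesis using x(2)[of a] a ax by simp
  qed simp
  then show ?thesis using x(1) by blast
qed

text \<open>The single bag \<open>V\<close> shows that some decomposition exists, so the
  \<open>LEAST\<close> is attained. The truncated subtraction in the width is harmless for an upper
  bound on bag sizes.\<close>

lemma treewidth_decomposition:
  assumes "simple_graph V E"
  obtains N :: "nat set" and F B where "tree_decomposition V E N F B"
    "\<And>x. x \<in> N \<Longrightarrow> card (B x) \<le> treewidth V E + 1"
proof -
  have tree: "is_tree {0 :: nat} {}"
    unfolding is_tree_def simple_graph_def
  proof (intro conjI ballI ex1I)
    fix x y :: nat and p assume "x \<in> {0}" "y \<in> {0}" and p: "is_path {0} {} x y p"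
    then have "distinct p" "set p \<subseteq> {0}" "p \<noteq> []" by (auto simp: is_path_def)
    then show "p = [0]" by (cases p; cases "tl p") auto
  qed auto
  have "\<forall>e \<in> E. e \<subseteq> V" using assms by (auto simp: simple_graph_def)
  then have "tree_decomposition V E {0 :: nat} {} (\<lambda>_. V)"
    using tree unfolding tree_decomposition_def
    by (auto intro!: exI[of _ "[0]"])
  then have "\<exists>k. \<exists>(N :: nat set) F B. tree_decomposition V E N F B \<and> decomposition_width N B = k"
    by blast
  from LeastI_ex[OF this] obtain N :: "nat set" and F B where
    td: "tree_decomposition V E N F B" and w: "decomposition_width N B = treewidth V E"
    unfolding treewidth_def by blast
  have "finite N" using td by (simp add: tree_decomposition_def is_tree_def simple_graph_def)
  have "card (B x) \<le> treewidth V E + 1" if "x \<in> N" for x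
  proof -
    have "card (B x) \<le> Max ((\<lambda>x. card (B x)) ` N)"
      using \<open>finite N\<close> that by (intro Max_ge) auto
    then show ?thesis using w unfolding decomposition_width_def by linarith
  qed
  with td show ?thesis using that by blast
qed

section \<open>Splitting vertex sets\<close>

definition eset :: "('a \<times> 'a) list \<Rightarrow> 'a set set" where
  "eset es = (\<lambda>(u, v). {u, v}) ` set es"

lemma adj_eset: "adj es a b \<longleftrightarrow> {a, b} \<in> eset es"
  by (force simp: adj_def eset_def doubleton_eq_iff)

lemma adj_sym: "adj es a b \<longleftrightarrow> adj es b a"
  by (auto simp: adj_def)

section \<open>Closed neighbourhoods and connected components\<close>

definition nbs :: "('a \<times> 'a) list \<Rightarrow> 'a set \<Rightarrow> 'a set \<Rightarrow> 'a set" where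
  "nbs es A R = {v \<in> A. v \<in> R \<or> (\<exists>w \<in> R. adj es v w)}"

lemma nbs_iff: "v \<in> nbs es A R \<longleftrightarrow> v \<in> A \<and> (v \<in> R \<or> (\<exists>w \<in> R. adj es v w))"
  by (simp add: nbs_def)

lemma set_expd: "set (expd es A R) = nbs es (set A) (set R)"
  by (auto simp: expd_def nbs_def)

lemma set_expd_funpow: "set ((expd es A ^^ n) R) = (nbs es (set A) ^^ n) (set R)"
  by (induction n) (auto simp: set_expd)

lemma nbs_mono: "R \<subseteq> R' \<Longrightarrow> nbs es A R \<subseteq> nbs es A R'"
  by (auto simp: nbs_def)

lemma nbs_funpow_subset: "R \<subseteq> A \<Longrightarrow> (nbs es A ^^ n) R \<subseteq> A"
  by (cases n) (auto simp: nbs_def)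

lemma nbs_funpow_mono: "R \<subseteq> R' \<Longrightarrow> (nbs es A ^^ n) R \<subseteq> (nbs es A ^^ n) R'"
proof (induction n)
  case (Suc n)
  then show ?case using nbs_mono[OF Suc.IH[OF Suc.prems]] by simp
qed simp

lemma nbs_increasing: "R \<subseteq> A \<Longrightarrow> R \<subseteq> nbs es A R"
  by (auto simp: nbs_def)

lemma nbs_funpow_increasing:
  assumes "R \<subseteq> A" "m \<le> n"
  shows "(nbs es A ^^ m) R \<subseteq> (nbs es A ^^ n) R"
  using assms(2)
proof (induction n rule: dec_induct)
  case (step n)
  then show ?case using nbs_increasing[OF nbs_funpow_subset[OF assms(1), where n = n and es = es], where es = es]
    by auto
qed simp

text \<open>As long as no fixed point is reached, every round adds a vertex; \<open>card A\<close>
  such rounds after the initial vertex would give more than \<open>card A\<close> vertices.\<close>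

lemma nbs_stable:
  assumes "finite A" "v \<in> A"
  shows "nbs es A ((nbs es A ^^ card A) {v}) = (nbs es A ^^ card A) {v}"
proof -
  let ?R = "\<lambda>n. (nbs es A ^^ n) {v}"
  have sub: "?R n \<subseteq> A" for n using nbs_funpow_subset[of "{v}" A] assms by blast
  have "Suc n \<le> card (?R n) \<or> nbs es A (?R n) = ?R n" for n
  proof (induction n)
    case (Suc n)
    show ?case
    proof (cases "nbs es A (?R n) = ?R n")
      case False
      then have "?R n \<subset> nbs es A (?R n)" using nbs_increasing[OF sub] by blast
      then have "card (?R n) < card (?R (Suc n))"
        using sub[of "Suc n"] assms(1) by (intro psubset_card_mono) (auto intro: finite_subset)
      then show ?thesis using Suc False by auto
    qed simp
  qed simp
  from this[of "card A"] show ?thesis using card_mono[OF assms(1) sub[of "card A"]] by auto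
qed

lemma component:
  fixes es :: "('a \<times> 'a) list"
  assumes "finite A" "v \<in> A"
  defines "K \<equiv> (nbs es A ^^ card A) {v}"
  shows "v \<in> K" "K \<subseteq> A" "\<And>a b. a \<in> K \<Longrightarrow> b \<in> A \<Longrightarrow> adj es a b \<Longrightarrow> b \<in> K"
    "connected_in (eset es) K"
proof -
  show "v \<in> K" unfolding K_def using nbs_funpow_increasing[of "{v}" A 0 "card A" es] assms by auto
  show KA: "K \<subseteq> A" unfolding K_def using nbs_funpow_subset[of "{v}" A] assms by blast
  have stable: "nbs es A K = K" unfolding K_def by (rule nbs_stable[OF assms(1,2)])
  show "\<And>a b. a \<in> K \<Longrightarrow> b \<in> A \<Longrightarrow> adj es a b \<Longrightarrow> b \<in> K"
    using stable adj_sym unfolding nbs_def by fast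
  have step: "K \<subseteq> Y" if Y: "v \<in> Y" "\<And>a b. a \<in> Y \<Longrightarrow> a \<in> K \<Longrightarrow> b \<in> K \<Longrightarrow> adj es a b \<Longrightarrow> b \<in> Y" for Y
  proof -
    have inK: "n \<le> card A \<Longrightarrow> (nbs es A ^^ n) {v} \<subseteq> K" for n
      unfolding K_def using assms(2) by (intro nbs_funpow_increasing) auto
    have "n \<le> card A \<Longrightarrow> (nbs es A ^^ n) {v} \<subseteq> Y" for n
    proof (induction n)
      case (Suc n)
      have "b \<in> Y" if b: "b \<in> (nbs es A ^^ Suc n) {v}" for b
      proof -
        consider "b \<in> (nbs es A ^^ n) {v}" | a where "a \<in> (nbs es A ^^ n) {v}" "adj es b a"
          using b by (auto simp: nbs_def)
        then show ?thesis
        proof cases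
          case 2
          then have "a \<in> Y" "a \<in> K" "b \<in> K" using Suc inK[of n] inK[of "Suc n"] b by auto
          then show ?thesis using Y(2) 2(2) adj_sym[of es a b] by blast
        qed (use Suc in auto)
      qed
      then show ?case by blast
    qed (use Y in simp)
    then show ?thesis unfolding K_def by blast
  qed
  show "connected_in (eset es) K"
    unfolding connected_in_def
  proof (intro allI impI)
    fix Y assume Y: "Y \<subseteq> K" "Y \<noteq> {}" "\<forall>a \<in> Y. \<forall>b \<in> K. {a, b} \<in> eset es \<longrightarrow> b \<in> Y"
    show "Y = K"
    proof (cases "v \<in> Y")
      case True
      then show ?thesis using step[of Y] Y by (auto simp: adj_eset)
    next
      case False
      \<comment> \<open>By symmetry of adjacency the complement of a closed set is closed as well.
        It contains \<open>v\<close> and thus all of \<open>K\<close>, which makes \<open>Y\<close>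
        empty.\<close>
      have "K \<subseteq> - Y"
      proof (rule step)
        fix a b assume "a \<in> - Y" "a \<in> K" "b \<in> K" "adj es a b"
        then show "b \<in> - Y" using Y(3) adj_sym[of es a b] by (auto simp: adj_eset)
      qed (use False in simp)
      then show ?thesis using Y by blast
    qed
  qed
qed

text \<open>
  Removing \<open>S\<close> breaks \<open>C\<close> into the singletons of \<open>S\<close> and the components of \<open>C - S\<close>.
\<close>

definition part :: "('a \<times> 'a) list \<Rightarrow> 'a set \<Rightarrow> 'a set \<Rightarrow> 'a list list \<Rightarrow> bool" where
  "part es S C ps \<longleftrightarrow> distinct (concat ps) \<and> set (concat ps) = C \<and> [] \<notin> set ps \<and>
    (\<forall>p \<in> set ps. (\<exists>b \<in> S. p = [b]) \<or>
      (set p \<inter> S = {} \<and> (\<forall>a \<in> set p. \<forall>b \<in> C - S. adj es a b \<longrightarrow> b \<in> set p) \<and>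
       connected_in (eset es) (set p)))"

lemma length_le_concat: "[] \<notin> set ps \<Longrightarrow> length ps \<le> length (concat ps)"
proof (induction ps)
  case (Cons p ps)
  then have "1 \<le> length p" by (cases p) auto
  with Cons show ?case by simp
qed simp

lemma part_length: "part es S C ps \<Longrightarrow> length ps \<le> card C"
  using length_le_concat[of ps] distinct_card[of "concat ps"] by (auto simp: part_def)

lemma part_piece: "part es S C ps \<Longrightarrow> p \<in> set ps \<Longrightarrow> set p \<subseteq> C \<and> distinct p \<and> p \<noteq> []"
  by (auto simp: part_def distinct_concat_iff)

lemma part_empty: "part es {} C ps \<longleftrightarrow> distinct (concat ps) \<and> set (concat ps) = C \<and> [] \<notin> set ps \<and>
    (\<forall>p \<in> set ps. (\<forall>a \<in> set p. \<forall>b \<in> C. adj es a b \<longrightarrow> b \<in> set p) \<and> connected_in (eset es) (set p))"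
  by (simp add: part_def)

text \<open>The pieces of the rest remain closed when \<open>K\<close> is added back: an edge from
  them into \<open>K\<close> would, read backwards, leave \<open>K\<close>.\<close>

lemma part_Cons:
  assumes K: "distinct K" "K \<noteq> []" "set K \<subseteq> C" "connected_in (eset es) (set K)"
     "\<And>a b. a \<in> set K \<Longrightarrow> b \<in> C \<Longrightarrow> adj es a b \<Longrightarrow> b \<in> set K"
    and ps: "part es {} (C - set K) ps"
  shows "part es {} C (K # ps)"
proof -
  have "b \<in> set p" if "p \<in> set ps" "a \<in> set p" "b \<in> C" "adj es a b" for p a b
  proof -
    have "a \<in> C - set K" using part_piece[OF ps that(1)] that(2) by blast
    then have "b \<notin> set K" using K(5)[of b a] that(4) adj_sym[of es a b] by blast
    then show ?thesis using ps that unfolding part_empty by blast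
  qed
  moreover note ps[unfolded part_empty]
  moreover have "set (concat (K # ps)) = C"
    using K(3) ps unfolding part_empty by (simp only: concat.simps set_append) blast
  moreover have "distinct (concat (K # ps))"
    using K(1) ps unfolding part_empty by (simp only: concat.simps distinct_append) blast
  ultimately show ?thesis
    unfolding part_empty using K(2,4,5) by (simp only: list.set ball_simps insert_iff) blast
qed

lemma part_singletons:
  assumes "part es {} C ps" "distinct S" "set S \<inter> C = {}"
  shows "part es (set S) (set S \<union> C) (map (\<lambda>b. [b]) S @ ps)"
  unfolding part_def
proof (intro conjI ballI)
  have c: "concat (map (\<lambda>b. [b]) S) = S" by simp
  note ps = assms(1)[unfolded part_empty]
  show "distinct (concat (map (\<lambda>b. [b]) S @ ps))"
    using ps assms(2,3) by (simp only: concat_append c distinct_append)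
  show "set (concat (map (\<lambda>b. [b]) S @ ps)) = set S \<union> C"
    using ps by (simp only: concat_append c set_append)
  show "[] \<notin> set (map (\<lambda>b. [b]) S @ ps)" using ps by auto
  fix p assume "p \<in> set (map (\<lambda>b. [b]) S @ ps)"
  then consider "\<exists>b \<in> set S. p = [b]" | "p \<in> set ps" by auto
  then show "(\<exists>b \<in> set S. p = [b]) \<or> (set p \<inter> set S = {} \<and>
      (\<forall>a \<in> set p. \<forall>b \<in> set S \<union> C - set S. adj es a b \<longrightarrow> b \<in> set p) \<and> connected_in (eset es) (set p))"
  proof cases
    case 2
    then have "set p \<inter> set S = {}" using part_piece[OF assms(1) 2] assms(3) by blast
    then show ?thesis using ps 2 by blast
  qed simp
qed

text \<open>\<open>S\<close> determines the pieces up to the order of listing. Quantifying over all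
  \<open>ps\<close> covers whichever listing the program produces.\<close>

definition ok_split :: "(nat \<times> nat) list \<Rightarrow> nat \<Rightarrow> nat set \<Rightarrow> nat set \<Rightarrow> bool" where
  "ok_split es n C S \<longleftrightarrow>
    (\<forall>ps. part es S C ps \<longrightarrow> 2 \<le> length ps \<and> (\<forall>p \<in> set ps. ecut es (set p) \<le> n))"

text \<open>What a successful search delivers. The set \<open>S\<close> and the bound on its size
  are kept because the joint boundary of the pieces is later estimated through
  \<open>S\<close>.\<close>

definition good_split :: "(nat \<times> nat) list \<Rightarrow> nat \<Rightarrow> nat set \<Rightarrow> nat list list \<Rightarrow> bool" where
  "good_split es n C ps \<longleftrightarrow> 2 \<le> length ps \<and> (\<forall>p \<in> set ps. ecut es (set p) \<le> n) \<and>
    (\<exists>S \<subseteq> C. card S \<le> n \<and> part es S C ps)"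

section \<open>Correctness and cost of the search for a split\<close>

context budget begin

lemma Comps_spec:
  assumes "se es"
  shows "sl C \<Longrightarrow> distinct C \<Longrightarrow> \<exists>ps. fn Comps (ee k es ;; en C) = Some (enc_list en ps) \<and>
    part es {} (set C) ps \<and> ct Comps (ee k es ;; en C) \<le> B ^ 10 * (length C + 1)"
proof (induction C rule: length_induct)
  case (1 C)
  show ?case
  proof (cases C)
    case Nil
    have v: "fn Comps (ee k es ;; en C) = Some (enc_list en [])"
      unfolding Nil by (subst fn_unfold) (simp add: body.simps)
    show ?thesis using ct_unfold[OF v] B B_pows v
      by (intro exI[of _ "[]"]) (simp add: Nil body.simps part_def)
  next
    case (Cons x C')
    define K where "K = (expd es C ^^ length C) [x]"
    have sK: "set K = (nbs es (set C) ^^ card (set C)) {x}"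
      using 1(3) by (simp add: K_def set_expd_funpow distinct_card)
    have xC: "x \<in> set C" by (simp add: Cons)
    note comp = component[OF finite_set xC, where es = es, folded sK]
    \<comment> \<open>The last round is exposed because its outcome is a filtered \<open>C\<close>;
      this makes \<open>K\<close> distinct and keeps it within the budget.\<close>
    have K': "K = expd es C ((expd es C ^^ length C') [x])"
      by (simp add: K_def Cons)
    have dK: "distinct K" unfolding K' expd_def using 1(3) by simp
    have slK: "sl K" unfolding K' using sl_expd 1(2) by blast
    let ?D = "filter (\<lambda>y. y \<notin> set K) C"
    have lD: "length ?D < length C" using comp(1) xC by (intro length_filter_less) auto
    have "sl ?D" "distinct ?D" using 1(2,3) sl_filter by auto
    then obtain ps where ps: "fn Comps (ee k es ;; en ?D) = Some (enc_list en ps)"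
      "part es {} (set ?D) ps" "ct Comps (ee k es ;; en ?D) \<le> B ^ 10 * (length ?D + 1)"
      using 1(1) lD by blast
    have v2: "fn Comps2 (en K ;; ee k es ;; en C) = Some (enc_list en (K # ps))"
      by (subst fn_unfold) (simp add: body.simps ps(1))
    have it: "fn Iter (VNum (length C) ;; (VNum x ;; VNum 0) ;; ee k es ;; en C) = Some (en K)"
      using fn_Iter[of "length C" "[x]" k es C] by (simp add: K_def)
    have ln: "fn Len (en C) = Some (VNum (length C))" by simp
    have C': "en C = VNum x ;; en C'" by (simp add: Cons)
    have v: "fn Comps (ee k es ;; en C) = Some (enc_list en (K # ps))"
      using v2 it ln unfolding C' by (subst fn_unfold) (simp add: body.simps del: fn_Len fn_Iter)
    have "ct Comps2 (en K ;; ee k es ;; en C) \<le> 40 + ct Diff (en K ;; en C) + ct Comps (ee k es ;; en ?D)"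
      using ct_unfold[OF v2] ps(1) by (simp add: body.simps)
    moreover have "ct Comps (ee k es ;; en C) \<le> 60 + ct Len (en C) +
       ct Iter (VNum (length C) ;; (VNum x ;; VNum 0) ;; ee k es ;; en C) + ct Comps2 (en K ;; ee k es ;; en C)"
      using ct_unfold[OF v] v2 it ln unfolding C' by (simp add: body.simps del: fn_Len fn_Iter)
    moreover have "ct Iter (VNum (length C) ;; (VNum x ;; VNum 0) ;; ee k es ;; en C) \<le> B ^ 9"
      using ct_Iter[OF 1(2) assms, of "[x]" "length C" k] 1(2) sl_length[OF 1(2)] B by (simp add: Cons)
    moreover have "ct Len (en C) \<le> B ^ 3" "ct Diff (en K ;; en C) \<le> B ^ 5"
      using ct_Len[of C VNum] ct_Diff[OF slK 1(2)] sl_length[OF 1(2)] by auto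
    moreover have "B ^ 10 * (length ?D + 1) + B ^ 10 \<le> B ^ 10 * (length C + 1)"
    proof -
      have "B ^ 10 * (length ?D + 1) + B ^ 10 = B ^ 10 * (length ?D + 2)" by (simp add: algebra_simps)
      also have "\<dots> \<le> B ^ 10 * (length C + 1)" using lD by (intro mult_le_mono2) linarith
      finally show ?thesis .
    qed
    ultimately have "ct Comps (ee k es ;; en C) \<le> B ^ 10 * (length C + 1)"
      using ps(3) B B_pows by linarith
    moreover have "part es {} (set C) (K # ps)"
    proof (rule part_Cons)
      show "part es {} (set C - set K) ps"
        using ps(2) by (simp add: set_diff_eq)
    qed (use comp dK in auto)
    ultimately show ?thesis using v by blast
  qed
qed

lemma Pieces_spec:
  assumes "se es" "sl C" "distinct C" "sl S" "distinct S" "set S \<inter> set C = {}"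
  shows "\<exists>ps. fn Pieces (ee k es ;; en C ;; en S) = Some (enc_list en ps) \<and>
    part es (set S) (set S \<union> set C) ps \<and> ct Pieces (ee k es ;; en C ;; en S) \<le> B ^ 12"
proof -
  obtain ps where ps: "fn Comps (ee k es ;; en C) = Some (enc_list en ps)"
    "part es {} (set C) ps" "ct Comps (ee k es ;; en C) \<le> B ^ 10 * (length C + 1)"
    using Comps_spec[OF assms(1-3)] by blast
  have c: "ct Comps (ee k es ;; en C) \<le> B ^ 11"
    using ps(3) loop_le[OF sl_length[OF assms(2)], of 10] by simp
  have v: "fn Pieces (ee k es ;; en C ;; en S) = Some (enc_list en (map (\<lambda>b. [b]) S @ ps))" for S
  proof (induction S)
    case Nil
    show ?case by (subst fn_unfold) (simp add: body.simps ps(1))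
  next
    case (Cons x S)
    then show ?case by (subst fn_unfold) (simp add: body.simps)
  qed
  have "ct Pieces (ee k es ;; en C ;; en S) \<le> 20 + 40 * length S + ct Comps (ee k es ;; en C)" for S
  proof (induction S)
    case Nil
    show ?case using ct_unfold[OF v[of "[]"]] by (simp add: body.simps ps(1))
  next
    case (Cons x S)
    have "ct Pieces (ee k es ;; en C ;; en (x # S)) \<le> 40 + ct Pieces (ee k es ;; en C ;; en S)"
      using v[of S] by (subst ct_unfold[OF v[of "x # S"]]) (simp add: body.simps)
    then show ?case using Cons by simp
  qed
  from this[of S] have "ct Pieces (ee k es ;; en C ;; en S) \<le> B ^ 12"
    using c B B_pows sl_length[OF assms(4)] by linarith
  then show ?thesis using v part_singletons[OF ps(2) assms(5,6)] by blast
qed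

abbreviation search_arg :: "nat \<Rightarrow> nat list \<Rightarrow> nat \<Rightarrow> (nat \<Rightarrow> nat \<Rightarrow> nat) \<Rightarrow> (nat \<times> nat) list
    \<Rightarrow> nat list \<Rightarrow> nat list \<Rightarrow> val" where
  "search_arg j S n k es C rest \<equiv> VNum j ;; en S ;; VNum n ;; ee k es ;; en C ;; en rest"

lemma Search_acc:
  assumes "r \<noteq> VNum 0"
  shows "fn Search (r ;; j ;; S ;; n ;; e ;; C ;; rest) = Some r"
    "ct Search (r ;; j ;; S ;; n ;; e ;; C ;; rest) \<le> 10"
proof -
  show v: "fn Search (r ;; j ;; S ;; n ;; e ;; C ;; rest) = Some r"
    using assms by (subst fn_unfold) (simp add: body.simps)
  show "ct Search (r ;; j ;; S ;; n ;; e ;; C ;; rest) \<le> 10"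
    using assms by (subst ct_unfold[OF v]) (simp add: body.simps)
qed

lemma good_split_nonzero: "good_split es n C ps \<Longrightarrow> enc_list en ps \<noteq> VNum 0"
  by (auto simp: good_split_def)

text \<open>
  The additional summand \<open>B ^ 13\<close> on the left lets the recurrence for the number of recursive calls
  close without lower-order terms.
\<close>

lemma Search_spec:
  assumes es: "se es" and C: "sl C" "distinct C" and n: "n < B" and C0: "C \<noteq> []"
  shows "distinct S \<Longrightarrow> distinct rest \<Longrightarrow> set S \<inter> set rest = {} \<Longrightarrow> set S \<union> set rest \<subseteq> set C \<Longrightarrow>
    length S + j \<le> n \<Longrightarrow>
    \<exists>r. fn Search (VNum 0 ;; search_arg j S n k es C rest) = Some r \<and>
      (r = VNum 0 \<and> (\<forall>S' \<subseteq> set rest. card S' \<le> j \<longrightarrow> \<not> ok_split es n (set C) (S' \<union> set S)) \<or>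
       (\<exists>ps. good_split es n (set C) ps \<and> r = enc_list en ps)) \<and>
      ct Search (VNum 0 ;; search_arg j S n k es C rest) + B ^ 13
        \<le> B ^ 13 * (2 * (length rest + 1) ^ j)"
proof (induction rest arbitrary: j S)
  \<comment> \<open>The recursion ends when no more vertices may be added or none are left; both
    ends run the same check.\<close>
  have base: "\<exists>r. fn Search (VNum 0 ;; search_arg j S n k es C rest) = Some r \<and>
      (r = VNum 0 \<and> (\<forall>S' \<subseteq> set rest. card S' \<le> j \<longrightarrow> \<not> ok_split es n (set C) (S' \<union> set S)) \<or>
       (\<exists>ps. good_split es n (set C) ps \<and> r = enc_list en ps)) \<and>
      ct Search (VNum 0 ;; search_arg j S n k es C rest) + B ^ 13
        \<le> B ^ 13 * (2 * (length rest + 1) ^ j)"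
    if a: "distinct S" "set S \<subseteq> set C" "length S \<le> n" "rest = [] \<or> j = 0" for S :: "nat list" and rest j
  proof -
    let ?C = "filter (\<lambda>x. x \<notin> set S) C"
    have lS: "length S \<le> length C"
      using a(1,2) C(2) card_mono[of "set C" "set S"] by (simp add: distinct_card)
    have slS: "sl S" using sl_subset[OF C(1) a(2) lS] .
    have "set S \<inter> set ?C = {}" "distinct ?C" "sl ?C" using C sl_filter by auto
    then obtain ps where ps: "fn Pieces (ee k es ;; en ?C ;; en S) = Some (enc_list en ps)"
      "part es (set S) (set S \<union> set ?C) ps" "ct Pieces (ee k es ;; en ?C ;; en S) \<le> B ^ 12"
      using Pieces_spec[OF es _ _ slS a(1)] by blast
    have SC: "set S \<union> set ?C = set C" using a(2) by auto
    have ps0: "ps \<noteq> []" using ps(2) C0 unfolding part_def SC by auto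
    define r where "r = (if length ps \<ge> 2 \<and> (\<forall>p \<in> set ps. ecut es (set p) \<le> n) then enc_list en ps else VNum 0)"
    have ck: "fn Check (VNum n ;; ee k es ;; enc_list en ps) = Some r"
      using ps0 by (simp add: r_def)
    have v: "fn Search (VNum 0 ;; search_arg j S n k es C rest) = Some r"
      using a(4) ps(1) ck by (subst fn_unfold) (auto simp: body.simps simp del: fn_Check)
    have "ct Search (VNum 0 ;; search_arg j S n k es C rest) \<le> 120 +
       ct Diff (en S ;; en C) + ct Pieces (ee k es ;; en ?C ;; en S) + ct Check (VNum n ;; ee k es ;; enc_list en ps)"
      using a(4) ps(1) by (subst ct_unfold[OF v]) (auto simp: body.simps simp del: fn_Check)
    moreover have "ct Diff (en S ;; en C) \<le> B ^ 5" using ct_Diff slS C by blast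
    moreover have "ct Check (VNum n ;; ee k es ;; enc_list en ps) \<le> B ^ 8"
    proof (rule ct_Check[OF ps0 _ _ es n])
      show "length ps < B" using part_length[OF ps(2)] SC C sl_length[OF C(1)] 
        by (simp add: distinct_card)
      show "\<forall>p \<in> set ps. sl p"
      proof
        fix p assume p: "p \<in> set ps"
        have "set p \<subseteq> set C" "distinct p" using part_piece[OF ps(2) p] SC by auto
        then show "sl p" using sl_subset[OF C(1)] card_mono[of "set C" "set p"] C(2)
          by (simp add: distinct_card)
      qed
    qed
    ultimately have "ct Search (VNum 0 ;; search_arg j S n k es C rest) + B ^ 13
        \<le> B ^ 13 * 2" using ps(3) B B_pows by linarith
    also have "\<dots> \<le> B ^ 13 * (2 * (length rest + 1) ^ j)" by (intro mult_le_mono2) auto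
    finally have cost: "ct Search (VNum 0 ;; search_arg j S n k es C rest) + B ^ 13
        \<le> B ^ 13 * (2 * (length rest + 1) ^ j)" .
    show ?thesis
    proof (cases "length ps \<ge> 2 \<and> (\<forall>p \<in> set ps. ecut es (set p) \<le> n)")
      case True
      have "card (set S) \<le> n" using a(1,3) by (simp add: distinct_card)
      then have "good_split es n (set C) ps"
        using True a(2) ps(2) unfolding good_split_def SC by blast
      then show ?thesis using v cost True by (auto simp: r_def)
    next
      case False
      then have "\<not> ok_split es n (set C) (set S)" using ps(2) unfolding ok_split_def SC by blast
      moreover have "S' = {}" if "S' \<subseteq> set rest" "card S' \<le> j" for S'
        using a(4) that finite_subset[OF that(1)] by auto
      ultimately have "\<forall>S' \<subseteq> set rest. card S' \<le> j \<longrightarrow> \<not> ok_split es n (set C) (S' \<union> set S)"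
        by (metis sup_bot_left)
      moreover have "r = VNum 0" unfolding r_def using False by (simp only: if_False)
      ultimately show ?thesis using v cost by blast
    qed
  qed
  {
    case Nil
    then show ?case using base[of S "[]" j] by simp
  next
    case (Cons x rest)
    show ?case
    proof (cases j)
      case 0
      then show ?thesis using base[of S "x # rest" j] Cons.prems by simp
    next
      case (Suc i)
      let ?S1 = "VNum 0 ;; search_arg i (x # S) n k es C rest"
      let ?S2 = "VNum 0 ;; search_arg j S n k es C rest"
      let ?S0 = "VNum 0 ;; search_arg j S n k es C (x # rest)"
      obtain r1 where r1: "fn Search ?S1 = Some r1"
        "r1 = VNum 0 \<and> (\<forall>S' \<subseteq> set rest. card S' \<le> i \<longrightarrow> \<not> ok_split es n (set C) (S' \<union> set (x # S))) \<or>
         (\<exists>ps. good_split es n (set C) ps \<and> r1 = enc_list en ps)"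
        "ct Search ?S1 + B ^ 13 \<le> B ^ 13 * (2 * (length rest + 1) ^ i)"
        using Cons.IH[of "x # S" i] Cons.prems Suc by auto
      obtain r2 where r2: "fn Search ?S2 = Some r2"
        "r2 = VNum 0 \<and> (\<forall>S' \<subseteq> set rest. card S' \<le> j \<longrightarrow> \<not> ok_split es n (set C) (S' \<union> set S)) \<or>
         (\<exists>ps. good_split es n (set C) ps \<and> r2 = enc_list en ps)"
        "ct Search ?S2 + B ^ 13 \<le> B ^ 13 * (2 * (length rest + 1) ^ j)"
        using Cons.IH[of S j] Cons.prems by auto
      let ?S3 = "r1 ;; search_arg j S n k es C rest"
      define r where "r = (if r1 = VNum 0 then r2 else r1)"
      have r3: "fn Search ?S3 = Some r" "ct Search ?S3 \<le> 10 + ct Search ?S2"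
        using r2(1) Search_acc[of r1] by (cases "r1 = VNum 0"; force simp: r_def intro: trans_le_add1)+
      have v: "fn Search ?S0 = Some r"
        using r1(1) r3(1) by (subst fn_unfold) (simp add: body.simps Suc)
      have j: "j < B" using Cons.prems n by simp
      have "ct Search ?S0 \<le> 180 + floorlog 2 j + ct Search ?S1 + ct Search ?S3"
        using r1(1) r3(1) by (subst ct_unfold[OF v]) (simp add: body.simps Suc)
      then have "ct Search ?S0 + B ^ 13 \<le> B ^ 13 * (2 * (length rest + 1) ^ i) + B ^ 13 * (2 * (length rest + 1) ^ j)"
        using r1(3) r2(3) r3(2) B B_pows bits_le[OF less_B_small, of j] j by linarith
      \<comment> \<open>With r for the length of \<open>rest\<close> and j = i + 1, the sum (r +
        1)^i + (r + 1)^j equals (r + 1)^i * (r + 2), which is at most (r + 2)^j.\<close>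
      also have "\<dots> = B ^ 13 * (2 * ((length rest + 1) ^ i * (length rest + 2)))"
        by (simp add: Suc algebra_simps)
      also have "\<dots> \<le> B ^ 13 * (2 * (length (x # rest) + 1) ^ j)"
      proof -
        have "(length rest + 1) ^ i * (length rest + 2) \<le> (length rest + 2) ^ i * (length rest + 2)"
          by (intro mult_le_mono1 power_mono) auto
        then show ?thesis using Suc by (intro mult_le_mono2) (simp add: mult.commute)
      qed
      finally have cost: "ct Search ?S0 + B ^ 13 \<le> B ^ 13 * (2 * (length (x # rest) + 1) ^ j)" .
      have "\<not> ok_split es n (set C) (S' \<union> set S)"
        if z: "r = VNum 0" and S': "S' \<subseteq> set (x # rest)" "card S' \<le> j" for S'
      proof -
        have z1: "r1 = VNum 0" "r2 = VNum 0" using z by (auto simp: r_def split: if_splits)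
        show ?thesis
        proof (cases "x \<in> S'")
          case True
          have "card (S' - {x}) \<le> i" "S' - {x} \<subseteq> set rest"
            using S' True Suc finite_subset[OF S'(1)] by auto
          moreover have "S' \<union> set S = (S' - {x}) \<union> set (x # S)" using True by auto
          ultimately show ?thesis using r1(2) z1 good_split_nonzero by metis
        next
          case False
          then have "S' \<subseteq> set rest" using S' by auto
          then show ?thesis using r2(2) z1 S' good_split_nonzero by metis
        qed
      qed
      moreover have "r = VNum 0 \<or> (\<exists>ps. good_split es n (set C) ps \<and> r = enc_list en ps)"
        using r1(2) r2(2) by (auto simp: r_def)
      ultimately show ?thesis using v cost by blast
    qed
  }
qed

text \<open>Induction downwards from \<open>K\<close>, where the assumed \<open>S\<close> rules out
  failure. A failure below \<open>K\<close> passes on to the next bound, and a split for some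
  \<open>n \<le> K\<close> is also one for \<open>K\<close>.\<close>

lemma Split_spec:
  assumes es: "se es" and C: "sl C" "distinct C" "C \<noteq> []" and K: "K < B" "2 * (length C + 1) ^ K \<le> B"
    and S: "S \<subseteq> set C" "card S \<le> K" "ok_split es K (set C) S"
  shows "n \<le> K \<Longrightarrow> \<exists>ps. fn Split (VNum n ;; ee k es ;; en C) = Some (enc_list en ps) \<and>
    good_split es K (set C) ps \<and> ct Split (VNum n ;; ee k es ;; en C) \<le> B ^ 15 * (K - n + 1)"
proof (induction n rule: inc_induct)
  have srch: "\<exists>r. fn Search (VNum 0 ;; search_arg n [] n k es C C) = Some r \<and>
      (r = VNum 0 \<and> (\<forall>S' \<subseteq> set C. card S' \<le> n \<longrightarrow> \<not> ok_split es n (set C) S') \<or>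
       (\<exists>ps. good_split es K (set C) ps \<and> r = enc_list en ps)) \<and>
      ct Search (VNum 0 ;; search_arg n [] n k es C C) \<le> B ^ 14"
    if n: "n \<le> K" for n
  proof -
    obtain r where r: "fn Search (VNum 0 ;; search_arg n [] n k es C C) = Some r"
      "r = VNum 0 \<and> (\<forall>S' \<subseteq> set C. card S' \<le> n \<longrightarrow> \<not> ok_split es n (set C) S') \<or>
       (\<exists>ps. good_split es n (set C) ps \<and> r = enc_list en ps)"
      "ct Search (VNum 0 ;; search_arg n [] n k es C C) + B ^ 13
        \<le> B ^ 13 * (2 * (length C + 1) ^ n)"
      using Search_spec[OF es C(1,2) _ C(3), of n "[]" C n k] C n K(1) by auto
    have "2 * (length C + 1) ^ n \<le> 2 * (length C + 1) ^ K"
      using n by (intro mult_le_mono2 power_increasing) auto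
    then have "B ^ 13 * (2 * (length C + 1) ^ n) \<le> B ^ 13 * B"
      using K(2) by (intro mult_le_mono2) linarith
    then have "ct Search (VNum 0 ;; search_arg n [] n k es C C) \<le> B ^ 14"
      using r(3) by (simp add: power_Suc2[symmetric] del: power_Suc)
    moreover have "good_split es n (set C) ps \<Longrightarrow> good_split es K (set C) ps" for ps
      using n unfolding good_split_def by (meson le_trans)
    ultimately show ?thesis using r(1,2) by blast
  qed
  have found: "\<exists>ps. fn Split (VNum n ;; ee k es ;; en C) = Some (enc_list en ps) \<and>
    good_split es K (set C) ps \<and> ct Split (VNum n ;; ee k es ;; en C) \<le> B ^ 15"
    if r: "fn Search (VNum 0 ;; search_arg n [] n k es C C) = Some (enc_list en ps)"
      "ct Search (VNum 0 ;; search_arg n [] n k es C C) \<le> B ^ 14"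
      "good_split es K (set C) ps" for n ps
  proof -
    let ?r = "enc_list en ps"
    have nz: "ps \<noteq> []" using r(3) by (auto simp: good_split_def)
    have v2: "fn Split2 (?r ;; VNum n ;; ee k es ;; en C) = Some ?r"
      using nz by (subst fn_unfold) (simp add: body.simps)
    have v: "fn Split (VNum n ;; ee k es ;; en C) = Some ?r"
      using v2 r(1) by (subst fn_unfold) (simp add: body.simps)
    have "ct Split2 (?r ;; VNum n ;; ee k es ;; en C) \<le> 10"
      using nz by (subst ct_unfold[OF v2]) (simp add: body.simps)
    moreover have "ct Split (VNum n ;; ee k es ;; en C) \<le> 60 +
      ct Search (VNum 0 ;; search_arg n [] n k es C C) +
      ct Split2 (?r ;; VNum n ;; ee k es ;; en C)"
      using v2 r(1) by (subst ct_unfold[OF v]) (simp add: body.simps)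
    ultimately have "ct Split (VNum n ;; ee k es ;; en C) \<le> B ^ 15" using r(2) B B_pows by linarith
    then show ?thesis using v r(3) by blast
  qed
  {
    case base
    from srch[OF order.refl] obtain ps where
      "fn Search (VNum 0 ;; search_arg K [] K k es C C) = Some (enc_list en ps)"
      "good_split es K (set C) ps"
      "ct Search (VNum 0 ;; search_arg K [] K k es C C) \<le> B ^ 14"
      using S by blast
    from found[OF this(1,3,2)] show ?case by simp
  next
    case (step n)
    obtain r where r: "fn Search (VNum 0 ;; search_arg n [] n k es C C) = Some r"
      "r = VNum 0 \<or> (\<exists>ps. good_split es K (set C) ps \<and> r = enc_list en ps)"
      "ct Search (VNum 0 ;; search_arg n [] n k es C C) \<le> B ^ 14"
      using srch[OF less_imp_le[OF step.hyps(2)]] by metis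
    show ?case
    proof (cases "r = VNum 0")
      case False
      then obtain ps where "good_split es K (set C) ps" "r = enc_list en ps" using r(2) by blast
      from found[OF r(1)[unfolded this(2)] r(3) this(1)] obtain qs where
        "fn Split (VNum n ;; ee k es ;; en C) = Some (enc_list en qs)"
        "good_split es K (set C) qs" "ct Split (VNum n ;; ee k es ;; en C) \<le> B ^ 15" by blast
      moreover have "B ^ 15 * 1 \<le> B ^ 15 * (K - n + 1)" by (intro mult_le_mono2) simp
      ultimately show ?thesis by force
    next
      case True
      from step.IH obtain ps where ps: "fn Split (VNum (Suc n) ;; ee k es ;; en C) = Some (enc_list en ps)"
        "good_split es K (set C) ps" "ct Split (VNum (Suc n) ;; ee k es ;; en C) \<le> B ^ 15 * (K - Suc n + 1)"
        by blast
      have v2: "fn Split2 (r ;; VNum n ;; ee k es ;; en C) = Some (enc_list en ps)"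
        using True ps(1) by (subst fn_unfold) (simp add: body.simps)
      have v: "fn Split (VNum n ;; ee k es ;; en C) = Some (enc_list en ps)"
        using v2 r(1) by (subst fn_unfold) (simp add: body.simps)
      have "ct Split2 (r ;; VNum n ;; ee k es ;; en C) \<le> 40 + floorlog 2 n + ct Split (VNum (Suc n) ;; ee k es ;; en C)"
        using True ps(1) by (subst ct_unfold[OF v2]) (simp add: body.simps)
      moreover have "ct Split (VNum n ;; ee k es ;; en C) \<le> 60 +
        ct Search (VNum 0 ;; search_arg n [] n k es C C) +
        ct Split2 (r ;; VNum n ;; ee k es ;; en C)"
        using v2 r(1) by (subst ct_unfold[OF v]) (simp add: body.simps)
      moreover have "floorlog 2 n \<le> B" using step.hyps K by (intro bits_le less_B_small) simp
      moreover have "B ^ 15 * (K - Suc n + 1) + B ^ 15 = B ^ 15 * (K - n + 1)"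
        using step.hyps by (simp add: Suc_diff_Suc algebra_simps)
      ultimately have "ct Split (VNum n ;; ee k es ;; en C) \<le> B ^ 15 * (K - n + 1)"
        using ps(3) r(3) B B_pows by linarith
      then show ?thesis using v ps(2) by blast
    qed
  }
qed

end

section \<open>Boundary edges and neighbourhoods\<close>

locale edge_list =
  fixes V :: "nat set" and es :: "(nat \<times> nat) list"
  assumes simple: "simple_graph V (eset es)" and dist: "distinct (map (\<lambda>(u, v). {u, v}) es)"
begin

abbreviation \<Delta> where "\<Delta> \<equiv> max_degree V (eset es)"

lemma finV: "finite V" using simple by (simp add: simple_graph_def)

lemma edge_V: "(a, b) \<in> set es \<Longrightarrow> a \<in> V \<and> b \<in> V \<and> a \<noteq> b"
proof -
  assume "(a, b) \<in> set es"
  then have "{a, b} \<in> eset es" by (force simp: eset_def)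
  then have "\<exists>u\<in>V. \<exists>v\<in>V. u \<noteq> v \<and> {a, b} = {u, v}"
    using simple unfolding simple_graph_def by blast
  then show ?thesis by (auto simp: doubleton_eq_iff)
qed

lemma distinct_es: "distinct es"
  using dist by (simp add: distinct_map)

lemma edge_unique:
  assumes "e \<in> set es" "e' \<in> set es" "{fst e, snd e} = {fst e', snd e'}"
  shows "e = e'"
proof -
  have "inj_on (\<lambda>(u, v). {u, v}) (set es)" using dist by (simp add: distinct_map)
  then show ?thesis using assms unfolding inj_on_def by (auto simp: case_prod_unfold)
qed

definition inc :: "nat \<Rightarrow> (nat \<times> nat) set" where
  "inc v = {(a, b) \<in> set es. a = v \<or> b = v}"

lemma card_inc: 
  assumes "v \<in> V"
  shows "card (inc v) \<le> \<Delta>"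
proof -
  have "inj_on (\<lambda>(u, v). {u, v}) (inc v)"
    using dist by (auto simp: distinct_map inc_def intro: inj_on_subset)
  then have "card (inc v) = card ((\<lambda>(u, v). {u, v}) ` inc v)" by (simp add: card_image)
  also have "(\<lambda>(u, v). {u, v}) ` inc v = {e \<in> eset es. v \<in> e}"
    by (force simp: inc_def eset_def)
  also have "card \<dots> \<le> \<Delta>"
    using assms finV unfolding max_degree_def by (intro Max_ge) auto
  finally show ?thesis .
qed

lemma finite_inc [simp]: "finite (inc v)"
  unfolding inc_def by (rule finite_subset[of _ "set es"]) auto

lemma ecut_card: "ecut es X = card {(a, b) \<in> set es. (a \<in> X) \<noteq> (b \<in> X)}"
proof -
  have "ecut es X = card (set (filter (\<lambda>(a, b). (a \<in> X) \<noteq> (b \<in> X)) es))"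
    unfolding ecut_def by (rule distinct_card[symmetric]) (simp add: distinct_es)
  also have "set (filter (\<lambda>(a, b). (a \<in> X) \<noteq> (b \<in> X)) es) = {(a, b) \<in> set es. (a \<in> X) \<noteq> (b \<in> X)}"
    by auto
  finally show ?thesis .
qed

text \<open>
  The boundary edges of \<open>C\<close> at \<open>v\<close>; their numbers are the vertex weights for \<open>balanced_bag\<close>.
\<close>

definition bcut :: "nat set \<Rightarrow> nat \<Rightarrow> (nat \<times> nat) set" where
  "bcut C v = {(a, b) \<in> set es. (a = v \<and> b \<notin> C) \<or> (b = v \<and> a \<notin> C)}"

lemma finite_bcut [simp]: "finite (bcut C v)"
  unfolding bcut_def by (rule finite_subset[of _ "set es"]) auto

lemma sum_bcut:
  assumes "X \<subseteq> C" "finite X"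
  shows "(\<Sum>v \<in> X. card (bcut C v)) = card (\<Union>v \<in> X. bcut C v)"
proof -
  have "\<forall>i \<in> X. \<forall>j \<in> X. i \<noteq> j \<longrightarrow> bcut C i \<inter> bcut C j = {}"
    using assms(1) by (auto simp: bcut_def)
  then show ?thesis using assms(2) by (simp add: card_UN_disjoint)
qed

text \<open>An edge that leaves \<open>p\<close> either leaves \<open>C\<close> too, and is then
  counted at its end point in \<open>p\<close>, or it ends in \<open>S\<close>, because
  \<open>p\<close> is closed within \<open>C - S\<close>.\<close>

lemma ecut_piece:
  assumes "p \<subseteq> C" "C \<subseteq> V" "S \<subseteq> C" "p \<inter> S = {}"
    and closed: "\<And>a b. a \<in> p \<Longrightarrow> b \<in> C - S \<Longrightarrow> adj es a b \<Longrightarrow> b \<in> p"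
  shows "ecut es p \<le> (\<Sum>v \<in> p. card (bcut C v)) + card S * \<Delta>"
proof -
  have "finite C" by (rule finite_subset[OF assms(2) finV])
  then have fin: "finite p" "finite S" using assms(1,3) by (auto intro: finite_subset)
  have "{(a, b) \<in> set es. (a \<in> p) \<noteq> (b \<in> p)} \<subseteq> (\<Union>v \<in> p. bcut C v) \<union> (\<Union>v \<in> S. inc v)"
  proof clarify
    fix a b assume ab: "(a, b) \<in> set es" "(a \<in> p) \<noteq> (b \<in> p)" "(a, b) \<notin> (\<Union>v \<in> S. inc v)"
    then have S: "a \<notin> S" "b \<notin> S" by (auto simp: inc_def)
    have "adj es a b" "adj es b a" using ab by (auto simp: adj_def)
    show "(a, b) \<in> (\<Union>v \<in> p. bcut C v)"
    proof (cases "a \<in> p")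
      case True
      then have "b \<notin> C" using ab(2) S closed[OF True _ \<open>adj es a b\<close>] by blast
      then have "(a, b) \<in> bcut C a" using ab(1) by (simp add: bcut_def)
      then show ?thesis using True by blast
    next
      case False
      then have b: "b \<in> p" using ab(2) by blast
      then have "a \<notin> C" using False S closed[OF b _ \<open>adj es b a\<close>] by blast
      then have "(a, b) \<in> bcut C b" using ab(1) by (simp add: bcut_def)
      then show ?thesis using b by blast
    qed
  qed
  then have "ecut es p \<le> card ((\<Union>v \<in> p. bcut C v) \<union> (\<Union>v \<in> S. inc v))"
    unfolding ecut_card using fin by (intro card_mono) auto
  also have "\<dots> \<le> card (\<Union>v \<in> p. bcut C v) + card (\<Union>v \<in> S. inc v)" by (rule card_Un_le)
  also have "card (\<Union>v \<in> S. inc v) \<le> (\<Sum>v \<in> S. card (inc v))" using fin by (intro card_UN_le)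
  also have "\<dots> \<le> card S * \<Delta>"
  proof -
    have "card (inc v) \<le> \<Delta>" if "v \<in> S" for v using card_inc that assms(2,3) by blast
    from sum_bounded_above[of S, OF this] show ?thesis by simp
  qed
  finally show ?thesis using sum_bcut[OF assms(1) fin(1)] by simp
qed

lemma ecut_singleton: "b \<in> V \<Longrightarrow> ecut es {b} \<le> \<Delta>"
proof -
  assume "b \<in> V"
  have "ecut es {b} \<le> card (inc b)"
    unfolding ecut_card by (rule card_mono[OF finite_inc]) (auto simp: inc_def)
  then show ?thesis using card_inc[OF \<open>b \<in> V\<close>] by simp
qed

lemma exists_split:
  assumes C: "C \<subseteq> V" "2 \<le> card C" and K: "K = 2 * (treewidth V (eset es) + 1) * (\<Delta> + 1)"
    and cut: "ecut es C \<le> K"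
  shows "\<exists>S \<subseteq> C. card S \<le> K \<and> ok_split es K C S"
proof -
  let ?E = "eset es"
  let ?tw = "treewidth V ?E"
  have finC: "finite C" using C(1) finV finite_subset by blast
  obtain N :: "nat set" and F Bag where td: "tree_decomposition V ?E N F Bag"
    and width: "\<And>x. x \<in> N \<Longrightarrow> card (Bag x) \<le> ?tw + 1"
    using treewidth_decomposition[OF simple] by blast
  define w where "w v = (if v \<in> C then card (bcut C v) else 0)" for v
  have wX: "sum w X = (\<Sum>v \<in> X. card (bcut C v))" if "X \<subseteq> C" for X
    using that by (intro sum.cong) (auto simp: w_def)
  have "(\<Union>v \<in> C. bcut C v) = {(a, b) \<in> set es. (a \<in> C) \<noteq> (b \<in> C)}" by (auto simp: bcut_def)
  then have wC: "sum w C = ecut es C" unfolding wX[OF order.refl] ecut_card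
    by (simp add: sum_bcut finC)
  have wV: "sum w V = ecut es C"
    unfolding wC[symmetric] using C(1) finV by (intro sum.mono_neutral_right) (auto simp: w_def)
  \<comment> \<open>The last conjunct guarantees progress: a bag that misses a connected
    \<open>C\<close> would leave it in one piece.\<close>
  have "\<exists>x \<in> N. (\<forall>X \<subseteq> C. X \<inter> Bag x = {} \<longrightarrow> connected_in ?E X \<longrightarrow> 2 * sum w X \<le> ecut es C) \<and>
    \<not> (C \<inter> Bag x = {} \<and> connected_in ?E C)"
  proof (cases "ecut es C = 0")
    \<comment> \<open>All weights are 0, so every bag is balanced, even one that misses
      \<open>C\<close>. A bag that contains a vertex of \<open>C\<close> is taken instead.\<close>
    case True
    obtain v where v: "v \<in> C" using C(2) by fastforce
    then obtain x where x: "x \<in> N" "v \<in> Bag x" using td C(1) unfolding tree_decomposition_def by blast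
    have "sum w X \<le> sum w C" if "X \<subseteq> C" for X using that finC by (intro sum_mono2) auto
    then show ?thesis using x v True wC by (intro bexI[of _ x]) auto
  next
    case False
    obtain x where x: "x \<in> N" "\<forall>X \<subseteq> V. X \<inter> Bag x = {} \<longrightarrow> connected_in ?E X \<longrightarrow> 2 * sum w X \<le> sum w V"
      using balanced_bag[OF td finV] by blast
    \<comment> \<open>Otherwise \<open>C\<close> itself would carry at most half of the total
      weight, which is its own positive weight.\<close>
    have "\<not> (C \<inter> Bag x = {} \<and> connected_in ?E C)"
    proof
      assume "C \<inter> Bag x = {} \<and> connected_in ?E C"
      then have "2 * sum w C \<le> sum w V" using x(2) C(1) by blast
      then show False using wC wV False by simp
    qed
    moreover have "\<forall>X \<subseteq> C. X \<inter> Bag x = {} \<longrightarrow> connected_in ?E X \<longrightarrow> 2 * sum w X \<le> ecut es C"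
      using x(2) C(1) unfolding wV by (meson subset_trans)
    ultimately show ?thesis using x(1) by blast
  qed
  then obtain x where x: "x \<in> N"
    "\<And>X. X \<subseteq> C \<Longrightarrow> X \<inter> Bag x = {} \<Longrightarrow> connected_in ?E X \<Longrightarrow> 2 * sum w X \<le> ecut es C"
    "\<not> (C \<inter> Bag x = {} \<and> connected_in ?E C)" by blast
  define S where "S = C \<inter> Bag x"
  have BV: "Bag x \<subseteq> V" using td x(1) unfolding tree_decomposition_def by blast
  have cS: "card S \<le> ?tw + 1"
    using width[OF x(1)] card_mono[OF finite_subset[OF BV finV], of S] by (simp add: S_def)
  have K2: "2 * ((?tw + 1) * \<Delta>) \<le> K" "?tw + 1 \<le> K" "\<Delta> \<le> K" unfolding K by simp_all
  have "2 \<le> length ps \<and> (\<forall>p \<in> set ps. ecut es (set p) \<le> K)" if ps: "part es S C ps" for ps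
  proof
    show "\<forall>p \<in> set ps. ecut es (set p) \<le> K"
    proof
      fix p assume p: "p \<in> set ps"
      have pC: "set p \<subseteq> C" using part_piece[OF ps p] by blast
      consider b where "b \<in> S" "p = [b]" | "set p \<inter> S = {}"
          "\<forall>a \<in> set p. \<forall>b \<in> C - S. adj es a b \<longrightarrow> b \<in> set p" "connected_in ?E (set p)"
        using ps p unfolding part_def by blast
      then show "ecut es (set p) \<le> K"
      proof cases
        case (1 b)
        then show ?thesis using ecut_singleton[of b] C(1) K2(3) by (auto simp: S_def)
      next
        case 2
        have "set p \<inter> Bag x = {}" using 2(1) pC by (auto simp: S_def)
        from x(2)[OF pC this 2(3)] have "2 * (\<Sum>v \<in> set p. card (bcut C v)) \<le> K"
          using cut wX[OF pC] by simp
        moreover have "ecut es (set p) \<le> (\<Sum>v \<in> set p. card (bcut C v)) + card S * \<Delta>"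
          using 2 by (intro ecut_piece[OF pC C(1)]) (auto simp: S_def)
        moreover have "card S * \<Delta> \<le> (?tw + 1) * \<Delta>" using cS by (rule mult_le_mono1)
        ultimately show ?thesis using K2(1) by linarith
      qed
    qed
    show "2 \<le> length ps"
    proof (rule ccontr)
      assume "\<not> 2 \<le> length ps"
      moreover have "ps \<noteq> []" using ps C(2) by (auto simp: part_def)
      ultimately obtain p where p: "ps = [p]" by (cases ps; cases "tl ps") auto
      have pC: "set p = C" using ps by (simp add: part_def p)
      consider b where "b \<in> S" "p = [b]" | "set p \<inter> S = {}" "connected_in ?E (set p)"
        using ps unfolding part_def p by auto
      then show False
      proof cases
        case (1 b)
        then show False using pC C(2) by auto
      next
        case 2
        then show False using x(3) pC by (auto simp: S_def)
      qed
    qed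
  qed
  then have "ok_split es K C S" unfolding ok_split_def by blast
  moreover have "S \<subseteq> C" "card S \<le> K" using cS K2(2) by (auto simp: S_def)
  ultimately show ?thesis by blast
qed

section \<open>Balls around the boundary\<close>

definition bd :: "nat set \<Rightarrow> nat set" where
  "bd C = {v. \<exists>(a, b) \<in> set es. (a \<in> C) \<noteq> (b \<in> C) \<and> (v = a \<or> v = b)}"

abbreviation ball :: "nat \<Rightarrow> nat set \<Rightarrow> nat set" where
  "ball n R \<equiv> (nbs es V ^^ n) R"

definition touch :: "nat set \<Rightarrow> nat \<Rightarrow> bool" where
  "touch R i \<longleftrightarrow> fst (es ! i) \<in> R \<or> snd (es ! i) \<in> R"

lemma bd_V: "bd C \<subseteq> V"
  using edge_V unfolding bd_def by blast

lemma ball_Suc2: "ball (Suc n) R = ball n (nbs es V R)"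
  by (simp add: funpow_swap1)

lemma card_nbs:
  assumes "R \<subseteq> V"
  shows "card (nbs es V R) \<le> card R * (\<Delta> + 1)"
proof -
  have finR: "finite R" using assms finV finite_subset by blast
  define nb where "nb r = insert r ((\<lambda>(a, b). if a = r then b else a) ` inc r)" for r
  have "nbs es V R \<subseteq> (\<Union>r \<in> R. nb r)"
  proof
    fix v assume "v \<in> nbs es V R"
    then consider "v \<in> R" | r where "r \<in> R" "adj es v r" by (auto simp: nbs_iff)
    then show "v \<in> (\<Union>r \<in> R. nb r)"
    proof cases
      case (2 r)
      then consider "(v, r) \<in> inc r" | "(r, v) \<in> inc r" by (auto simp: adj_def inc_def)
      then have "v \<in> nb r" unfolding nb_def by cases (force simp: image_iff)+
      then show ?thesis using 2 by blast
    qed (auto simp: nb_def)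
  qed
  then have "card (nbs es V R) \<le> card (\<Union>r \<in> R. nb r)"
    using finR by (intro card_mono) (auto simp: nb_def)
  also have "\<dots> \<le> (\<Sum>r \<in> R. card (nb r))" using finR by (rule card_UN_le)
  also have "\<dots> \<le> card R * (\<Delta> + 1)"
  proof -
    have "card (nb r) \<le> \<Delta> + 1" if "r \<in> R" for r
    proof -
      have "card (nb r) \<le> Suc (card ((\<lambda>(a, b). if a = r then b else a) ` inc r))"
        unfolding nb_def by (rule card_insert_le_m1) auto
      also have "\<dots> \<le> Suc (card (inc r))" by (simp add: card_image_le)
      finally show ?thesis using card_inc[of r] that assms by auto
    qed
    then show ?thesis using sum_bounded_above[of R "\<lambda>r. card (nb r)" "\<Delta> + 1"] by simp
  qed
  finally show ?thesis .
qed

lemma card_ball: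
  assumes "R \<subseteq> V"
  shows "card (ball n R) \<le> card R * (\<Delta> + 1) ^ n"
proof (induction n)
  case (Suc n)
  have "card (ball (Suc n) R) \<le> card (ball n R) * (\<Delta> + 1)"
    using card_nbs[OF nbs_funpow_subset[OF assms]] by simp
  also have "\<dots> \<le> card R * (\<Delta> + 1) ^ n * (\<Delta> + 1)" using Suc by (rule mult_le_mono1)
  finally show ?case by (simp add: mult_ac)
qed simp

lemma card_touch:
  assumes "R \<subseteq> V"
  shows "card {i. i < length es \<and> touch (ball n R) i} \<le> card R * (\<Delta> + 1) ^ Suc n"
proof -
  have RV: "ball n R \<subseteq> V" using nbs_funpow_subset[OF assms] .
  have finR: "finite (ball n R)" using finV RV finite_subset by blast
  let ?I = "{i. i < length es \<and> touch (ball n R) i}"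
  have "card ?I = card ((!) es ` ?I)"
    using distinct_es by (intro card_image[symmetric] inj_onI) (auto simp: nth_eq_iff_index_eq)
  also have "\<dots> \<le> card (\<Union>v \<in> ball n R. inc v)"
  proof (rule card_mono)
    show "(!) es ` ?I \<subseteq> (\<Union>v \<in> ball n R. inc v)"
    proof
      fix e assume "e \<in> (!) es ` ?I"
      then obtain i where i: "i < length es" "touch (ball n R) i" "e = es ! i" by auto
      then show "e \<in> (\<Union>v \<in> ball n R. inc v)"
        by (cases "es ! i") (auto simp: touch_def inc_def dest: nth_mem)
    qed
  qed (use finR in auto)
  also have "\<dots> \<le> (\<Sum>v \<in> ball n R. card (inc v))" using finR by (rule card_UN_le)
  also have "\<dots> \<le> card (ball n R) * \<Delta>"
  proof -
    have "card (inc v) \<le> \<Delta>" if "v \<in> ball n R" for v using card_inc that RV by blast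
    from sum_bounded_above[of "ball n R", OF this] show ?thesis by simp
  qed
  also have "\<dots> \<le> card R * (\<Delta> + 1) ^ n * (\<Delta> + 1)"
    using card_ball[OF assms, of n] by (intro mult_le_mono) auto
  finally show ?thesis by (simp add: mult_ac)
qed

text \<open>A walk from outside to a vertex of \<open>C\<close> enters through a boundary edge,
  whose end point in \<open>C\<close> lies in \<open>bd C\<close>; what remains of the walk is not
  longer.\<close>

lemma bd_ball: "x \<in> ball n (V - C) \<Longrightarrow> x \<in> C \<Longrightarrow> x \<in> ball n (bd C)"
proof (induction n arbitrary: x)
  case (Suc n)
  have xV: "x \<in> V" using Suc.prems(1) by (simp add: nbs_iff)
  consider "x \<in> ball n (V - C)" | z where "z \<in> ball n (V - C)" "adj es x z" "z \<in> C"
    | z where "adj es x z" "z \<notin> C"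
    using Suc.prems(1) by (auto simp: nbs_iff)
  then show ?case
  proof cases
    case 1
    then show ?thesis using Suc xV by (auto simp: nbs_iff)
  next
    case (2 z)
    then show ?thesis using Suc.IH[of z] xV by (auto simp: nbs_iff)
  next
    case (3 z)
    then have "x \<in> bd C" using Suc.prems(2) by (auto simp: bd_def adj_def)
    then show ?thesis using nbs_funpow_increasing[OF bd_V, of 0 "Suc n" es C] by auto
  qed
qed simp

text \<open>This symmetry is the reason to collect the end points on both sides of a boundary
  edge.\<close>

lemma bd_compl: "bd (V - C) = bd C"
  using edge_V unfolding bd_def by blast

text \<open>If the edge crosses the boundary, its end points lie in \<open>bd C\<close>. Otherwise
  both end points are on the same side, and \<open>bd_ball\<close> applies to the one that is close
  to the opposite side.\<close>

lemma touch_both: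
  assumes "C \<subseteq> V" "i < length es" "touch (ball n C) i" "touch (ball n (V - C)) i"
  shows "touch (ball n (bd C)) i"
proof -
  obtain a b where ab: "es ! i = (a, b)" by force
  have e: "(a, b) \<in> set es" using assms(2) ab nth_mem by metis
  have inV: "a \<in> V" "b \<in> V" using edge_V[OF e] by auto
  have VC: "V - (V - C) = C" using assms(1) by blast
  have in2: "z \<in> ball n (bd C)" if "z \<in> ball n C" "z \<in> V - C" for z
    using bd_ball[of z n "V - C"] that unfolding VC bd_compl by blast
  have in1: "z \<in> ball n (bd C)" if "z \<in> ball n (V - C)" "z \<in> C" for z
    using bd_ball that by blast
  show ?thesis
  proof (cases "(a \<in> C) = (b \<in> C)")
    case True
    then show ?thesis using assms(3,4) in1 in2 inV unfolding touch_def ab by auto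
  next
    case False
    then have "a \<in> bd C" using e by (auto simp: bd_def)
    then have "a \<in> ball n (bd C)" using nbs_funpow_increasing[OF bd_V, of 0 n es C] by auto
    then show ?thesis by (simp add: touch_def ab)
  qed
qed

lemma card_bd: "card (bd C) \<le> 2 * ecut es C"
proof -
  let ?D = "{(a, b) \<in> set es. (a \<in> C) \<noteq> (b \<in> C)}"
  have fin: "finite ?D" by (rule finite_subset[of _ "set es"]) auto
  have "bd C \<subseteq> fst ` ?D \<union> snd ` ?D" by (force simp: bd_def)
  then have "card (bd C) \<le> card (fst ` ?D \<union> snd ` ?D)" using fin by (intro card_mono) auto
  also have "\<dots> \<le> card (fst ` ?D) + card (snd ` ?D)" by (rule card_Un_le)
  also have "\<dots> \<le> card ?D + card ?D" using fin by (intro add_mono card_image_le)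
  finally show ?thesis by (simp add: ecut_card)
qed

text \<open>One set covers the boundaries of all pieces. Their tables and all intermediate joins
  thus share a key set of bounded size, however many pieces there are.\<close>

lemma bd_piece:
  assumes "part es S C ps" "p \<in> set ps" "S \<subseteq> C" "C \<subseteq> V"
  shows "bd (set p) \<subseteq> bd C \<union> nbs es V S"
proof
  fix v assume "v \<in> bd (set p)"
  then obtain a b where ab: "(a, b) \<in> set es" "(a \<in> set p) \<noteq> (b \<in> set p)" "v = a \<or> v = b"
    by (auto simp: bd_def)
  have pC: "set p \<subseteq> C" using part_piece[OF assms(1,2)] by blast
  have adj: "adj es a b" "adj es b a" using ab by (auto simp: adj_def)
  have inV: "a \<in> V" "b \<in> V" using edge_V[OF ab(1)] by auto
  show "v \<in> bd C \<union> nbs es V S"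
  proof (cases "a \<in> S \<or> b \<in> S")
    case True
    then show ?thesis using ab(3) adj inV by (auto simp: nbs_iff)
  next
    case False
    have "\<forall>a \<in> set p. \<forall>b \<in> C - S. adj es a b \<longrightarrow> b \<in> set p"
    proof (cases "\<exists>c \<in> S. p = [c]")
      case True
      then show ?thesis using False ab(2) by auto
    next
      case f: False
      then show ?thesis using assms(1,2) unfolding part_def by blast
    qed
    then have "(a \<in> C) \<noteq> (b \<in> C)" using ab(2) adj False pC by blast
    then show ?thesis using ab(1,3) by (auto simp: bd_def)
  qed
qed

end

section \<open>Partial solutions\<close>

lemma nth_bump: "length u = length es \<Longrightarrow> i < length es \<Longrightarrow>
    bump a b d es u ! i = (if es ! i = (a, b) then u ! i + d else u ! i)"
  by (simp add: bump_def)

lemma wset_length: "v \<in> wset es t d n c u \<Longrightarrow> length u = length es \<Longrightarrow> length v = length es"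
  by (induction n arbitrary: c u) (auto split: if_splits)

context edge_list begin

lemma edge_iff:
  assumes "e \<in> set es" "(a, b) \<in> set es"
  shows "e = (a, b) \<longleftrightarrow> {fst e, snd e} = {a, b}"
proof
  show "{fst e, snd e} = {a, b} \<Longrightarrow> e = (a, b)"
    using edge_unique[OF assms] by simp
qed simp

lemma wset_touch:
  "v \<in> wset es t d n c u \<Longrightarrow> length u = length es \<Longrightarrow> i < length es \<Longrightarrow> c \<in> V \<Longrightarrow> u ! i \<noteq> v ! i \<Longrightarrow>
    touch (ball n {c}) i"
proof (induction n arbitrary: c u)
  case 0
  then show ?case by (auto split: if_splits)
next
  case (Suc n)
  obtain a b where ab: "(a, b) \<in> set es"
    "(a = c \<and> v \<in> wset es t d n b (bump a b d es u)) \<or> (a \<noteq> c \<and> b = c \<and> v \<in> wset es t d n a (bump a b d es u))"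
    using Suc.prems by (auto split: if_splits)
  let ?u = "bump a b d es u"
  have len: "length ?u = length es" using Suc.prems(2) by simp
  show ?case
  proof (cases "es ! i = (a, b)")
    case True
    have "c \<in> ball (Suc n) {c}" using nbs_funpow_increasing[of "{c}" V 0 "Suc n" es] Suc.prems(4) by auto
    then show ?thesis using True ab(2) by (auto simp: touch_def simp del: funpow.simps)
  next
    case False
    then have ne: "?u ! i \<noteq> v ! i" using Suc.prems by (simp add: nth_bump)
    obtain z where z: "z \<in> V" "adj es z c" "v \<in> wset es t d n z ?u"
      using ab edge_V[OF ab(1)] by (auto simp: adj_def)
    have "touch (ball n {z}) i" by (rule Suc.IH[OF z(3) len Suc.prems(3) z(1) ne])
    moreover have "ball n {z} \<subseteq> ball (Suc n) {c}"
      unfolding ball_Suc2 using z by (intro nbs_funpow_mono) (auto simp: nbs_iff)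
    ultimately show ?thesis unfolding touch_def by blast
  qed
qed

lemma path_wset:
  "is_path V (eset es) c t p \<Longrightarrow> path_length p \<le> n \<Longrightarrow> length u = length es \<Longrightarrow>
    \<exists>v \<in> wset es t d n c u. \<forall>i < length es.
      v ! i = u ! i + (if {fst (es ! i), snd (es ! i)} \<in> path_edges p then d else 0)"
proof (induction p arbitrary: n c u)
  case (Cons x p)
  show ?case
  proof (cases p)
    case Nil
    then show ?thesis using Cons.prems by (cases n) auto
  next
    case p: (Cons y q)
    obtain n' where n: "n = Suc n'" using Cons.prems(2) p by (cases n) (auto simp: path_length_def)
    have x: "x = c" "{c, y} \<in> eset es" "c \<notin> set p" and py: "is_path V (eset es) y t p"
      using Cons.prems(1) p by auto
    have lp: "path_length p \<le> n'" using Cons.prems(2) n p by (simp add: path_length_def)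
    obtain a b where ab: "(a, b) \<in> set es" "(a = c \<and> b = y) \<or> (a = y \<and> b = c)" "{a, b} = {c, y}"
      using x(2) by (auto simp: eset_def doubleton_eq_iff)
    have cy: "c \<noteq> y" using x(3) p by auto
    let ?u = "bump a b d es u"
    have "length ?u = length es" using Cons.prems(3) by simp
    from Cons.IH[OF py lp this] obtain v where v: "v \<in> wset es t d n' y ?u"
      "\<And>i. i < length es \<Longrightarrow> v ! i = ?u ! i + (if {fst (es ! i), snd (es ! i)} \<in> path_edges p then d else 0)"
      by blast
    have "v \<in> wset es t d n c u" using v(1) ab(1,2) cy unfolding n by auto
    moreover have "v ! i = u ! i + (if {fst (es ! i), snd (es ! i)} \<in> path_edges (x # p) then d else 0)"
      if i: "i < length es" for i
    proof -
      have iff: "es ! i = (a, b) \<longleftrightarrow> {fst (es ! i), snd (es ! i)} = {c, y}"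
        using edge_iff[OF nth_mem[OF i] ab(1)] ab(3) by simp
      have "path_edges p \<subseteq> Pow (set p)" unfolding path_edges_def by auto
      then have "{c, y} \<notin> path_edges p" using x(3) by auto
      moreover have "path_edges (x # p) = insert {c, y} (path_edges p)" using p x(1) by simp
      ultimately show ?thesis using v(2)[OF i] iff i Cons.prems(3) by (auto simp: nth_bump)
    qed
    ultimately show ?thesis by blast
  qed
qed simp

text \<open>Unlike in \<open>path_wset\<close>, where each edge of the path counts once, there is
  only an inequality: a walk may repeat edges, and the path may skip some of them. Capacities are
  upper bounds, so this is enough.\<close>

lemma wset_path:
  "v \<in> wset es t d n c u \<Longrightarrow> length u = length es \<Longrightarrow> c \<in> V \<Longrightarrow>
    \<exists>p. is_path V (eset es) c t p \<and> path_length p \<le> n \<and> (\<forall>i < length es.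
      u ! i + (if {fst (es ! i), snd (es ! i)} \<in> path_edges p then d else 0) \<le> v ! i)"
proof (induction n arbitrary: c u)
  case 0
  then show ?case by (intro exI[of _ "[c]"]) (auto simp: path_length_def split: if_splits)
next
  case (Suc n)
  show ?case
  proof (cases "c = t \<and> v = u")
    case True
    then show ?thesis using Suc.prems by (intro exI[of _ "[c]"]) (auto simp: path_length_def)
  next
    case False
    obtain a b where ab: "(a, b) \<in> set es"
      "(a = c \<and> v \<in> wset es t d n b (bump a b d es u)) \<or> (a \<noteq> c \<and> b = c \<and> v \<in> wset es t d n a (bump a b d es u))"
      using Suc.prems(1) False by (auto split: if_splits)
    let ?u = "bump a b d es u"
    have len: "length ?u = length es" using Suc.prems(2) by simp
    obtain z where z: "z \<in> V" "{c, z} = {a, b}" "v \<in> wset es t d n z ?u"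
      using ab edge_V[OF ab(1)] by auto
    have cz: "{c, z} \<in> eset es" using z(2) ab(1) by (force simp: eset_def)
    from Suc.IH[OF z(3) len z(1)] obtain p where p: "is_path V (eset es) z t p" "path_length p \<le> n"
      "\<And>i. i < length es \<Longrightarrow> ?u ! i + (if {fst (es ! i), snd (es ! i)} \<in> path_edges p then d else 0) \<le> v ! i"
      by blast
    obtain q where q: "is_path V (eset es) c t q" "length q \<le> Suc (length p)"
      "path_edges q \<subseteq> insert {c, z} (path_edges p)"
      using is_path_extend[OF p(1) cz Suc.prems(3)] by blast
    have "p \<noteq> []" using p(1) by auto
    then have "path_length q \<le> Suc n" using q(2) p(2) by (cases p) (auto simp: path_length_def)
    moreover have "u ! i + (if {fst (es ! i), snd (es ! i)} \<in> path_edges q then d else 0) \<le> v ! i"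
      if i: "i < length es" for i
    proof -
      have "es ! i = (a, b) \<longleftrightarrow> {fst (es ! i), snd (es ! i)} = {c, z}"
        using edge_iff[OF nth_mem[OF i] ab(1)] z(2) by simp
      then show ?thesis using p(3)[OF i] q(3) i Suc.prems(2)
        by (cases "es ! i = (a, b)") (auto simp: nth_bump split: if_splits)
    qed
    ultimately show ?thesis using q(1) by blast
  qed
qed

end

section \<open>Choices of routes and the tables that represent them\<close>

locale flow = edge_list V es for V es +
  fixes cs :: "nat list" and TS :: "task set" and L :: nat
  assumes len_cs: "length cs = length es" and finTS: "finite TS"
    and TS_V: "\<And>s t d w. (s, t, d, w) \<in> TS \<Longrightarrow> s \<in> V \<and> t \<in> V"
begin

abbreviation m where "m \<equiv> length es"
abbreviation zero :: "nat list" where "zero \<equiv> replicate m 0"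

text \<open>
  A task is either dropped or routed along a walk; \<open>ch\<close> below chooses one option for every task.
\<close>

definition opt :: "task \<Rightarrow> (nat list \<times> nat) set" where
  "opt T = (case T of (s, t, d, w) \<Rightarrow> insert (zero, 0) ((\<lambda>u. (u, w)) ` wset es t d L s zero))"

definition usage :: "task set \<Rightarrow> (task \<Rightarrow> nat list \<times> nat) \<Rightarrow> nat \<Rightarrow> nat" where
  "usage X ch i = (\<Sum>T \<in> X. fst (ch T) ! i)"

definition profit :: "task set \<Rightarrow> (task \<Rightarrow> nat list \<times> nat) \<Rightarrow> nat" where
  "profit X ch = (\<Sum>T \<in> X. snd (ch T))"

definition psol :: "task set \<Rightarrow> (task \<Rightarrow> nat list \<times> nat) \<Rightarrow> bool" where
  "psol X ch \<longleftrightarrow> (\<forall>T \<in> X. ch T \<in> opt T) \<and> (\<forall>i < m. usage X ch i \<le> cs ! i)"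

text \<open>
  The edges that tasks outside \<open>X\<close> may use. On other edges the tasks in \<open>X\<close> are alone, and their
  usage was compared with the capacity when they were put together. So a usage vector may
  underestimate it there, and \<open>Mask\<close> sets it to 0.
\<close>

definition live :: "task set \<Rightarrow> nat \<Rightarrow> bool" where
  "live X i \<longleftrightarrow> (\<exists>T \<in> TS - X. \<exists>c \<in> opt T. fst c ! i \<noteq> 0)"

definition rep :: "task set \<Rightarrow> (task \<Rightarrow> nat list \<times> nat) \<Rightarrow> nat list \<Rightarrow> bool" where
  "rep X ch u \<longleftrightarrow> length u = m \<and>
    (\<forall>i < m. u ! i \<le> usage X ch i \<and> (live X i \<longrightarrow> u ! i = usage X ch i))"

text \<open>In the second part \<open>u\<close> belongs to \<open>ch\<close>, while the profit may
  come from a different choice. Both choices have the same usage on live edges, so the better one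
  can replace \<open>ch\<close> in any larger solution.\<close>

definition represents :: "task set \<Rightarrow> tab \<Rightarrow> bool" where
  "represents X T \<longleftrightarrow>
    (\<forall>(u, p) \<in> set T. \<exists>ch. psol X ch \<and> p = profit X ch \<and> rep X ch u) \<and>
    (\<forall>ch. psol X ch \<longrightarrow> (\<exists>(u, p) \<in> set T. profit X ch \<le> p \<and> rep X ch u))"

lemma representsD1:
  "represents X T \<Longrightarrow> (u, p) \<in> set T \<Longrightarrow> \<exists>ch. psol X ch \<and> p = profit X ch \<and> rep X ch u"
  unfolding represents_def by auto

lemma representsD2:
  assumes "represents X T" "psol X ch"
  obtains u p where "(u, p) \<in> set T" "profit X ch \<le> p" "rep X ch u"
proof -
  have "\<exists>x \<in> set T. case x of (u, p) \<Rightarrow> profit X ch \<le> p \<and> rep X ch u"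
    using assms unfolding represents_def by simp
  then show ?thesis using that by auto
qed

lemma vle_iff: "length u = m \<Longrightarrow> vle u cs \<longleftrightarrow> (\<forall>i < m. u ! i \<le> cs ! i)"
  by (simp add: list_all2_conv_all_nth len_cs)

lemma opt_length: "c \<in> opt T \<Longrightarrow> length (fst c) = m"
  using wset_length by (auto simp: opt_def split: prod.splits)

lemma represents_empty: "represents {} [(zero, 0)]"
  by (auto simp: represents_def psol_def profit_def rep_def usage_def)

lemma usage_cong: "(\<And>T. T \<in> X \<Longrightarrow> ch T = ch' T) \<Longrightarrow> usage X ch i = usage X ch' i"
  unfolding usage_def by (rule sum.cong) auto

lemma profit_cong: "(\<And>T. T \<in> X \<Longrightarrow> ch T = ch' T) \<Longrightarrow> profit X ch = profit X ch'"
  unfolding profit_def by (rule sum.cong) auto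

text \<open>The initial entry \<open>(zero, 0)\<close> is the option to drop the task.\<close>

lemma represents_task:
  assumes "tabrel [(zero, 0)] (walkset cs w (wset es t d L s zero)) R"
  shows "represents {(s, t, d, w)} R"
proof -
  let ?T = "(s, t, d, w)"
  have sub: "set R \<subseteq> insert (zero, 0) (walkset cs w (wset es t d L s zero))"
    and sup: "\<And>u p. (u, p) \<in> insert (zero, 0) (walkset cs w (wset es t d L s zero)) \<Longrightarrow> \<exists>p' \<ge> p. (u, p') \<in> set R"
    using assms unfolding tabrel_def by auto
  have *: "usage {?T} ch i = fst (ch ?T) ! i" "profit {?T} ch = snd (ch ?T)" for ch i
    by (auto simp: usage_def profit_def)
  have "\<exists>ch. psol {?T} ch \<and> p = profit {?T} ch \<and> rep {?T} ch u" if "(u, p) \<in> set R" for u p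
  proof -
    have "(u, p) = (zero, 0) \<or> (u, p) \<in> walkset cs w (wset es t d L s zero)" using that sub by auto
    then have o: "(u, p) \<in> opt ?T" "vle u cs"
      by (auto simp: opt_def walkset_def vle_iff)
    have "length u = m" using opt_length[OF o(1)] by simp
    then show ?thesis using o vle_iff[of u]
      by (intro exI[of _ "\<lambda>_. (u, p)"]) (simp add: psol_def * rep_def)
  qed
  moreover have "\<exists>(u, p) \<in> set R. profit {?T} ch \<le> p \<and> rep {?T} ch u" if "psol {?T} ch" for ch
  proof -
    obtain u p where up: "ch ?T = (u, p)" by force
    have o: "(u, p) \<in> opt ?T" "\<forall>i < m. u ! i \<le> cs ! i" using that up by (auto simp: psol_def *)
    have lu: "length u = m" using opt_length[OF o(1)] by simp
    then have "vle u cs" using o(2) vle_iff by blast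
    then have "(u, p) \<in> insert (zero, 0) (walkset cs w (wset es t d L s zero))"
      using o(1) by (auto simp: opt_def walkset_def)
    from sup[OF this] obtain p' where "p' \<ge> p" "(u, p') \<in> set R" by blast
    then show ?thesis using up lu by (intro bexI[of _ "(u, p')"]) (auto simp: * rep_def)
  qed
  ultimately show ?thesis unfolding represents_def by auto
qed

lemma dead_usage: "\<not> live X i \<Longrightarrow> Y \<subseteq> TS - X \<Longrightarrow> \<forall>T \<in> Y. ch T \<in> opt T \<Longrightarrow> usage Y ch i = 0"
  unfolding usage_def live_def by (intro sum.neutral) blast

lemma live_antimono: "live (X \<union> Y) i \<Longrightarrow> live X i"
  unfolding live_def by blast

lemma represents_join:
  assumes X: "X \<subseteq> TS" and Y: "Y \<subseteq> TS" and XY: "X \<inter> Y = {}"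
    and T1: "represents X T1" and T2: "represents Y T2"
  shows "represents (X \<union> Y) (join cs T2 T1 [])"
proof -
  have fin: "finite X" "finite Y" using X Y finTS finite_subset by blast+
  have usU: "usage (X \<union> Y) ch i = usage X ch i + usage Y ch i" for ch i
    unfolding usage_def by (rule sum.union_disjoint[OF fin XY])
  have prU: "profit (X \<union> Y) ch = profit X ch + profit Y ch" for ch
    unfolding profit_def by (rule sum.union_disjoint[OF fin XY])
  have rel: "tabrel [] (joinset cs T2 T1) (join cs T2 T1 [])" by (rule tabrel_join)
  have repU: "rep (X \<union> Y) ch (vadd u v)" if "rep X ch u" "rep Y ch v" for ch u v
    using that live_antimono[of X Y] live_antimono[of Y X]
    unfolding rep_def usU by (auto simp: Un_commute intro: add_mono)
  \<comment> \<open>On an edge that is not live for one of the sets, the other set has usage 0. Then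
    both sides hold by the capacity checks that the two partial solutions have already
    passed.\<close>
  have feas: "(\<forall>i < m. usage (X \<union> Y) ch i \<le> cs ! i) \<longleftrightarrow> vle (vadd u v) cs"
    if r: "rep X ch u" "rep Y ch v" and p: "psol X ch" "psol Y ch" for ch u v
  proof -
    have lens: "length u = m" "length v = m" "length (vadd u v) = m" using r by (auto simp: rep_def)
    have "usage (X \<union> Y) ch i \<le> cs ! i \<longleftrightarrow> u ! i + v ! i \<le> cs ! i" if i: "i < m" for i
    proof -
      have le: "u ! i \<le> usage X ch i" "v ! i \<le> usage Y ch i" using r i by (auto simp: rep_def)
      have cap: "usage X ch i \<le> cs ! i" "usage Y ch i \<le> cs ! i" using p i by (auto simp: psol_def)
      show ?thesis
      proof (cases "live X i \<and> live Y i")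
        case True
        then have "u ! i = usage X ch i" "v ! i = usage Y ch i" using r i by (auto simp: rep_def)
        then show ?thesis by (simp add: usU)
      next
        case False
        moreover have "Y \<subseteq> TS - X" "X \<subseteq> TS - Y" using X Y XY by auto
        moreover have "\<forall>T \<in> X. ch T \<in> opt T" "\<forall>T \<in> Y. ch T \<in> opt T"
          using p by (auto simp: psol_def)
        ultimately have "usage X ch i = 0 \<or> usage Y ch i = 0" using dead_usage by metis
        then show ?thesis using le cap by (auto simp: usU)
      qed
    qed
    then show ?thesis using lens by (simp add: vle_iff)
  qed
  have "\<exists>ch. psol (X \<union> Y) ch \<and> p = profit (X \<union> Y) ch \<and> rep (X \<union> Y) ch u"
    if "(u, p) \<in> set (join cs T2 T1 [])" for u p
  proof -
    have "(u, p) \<in> joinset cs T2 T1" using rel that by (auto simp: tabrel_def)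
    then obtain u1 p1 u2 p2 where eq: "u = vadd u1 u2" "p = p1 + p2" "vle (vadd u1 u2) cs"
      and in1: "(u1, p1) \<in> set T1" and in2: "(u2, p2) \<in> set T2" unfolding joinset_def by blast
    obtain c1 where c1: "psol X c1" "p1 = profit X c1" "rep X c1 u1"
      using representsD1[OF T1 in1] by blast
    obtain c2 where c2: "psol Y c2" "p2 = profit Y c2" "rep Y c2 u2"
      using representsD1[OF T2 in2] by blast
    define ch where "ch T = (if T \<in> X then c1 T else c2 T)" for T
    have e1: "\<And>T. T \<in> X \<Longrightarrow> ch T = c1 T" and e2: "\<And>T. T \<in> Y \<Longrightarrow> ch T = c2 T"
      using XY by (auto simp: ch_def)
    have d: "psol X ch" "p1 = profit X ch" "rep X ch u1" "psol Y ch" "p2 = profit Y ch" "rep Y ch u2"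
      using c1 c2 usage_cong[OF e1] usage_cong[OF e2] profit_cong[OF e1] profit_cong[OF e2] e1 e2
      by (auto simp: psol_def rep_def)
    have "psol (X \<union> Y) ch"
      using d feas[OF d(3,6,1,4)] eq(3) unfolding psol_def by blast
    then show ?thesis using repU[OF d(3,6)] d eq by (auto simp: prU)
  qed
  moreover have "\<exists>(u, p) \<in> set (join cs T2 T1 []). profit (X \<union> Y) ch \<le> p \<and> rep (X \<union> Y) ch u"
    if p: "psol (X \<union> Y) ch" for ch
  proof -
    have p1: "psol X ch" and p2: "psol Y ch"
      using p unfolding psol_def usU by (auto intro: add_leD1 add_leD2)
    obtain u1 q1 where 1: "(u1, q1) \<in> set T1" "profit X ch \<le> q1" "rep X ch u1"
      by (rule representsD2[OF T1 p1])
    obtain u2 q2 where 2: "(u2, q2) \<in> set T2" "profit Y ch \<le> q2" "rep Y ch u2"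
      by (rule representsD2[OF T2 p2])
    have "vle (vadd u1 u2) cs" using feas[OF 1(3) 2(3) p1 p2] p unfolding psol_def by blast
    then have "(vadd u1 u2, q1 + q2) \<in> joinset cs T2 T1" using 1(1) 2(1) unfolding joinset_def by blast
    then obtain q where "q \<ge> q1 + q2" "(vadd u1 u2, q) \<in> set (join cs T2 T1 [])"
      using rel unfolding tabrel_def by fastforce
    then show ?thesis using 1(2) 2(2) repU[OF 1(3) 2(3)]
      by (intro bexI[of _ "(vadd u1 u2, q)"]) (auto simp: prU)
  qed
  ultimately show ?thesis unfolding represents_def by auto
qed

lemma rep_vmask:
  assumes "length mv = m" "\<And>i. i < m \<Longrightarrow> live X i \<Longrightarrow> mv ! i \<noteq> 0" "rep X ch u"
  shows "rep X ch (vmask mv u)"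
  unfolding rep_def
proof (intro conjI allI impI)
  have u: "length u = m" "\<And>i. i < m \<Longrightarrow> u ! i \<le> usage X ch i"
    "\<And>i. i < m \<Longrightarrow> live X i \<Longrightarrow> u ! i = usage X ch i" using assms(3) by (auto simp: rep_def)
  show "length (vmask mv u) = m" using u(1) assms(1) by simp
  fix i assume i: "i < m"
  show "vmask mv u ! i \<le> usage X ch i" using u(1,2) assms(1) i by simp
  show "vmask mv u ! i = usage X ch i" if "live X i"
    using u(1) u(3)[OF i that] assms(1) assms(2)[OF i that] i by simp
qed

lemma represents_mask:
  assumes mv: "length mv = m" "\<And>i. i < m \<Longrightarrow> live X i \<Longrightarrow> mv ! i \<noteq> 0" and T: "represents X T"
  shows "represents X (mask mv T [])"
proof -
  have rel: "tabrel [] ((\<lambda>(u, p). (vmask mv u, p)) ` set T) (mask mv T [])" by (rule tabrel_mask)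
  have "\<exists>ch. psol X ch \<and> p = profit X ch \<and> rep X ch u" if "(u, p) \<in> set (mask mv T [])" for u p
  proof -
    have "(u, p) \<in> (\<lambda>(u, p). (vmask mv u, p)) ` set T" using rel that unfolding tabrel_def by auto
    then obtain v where v: "(v, p) \<in> set T" "u = vmask mv v" by auto
    then show ?thesis using representsD1[OF T v(1)] rep_vmask[OF mv] by blast
  qed
  moreover have "\<exists>(u, p) \<in> set (mask mv T []). profit X ch \<le> p \<and> rep X ch u" if ps: "psol X ch" for ch
  proof -
    obtain u q where 1: "(u, q) \<in> set T" "profit X ch \<le> q" "rep X ch u"
      by (rule representsD2[OF T ps])
    then have "(vmask mv u, q) \<in> (\<lambda>(u, p). (vmask mv u, p)) ` set T" by force
    then obtain q' where "q' \<ge> q" "(vmask mv u, q') \<in> set (mask mv T [])"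
      using rel unfolding tabrel_def by fastforce
    then show ?thesis using 1(2) rep_vmask[OF mv 1(3)]
      by (intro bexI[of _ "(vmask mv u, q')"]) auto
  qed
  ultimately show ?thesis unfolding represents_def by auto
qed

definition tasks_from :: "nat set \<Rightarrow> task set" where
  "tasks_from C = {T \<in> TS. fst T \<in> C}"

lemma opt_touch:
  assumes "T \<in> TS" "c \<in> opt T" "i < m" "fst c ! i \<noteq> 0"
  shows "touch (ball L {fst T}) i"
proof -
  obtain s t d w where T: "T = (s, t, d, w)" by (cases T)
  then have "fst c \<in> wset es t d L s zero" using assms(2,3,4) by (auto simp: opt_def)
  from wset_touch[OF this _ assms(3)] show ?thesis using assms TS_V[of s t d w] T by simp
qed

lemma touch_mono: "R \<subseteq> R' \<Longrightarrow> touch R i \<Longrightarrow> touch R' i"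
  by (auto simp: touch_def)

text \<open>Liveness speaks of all walks of the other tasks. The program tests the weaker condition
  on distances instead; masking fewer edges is always sound.\<close>

lemma live_touch:
  assumes "live (tasks_from C) i" "i < m"
  shows "touch (ball L (V - C)) i"
proof -
  obtain T c where T: "T \<in> TS" "T \<notin> tasks_from C" "c \<in> opt T" "fst c ! i \<noteq> 0"
    using assms(1) unfolding live_def by blast
  then have "{fst T} \<subseteq> V - C" using TS_V by (cases T) (auto simp: tasks_from_def)
  then have "ball L {fst T} \<subseteq> ball L (V - C)" by (rule nbs_funpow_mono)
  then show ?thesis using opt_touch[OF T(1,3) assms(2) T(4)] by (rule touch_mono)
qed

text \<open>The candidates for keys. \<open>R\<close> is \<open>C\<close> itself at a leaf,
  \<open>bd C\<close> after masking, and a common superset of the boundaries of the pieces while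
  their tables are joined.\<close>

definition keys :: "nat set \<Rightarrow> nat list set" where
  "keys R = {u. length u = m \<and> vle u cs \<and> (\<forall>i < m. u ! i \<noteq> 0 \<longrightarrow> touch (ball L R) i)}"

lemma keys_mono: "R \<subseteq> R' \<Longrightarrow> keys R \<subseteq> keys R'"
  unfolding keys_def using touch_mono[OF nbs_funpow_mono[where es = es and A = V and n = L, of R R']] by blast

lemma keys_vadd: "u \<in> keys R \<Longrightarrow> v \<in> keys R \<Longrightarrow> vle (vadd u v) cs \<Longrightarrow> vadd u v \<in> keys R"
  by (auto simp: keys_def)

text \<open>A key is determined by its entries on the edges near \<open>R\<close>, each of which is
  one of \<open>M + 1\<close> numbers.\<close>

lemma card_keys:
  assumes R: "R \<subseteq> V" and M: "\<forall>x \<in> set cs. x \<le> M"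
  shows "finite (keys R)" "card (keys R) \<le> (M + 1) ^ (card R * (\<Delta> + 1) ^ Suc L)"
proof -
  define J where "J = {i. i < m \<and> touch (ball L R) i}"
  have finJ: "finite J" by (simp add: J_def)
  have bound: "u ! i \<le> M" if "u \<in> keys R" "i < m" for u i
  proof -
    have "length u = m" "vle u cs" using that(1) by (simp_all add: keys_def)
    then have "u ! i \<le> cs ! i" using that(2) vle_iff by blast
    moreover have "cs ! i \<le> M" using M that(2) len_cs by simp
    ultimately show ?thesis by simp
  qed
  have inj: "inj_on (\<lambda>u. restrict (\<lambda>i. u ! i) J) (keys R)"
  proof (rule inj_onI)
    fix u v assume uv: "u \<in> keys R" "v \<in> keys R" "restrict (\<lambda>i. u ! i) J = restrict (\<lambda>i. v ! i) J"
    have "u ! i = v ! i" if i: "i < m" for i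
    proof (cases "i \<in> J")
      case True
      then show ?thesis using uv(3) by (metis restrict_apply')
    next
      case False
      then show ?thesis using uv(1,2) i unfolding keys_def J_def by (metis (mono_tags, lifting) mem_Collect_eq)
    qed
    then show "u = v" using uv(1,2) by (intro nth_equalityI) (auto simp: keys_def)
  qed
  have sub: "(\<lambda>u. restrict (\<lambda>i. u ! i) J) ` keys R \<subseteq> J \<rightarrow>\<^sub>E {..M}"
    using bound by (intro image_subsetI PiE_I) (auto simp: J_def)
  have fin: "finite (J \<rightarrow>\<^sub>E {..M})" using finJ by (intro finite_PiE) auto
  show "finite (keys R)" using inj sub fin by (rule inj_on_finite)
  have "card (keys R) \<le> card (J \<rightarrow>\<^sub>E {..M})" using inj sub fin by (rule card_inj_on_le)
  also have "\<dots> = (M + 1) ^ card J" using finJ by (simp add: card_PiE)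
  also have "\<dots> \<le> (M + 1) ^ (card R * (\<Delta> + 1) ^ Suc L)"
    unfolding J_def by (intro power_increasing card_touch[OF R]) simp
  finally show "card (keys R) \<le> (M + 1) ^ (card R * (\<Delta> + 1) ^ Suc L)" .
qed

end

section \<open>The solver\<close>

lemma fn_Any [simp]: "fn Any (VNum q ;; tb T) = Some (bl (\<exists>x \<in> set T. q \<le> snd x))"
proof (induction T)
  case (Cons x T)
  obtain u p where x: "x = (u, p)" by force
  from Cons show ?case by (subst fn_unfold) (auto simp: body.simps x)
qed (subst fn_unfold, simp add: body.simps)

context budget begin

lemma ct_Any:
  assumes "sn q" "st m T" "length T < B"
  shows "ct Any (VNum q ;; tb T) \<le> B ^ 3"
proof -
  have "st m T \<Longrightarrow> ct Any (VNum q ;; tb T) \<le> B ^ 2 * (length T + 1)"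
  proof (induction T)
    case Nil
    show ?case using B B_pows ct_unfold[OF fn_Any[of q "[]"]] by (simp add: body.simps)
  next
    case (Cons x T)
    obtain u p where x: "x = (u, p)" by force
    have "ct Any (VNum q ;; tb (x # T)) \<le> 40 + floorlog 2 q + floorlog 2 p + ct Any (VNum q ;; tb T)"
      by (subst ct_unfold[OF fn_Any]) (auto simp: body.simps x)
    moreover have "floorlog 2 p \<le> B" using Cons.prems x by (auto intro: bits_le)
    ultimately show ?case using B B_pows(1) Cons bits_le[OF assms(1)] by (simp add: algebra_simps)
  qed
  then show ?thesis using assms loop_le[of "length T" 2] by simp
qed

end

text \<open>\<open>K * (\<Delta> + 3)\<close> bounds the boundaries of all pieces of a split
  together: up to \<open>2 * K\<close> end points of boundary edges of \<open>C\<close>, and up to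
  \<open>K * (\<Delta> + 1)\<close> vertices in the closed neighbourhood of
  \<open>S\<close>.\<close>

locale solver = flow V es cs TS L + budget B for V es cs TS L B +
  fixes vs :: "nat list" and ts :: "task list" and k :: "nat \<Rightarrow> nat \<Rightarrow> nat" and K W :: nat
  assumes vs: "distinct vs" "set vs = V" "sl vs"
    and ts: "distinct ts" "set ts = TS" "length ts < B"
    and cs: "cs = map (\<lambda>(u, v). k u v) es" "\<forall>x \<in> set cs. x < B"
    and es: "se es" and LB: "L < B" "(2 * length es + 3) ^ (L + 1) \<le> B"
    and KB: "K = 2 * (treewidth V (eset es) + 1) * (max_degree V (eset es) + 1)"
      "K < B" "2 * (length vs + 1) ^ K \<le> B"
    and keys_B: "\<And>R. R \<subseteq> V \<Longrightarrow> card R \<le> K * (max_degree V (eset es) + 3) \<Longrightarrow> card (keys R) < B"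
    and small: "\<And>s t d w. (s, t, d, w) \<in> TS \<Longrightarrow> sn s \<and> sn t \<and> sn d \<and> sn w \<and> L * d < 2 ^ B"
    and W: "W = (\<Sum>(s, t, d, w) \<in> TS. w)" "sn (2 * W)"
begin

lemma lenC: "set C \<subseteq> V \<Longrightarrow> distinct C \<Longrightarrow> length C \<le> length vs"
  using card_mono[OF finV, of "set C"] vs by (metis distinct_card)

lemma slC: "set C \<subseteq> V \<Longrightarrow> distinct C \<Longrightarrow> sl C"
  using sl_subset[OF vs(3), of C] lenC vs(2) by blast

lemma sl_cs: "sl cs"
  using cs(2) es by (auto simp: sl_def cs(1) se_def intro!: less_B_small less_imp_le)

lemma mB: "m < B" using es by (rule se_length)

lemma keyset_keys:
  assumes "R \<subseteq> V" "card R \<le> K * (\<Delta> + 3)"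
  shows "keyset m (keys R)"
proof -
  have "finite (keys R)" using card_keys(1)[OF assms(1), of B] cs(2) less_imp_le by blast
  moreover have "length u = m \<and> (\<forall>x \<in> set u. x < B)" if "u \<in> keys R" for u
  proof -
    have u: "length u = m" "vle u cs" using that by (simp_all add: keys_def)
    have "u ! i < B" if "i < m" for i
    proof -
      have "u ! i \<le> cs ! i" using u vle_iff that by blast
      moreover have "cs ! i < B" using cs(2) that len_cs by simp
      ultimately show ?thesis by simp
    qed
    then show ?thesis using u(1) by (auto simp: in_set_conv_nth)
  qed
  ultimately show ?thesis using keys_B[OF assms] mB unfolding keyset_def by blast
qed

lemma profit_le: "X \<subseteq> TS \<Longrightarrow> psol X ch \<Longrightarrow> profit X ch \<le> W"
proof -
  assume X: "X \<subseteq> TS" "psol X ch"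
  have "profit X ch \<le> (\<Sum>(s, t, d, w) \<in> X. w)"
    unfolding profit_def using X(2) by (intro sum_mono) (auto simp: psol_def opt_def dest!: bspec)
  also have "\<dots> \<le> W" unfolding W(1) using X(1) finTS by (intro sum_mono2) auto
  finally show ?thesis .
qed

lemma rep_keys:
  assumes X: "X \<subseteq> tasks_from C" and ch: "psol X ch" "rep X ch u"
  shows "u \<in> keys C"
proof -
  have len: "length u = m" using ch by (simp add: rep_def)
  moreover have "vle u cs"
    using ch len unfolding vle_iff[OF len] psol_def rep_def by (meson le_trans)
  moreover have "touch (ball L C) i" if i: "i < m" "u ! i \<noteq> 0" for i
  proof -
    have "usage X ch i \<noteq> 0" using ch(2) i by (auto simp: rep_def dest!: spec[of _ i])
    then obtain T where T: "T \<in> X" "fst (ch T) ! i \<noteq> 0"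
      unfolding usage_def by (rule sum.not_neutral_contains_not_neutral)
    have "touch (ball L {fst T}) i"
      using T X ch(1) i(1) by (intro opt_touch[of T "ch T"]) (auto simp: psol_def tasks_from_def)
    moreover have "ball L {fst T} \<subseteq> ball L C"
      using T X by (intro nbs_funpow_mono) (auto simp: tasks_from_def)
    ultimately show ?thesis by (meson touch_mono)
  qed
  ultimately show ?thesis by (simp add: keys_def)
qed

lemma tasks_from_TS: "tasks_from C \<subseteq> TS"
  by (auto simp: tasks_from_def)

text \<open>For a join alone only the profit bound \<open>2 * W\<close> is known. It does not double
  from join to join, because each entry of the result is the profit of an actual choice for tasks of
  the instance.\<close>

lemma kt_represents:
  assumes "kt Q W' T" "represents X T" "X \<subseteq> TS"
  shows "kt Q W T"
proof -
  have "p \<le> W" if "(u, p) \<in> set T" for u p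
    using representsD1[OF assms(2) that] profit_le[OF assms(3)] by blast
  then show ?thesis using assms(1) unfolding kt_def by auto
qed

lemma zero_keys: "zero \<in> keys R"
  by (simp add: keys_def vle_iff)

lemma W_sn: "sn W" using W(2) by simp

lemma w_le_W: "(s, t, d, w) \<in> TS \<Longrightarrow> w \<le> W"
  unfolding W(1) using member_le_sum[of "(s, t, d, w)" TS "\<lambda>(s, t, d, w). w"] finTS by auto

lemma walk_table:
  assumes T: "(s, t, d, w) \<in> TS" and C: "s \<in> C" "C \<subseteq> V" "card C \<le> K * (\<Delta> + 3)"
  defines "R \<equiv> walk es cs t d w L s zero [(zero, 0)]"
  shows "kt (keys C) W R" "represents {(s, t, d, w)} R"
    "ct Walk (walk_arg k es cs t d w L s zero [(zero, 0)]) \<le> B ^ 8"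
proof -
  have kt0: "kt (keys C) W [(zero, 0)]" using zero_keys by (simp add: kt_def)
  have inK: "v \<in> keys C" if v: "v \<in> wset es t d L s zero" "vle v cs" for v
  proof -
    have "touch (ball L C) i" if i: "i < m" "v ! i \<noteq> 0" for i
    proof -
      have "touch (ball L {s}) i"
        using wset_touch[OF v(1) _ i(1)] C i by auto
      moreover have "ball L {s} \<subseteq> ball L C" using C(1) by (intro nbs_funpow_mono) auto
      ultimately show ?thesis by (meson touch_mono)
    qed
    then show ?thesis using wset_length[OF v(1)] v(2) by (simp add: keys_def)
  qed
  note sm = small[OF T]
  note walk_facts = es len_cs sl_cs conjunct1[OF conjunct2[OF sm]]
    conjunct1[OF conjunct2[OF conjunct2[OF sm]]] W_sn w_le_W[OF T] keyset_keys[OF C(2,3)]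
  show "kt (keys C) W R" unfolding R_def by (rule kt_walk[OF walk_facts kt0 inK])
  show "represents {(s, t, d, w)} R" unfolding R_def by (rule represents_task[OF tabrel_walk])
  have "ct Walk (walk_arg k es cs t d w L s zero [(zero, 0)])
      \<le> wcost es L"
    by (rule ct_Walk[OF walk_facts _ _ _ LB(1) kt0 inK]) (use sm in auto)
  also have "\<dots> \<le> B ^ 7 * B" unfolding wcost_def by (intro mult_le_mono2 LB(2))
  finally show "ct Walk (walk_arg k es cs t d w L s zero [(zero, 0)]) \<le> B ^ 8"
    by (simp add: power_Suc2[symmetric] del: power_Suc)
qed

lemma join_table:
  assumes "keyset m (keys Q)" "kt (keys Q) W T2" "kt (keys Q) W T1"
  shows "ct Join (en cs ;; VNum 0 ;; tb T2 ;; tb T1) \<le> B ^ 10" "kt (keys Q) (2 * W) (join cs T2 T1 [])"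
proof -
  have sub: "fst ` set T1 \<subseteq> keys Q" "fst ` set T2 \<subseteq> keys Q" using assms by (simp_all add: kt_def)
  have "vadd u v \<in> keys Q" if "u \<in> fst ` set T1" "v \<in> fst ` set T2" "vle (vadd u v) cs" for u v
    using keys_vadd[OF subsetD[OF sub(1) that(1)] subsetD[OF sub(2) that(2)] that(3)] .
  note J = ct_Join[OF assms(1) sl_cs len_cs W(2) assms(2,3) this]
  show "ct Join (en cs ;; VNum 0 ;; tb T2 ;; tb T1) \<le> B ^ 10" "kt (keys Q) (2 * W) (join cs T2 T1 [])"
    by (rule J; assumption)+
qed

abbreviation leaf_arg :: "nat list \<Rightarrow> tab \<Rightarrow> task list \<Rightarrow> val" where
  "leaf_arg C acc ts' \<equiv> en C ;; ee k es ;; en cs ;; VNum L ;; tb acc ;; te ts'"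

lemma Leaf_spec:
  assumes C: "set C \<subseteq> V" "distinct C" "card (set C) \<le> K * (\<Delta> + 3)"
  shows "distinct ts' \<Longrightarrow> set ts' \<subseteq> TS \<Longrightarrow> X \<subseteq> tasks_from (set C) \<Longrightarrow> X \<inter> set ts' = {} \<Longrightarrow>
    represents X acc \<Longrightarrow> kt (keys (set C)) W acc \<Longrightarrow>
    \<exists>R. fn Leaf (leaf_arg C acc ts') = Some (tb R) \<and>
      represents (X \<union> {T \<in> set ts'. fst T \<in> set C}) R \<and> kt (keys (set C)) W R \<and>
      ct Leaf (leaf_arg C acc ts') \<le> B ^ 11 * (length ts' + 1)"
proof (induction ts' arbitrary: X acc)
  case Nil
  have v: "fn Leaf (leaf_arg C acc []) = Some (tb acc)"
    by (subst fn_unfold) (simp add: body.simps)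
  then show ?case using ct_unfold[OF v] B B_pows Nil.prems by (intro exI[of _ acc]) (simp add: body.simps)
next
  case (Cons T ts')
  obtain s t d w where T: "T = (s, t, d, w)" by (cases T)
  have TTS: "(s, t, d, w) \<in> TS" using Cons.prems(2) T by simp
  have Q: "keyset m (keys (set C))" using keyset_keys[OF C(1,3)] .
  have memC: "ct Mem (VNum s ;; en C) \<le> B ^ 3" using small[OF TTS] slC[OF C(1,2)] by (intro ct_Mem) auto
  show ?case
  proof (cases "s \<in> set C")
    case False
    obtain R where R: "fn Leaf (leaf_arg C acc ts') = Some (tb R)"
      "represents (X \<union> {T \<in> set ts'. fst T \<in> set C}) R" "kt (keys (set C)) W R"
      "ct Leaf (leaf_arg C acc ts') \<le> B ^ 11 * (length ts' + 1)"
      using Cons.IH[of X acc] Cons.prems by auto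
    have v: "fn Leaf (leaf_arg C acc (T # ts')) = Some (tb R)"
      using R(1) False by (subst fn_unfold) (simp add: body.simps T)
    have "ct Leaf (leaf_arg C acc (T # ts')) \<le> 100 + ct Mem (VNum s ;; en C) +
      ct Leaf (leaf_arg C acc ts')"
      using R(1) False by (subst ct_unfold[OF v]) (simp add: body.simps T)
    then have "ct Leaf (leaf_arg C acc (T # ts')) \<le> B ^ 11 * (length (T # ts') + 1)"
      using R(4) memC B B_pows by (simp add: algebra_simps)
    moreover have "{T' \<in> set (T # ts'). fst T' \<in> set C} = {T \<in> set ts'. fst T \<in> set C}"
      using False T by auto
    ultimately show ?thesis using v R(2,3) by auto
  next
    case True
    define R0 where "R0 = walk es cs t d w L s zero [(zero, 0)]"
    note R0 = walk_table[OF TTS True C(1,3), folded R0_def]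
    have v0: "fn Walk (VNum L ;; VNum s ;; VNum t ;; VNum d ;; VNum w ;; en cs ;; ee k es ;; en zero ;; (en zero ;; VNum 0) ;; VNum 0)
       = Some (tb R0)"
      using fn_Walk[of cs es zero "[(zero, 0)]" L s t d w k] len_cs by (simp add: R0_def)
    define acc' where "acc' = join cs acc R0 []"
    have wts: "wt m acc" "wt m R0" using Cons.prems(6) R0(1) Q kt_wt by blast+
    have vJ: "fn Join (en cs ;; VNum 0 ;; tb acc ;; tb R0) = Some (tb acc')"
      using fn_Join[of cs m "[]" acc R0] wts len_cs by (simp add: acc'_def)
    have J: "ct Join (en cs ;; VNum 0 ;; tb acc ;; tb R0) \<le> B ^ 10" "kt (keys (set C)) (2 * W) acc'"
      unfolding acc'_def by (rule join_table[OF Q Cons.prems(6) R0(1)])+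
    have TX: "{T} \<inter> X = {}" "X \<subseteq> TS" using Cons.prems(3,4) by (auto simp: tasks_from_def)
    have rep': "represents ({T} \<union> X) acc'"
      unfolding acc'_def by (rule represents_join[OF _ TX(2,1) R0(2)[folded T] Cons.prems(5)])
        (use TTS T in simp)
    have kt': "kt (keys (set C)) W acc'" using kt_represents[OF J(2) rep'] TX(2) TTS T by simp
    have "T \<in> tasks_from (set C)" using True T TTS by (simp add: tasks_from_def)
    then obtain R where R: "fn Leaf (leaf_arg C acc' ts') = Some (tb R)"
      "represents ({T} \<union> X \<union> {T \<in> set ts'. fst T \<in> set C}) R" "kt (keys (set C)) W R"
      "ct Leaf (leaf_arg C acc' ts') \<le> B ^ 11 * (length ts' + 1)"
      using Cons.IH[OF _ _ _ _ rep' kt'] Cons.prems(1-4) by auto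
    have v: "fn Leaf (leaf_arg C acc (T # ts')) = Some (tb R)"
      using R(1) True vJ v0 by (subst fn_unfold) (simp add: body.simps T)
    have "ct Leaf (leaf_arg C acc (T # ts')) \<le> 200 + ct Mem (VNum s ;; en C) +
      2 * ct Zero (ee k es) +
      ct Walk (walk_arg k es cs t d w L s zero [(zero, 0)]) +
      ct Join (en cs ;; VNum 0 ;; tb acc ;; tb R0) +
      ct Leaf (leaf_arg C acc' ts')"
      using R(1) True vJ v0 by (subst ct_unfold[OF v]) (simp add: body.simps T)
    then have "ct Leaf (leaf_arg C acc (T # ts')) \<le> B ^ 11 * (length (T # ts') + 1)"
      using R(4) memC B B_pows R0(3) J(1) ct_Zero[OF mB, of "\<lambda>(u, v). VNum u ;; VNum v ;; enc_unary (k u v)"]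
      by (simp add: algebra_simps)
    moreover have eq: "X \<union> {T' \<in> set (T # ts'). fst T' \<in> set C} = {T} \<union> X \<union> {T \<in> set ts'. fst T \<in> set C}"
      using True T by auto
    ultimately show ?thesis unfolding eq using v R(2,3) by blast
  qed
qed

text \<open>The unit of the amortized analysis. It exceeds the work at one set besides the recursive
  calls, where \<open>Split\<close> dominates with at most \<open>B ^ 16\<close>.\<close>

definition M :: nat where "M = B ^ 17"

abbreviation solve_arg :: "val \<Rightarrow> val" where
  "solve_arg x \<equiv> en vs ;; ee k es ;; en cs ;; te ts ;; VNum L ;; x"

text \<open>
  Amortized cost: if \<open>C\<close> splits into at least two pieces, the credit of \<open>5 * M\<close> of each piece
  pays for its join and for the work at \<open>C\<close>.
\<close>

definition solved :: "nat list \<Rightarrow> bool" where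
  "solved C \<longleftrightarrow> (\<exists>R. fn Solve (solve_arg (en C)) = Some (tb R) \<and>
    represents (tasks_from (set C)) R \<and> kt (keys (bd (set C))) W R \<and>
    ct Solve (solve_arg (en C)) + 5 * M \<le> M * (6 * max 1 (length C)))"

text \<open>Of the credit \<open>5 * M\<close> of a piece one \<open>M\<close> pays for its join,
  and \<open>4 * M\<close> are handed on. The summand 1 on the right pays for the empty
  list.\<close>

lemma SolveAll_spec:
  assumes sub: "\<And>q. q \<in> set ps \<Longrightarrow> solved q \<and> q \<noteq> [] \<and> bd (set q) \<subseteq> RR"
    and RR: "RR \<subseteq> V" "card RR \<le> K * (\<Delta> + 3)"
  shows "set qs \<subseteq> set ps \<Longrightarrow> distinct (concat qs) \<Longrightarrow>
    \<exists>R. fn SolveAll (solve_arg (enc_list en qs)) = Some (tb R) \<and>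
      represents (tasks_from (set (concat qs))) R \<and> kt (keys RR) W R \<and>
      ct SolveAll (solve_arg (enc_list en qs)) + 4 * M * length qs \<le> M * (6 * length (concat qs) + 1)"
proof (induction qs)
  case Nil
  have v: "fn SolveAll (solve_arg (enc_list en [])) = Some (tb [(zero, 0)])"
    by (subst fn_unfold) (simp add: body.simps)
  have "ct SolveAll (solve_arg (enc_list en [])) \<le> 60 + ct Zero (ee k es)"
    by (subst ct_unfold[OF v]) (simp add: body.simps)
  then have "ct SolveAll (solve_arg (enc_list en [])) \<le> M"
    using ct_Zero[OF mB, of "\<lambda>(u, v). VNum u ;; VNum v ;; enc_unary (k u v)"] B B_pows unfolding M_def by linarith
  moreover have "kt (keys RR) W [(zero, 0)]" using zero_keys by (simp add: kt_def)
  moreover have "tasks_from {} = {}" by (simp add: tasks_from_def)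
  ultimately show ?case using v represents_empty by (intro exI[of _ "[(zero, 0)]"]) simp
next
  case (Cons q qs)
  have Q: "keyset m (keys RR)" using keyset_keys[OF RR] .
  obtain R1 where R1: "fn SolveAll (solve_arg (enc_list en qs)) = Some (tb R1)"
    "represents (tasks_from (set (concat qs))) R1" "kt (keys RR) W R1"
    "ct SolveAll (solve_arg (enc_list en qs)) + 4 * M * length qs \<le> M * (6 * length (concat qs) + 1)"
    using Cons by auto
  have q: "solved q" "q \<noteq> []" "bd (set q) \<subseteq> RR" using sub Cons.prems(1) by auto
  obtain R0 where R0: "fn Solve (solve_arg (en q)) = Some (tb R0)"
    "represents (tasks_from (set q)) R0" "kt (keys (bd (set q))) W R0"
    "ct Solve (solve_arg (en q)) + 5 * M \<le> M * (6 * max 1 (length q))"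
    using q(1) unfolding solved_def by blast
  have kt0: "kt (keys RR) W R0" using kt_mono[OF R0(3) keys_mono[OF q(3)]] by simp
  define R where "R = join cs R1 R0 []"
  have wts: "wt m R1" "wt m R0" using R1(3) kt0 Q kt_wt by blast+
  have vJ: "fn Join (en cs ;; VNum 0 ;; tb R1 ;; tb R0) = Some (tb R)"
    using fn_Join[of cs m "[]" R1 R0] wts len_cs by (simp add: R_def)
  have J: "ct Join (en cs ;; VNum 0 ;; tb R1 ;; tb R0) \<le> B ^ 10" "kt (keys RR) (2 * W) R"
    unfolding R_def by (rule join_table[OF Q R1(3) kt0])+
  have "set q \<inter> set (concat qs) = {}" using Cons.prems(2) by auto
  then have disj: "tasks_from (set q) \<inter> tasks_from (set (concat qs)) = {}"
    by (auto simp: tasks_from_def)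
  have un: "tasks_from (set q) \<union> tasks_from (set (concat qs)) = tasks_from (set (concat (q # qs)))"
    by (auto simp: tasks_from_def)
  have rep: "represents (tasks_from (set (concat (q # qs)))) R"
    unfolding R_def un[symmetric]
    by (rule represents_join[OF tasks_from_TS tasks_from_TS disj R0(2) R1(2)])
  have kt: "kt (keys RR) W R" by (rule kt_represents[OF J(2) rep tasks_from_TS])
  have v: "fn SolveAll (solve_arg (enc_list en (q # qs))) = Some (tb R)"
    using R1(1) R0(1) vJ by (subst fn_unfold) (simp add: body.simps)
  have "ct SolveAll (solve_arg (enc_list en (q # qs))) \<le> 200 + ct SolveAll (solve_arg (enc_list en qs)) +
    ct Solve (solve_arg (en q)) + ct Join (en cs ;; VNum 0 ;; tb R1 ;; tb R0)"
    using R1(1) R0(1) vJ by (subst ct_unfold[OF v]) (simp add: body.simps)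
  moreover have "200 + B ^ 10 \<le> M" unfolding M_def using B B_pows by linarith
  moreover have "max 1 (length q) = length q" using q(2) by (cases q) auto
  ultimately have "ct SolveAll (solve_arg (enc_list en (q # qs))) + 4 * M * length (q # qs)
      \<le> M * (6 * length (concat (q # qs)) + 1)"
    using R1(4) R0(4) J(1) by (simp add: algebra_simps)
  then show ?case using v rep kt by blast
qed

lemma Solve_spec:
  "set C \<subseteq> V \<Longrightarrow> distinct C \<Longrightarrow> ecut es (set C) \<le> K \<Longrightarrow> solved C"
proof (induction C rule: length_induct)
  case (1 C)
  let ?C = "set C"
  have K2: "2 * K \<le> K * (\<Delta> + 3)" "K \<ge> 1" unfolding KB(1) by (auto simp: algebra_simps)
  have bdC: "bd ?C \<subseteq> V" "card (bd ?C) \<le> K * (\<Delta> + 3)"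
    using bd_V card_bd[of ?C] 1(4) K2(1) by (blast, linarith)
  define R0 where "R0 = (expd es vs ^^ L) (filter (\<lambda>x. x \<notin> ?C) vs)"
  define mv :: "nat list" where "mv = map (\<lambda>(a, b). of_bool (a \<in> set R0 \<or> b \<in> set R0)) es"
  have sR0: "set R0 = ball L (V - ?C)"
    unfolding R0_def set_expd_funpow vs(2) set_filter by (simp add: set_diff_eq)
  have slR0: "sl R0" unfolding R0_def using sl_filter[OF vs(3)] sl_expd[OF vs(3)]
    by (cases L) (auto simp del: funpow.simps simp: funpow.simps(2))
  have lmv: "length mv = m" by (simp add: mv_def)
  have mv_iff: "mv ! i \<noteq> 0 \<longleftrightarrow> touch (ball L (V - ?C)) i" if "i < m" for i
    using that by (auto simp: mv_def touch_def sR0 split: prod.splits)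
  have vI: "fn Iter (VNum L ;; en (filter (\<lambda>x. x \<notin> ?C) vs) ;; ee k es ;; en vs) = Some (en R0)"
    by (simp add: R0_def)
  have vM: "fn Mvec (en R0 ;; ee k es) = Some (en mv)"
    by (simp add: mv_def)
  \<comment> \<open>The part of the body of \<open>Solve\<close> that computes the table before
    masking; naming it lets leaves and splits share the argument about the mask.\<close>
  define arg where "arg = Cond (Cond L5 (Snd L5) zr)
        (cl SolveAll (X0 ,, X1 ,, X2 ,, X3 ,, X4 ,, cl Split (zr ,, X1 ,, L5)))
        (cl Leaf (L5 ,, X1 ,, X2 ,, X4 ,, ((cl Zero X1 ,, zr) ,, zr) ,, X3))"
  have zc: "ct Zero (ee k es) \<le> B ^ 3"
    using ct_Zero[OF mB, of "\<lambda>(u, v). VNum u ;; VNum v ;; enc_unary (k u v)"] .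
  have main: "\<exists>T RR. vd (fnP prog) [solve_arg (en C)] arg = Some (tb T) \<and>
    represents (tasks_from ?C) T \<and> kt (keys RR) W T \<and> RR \<subseteq> V \<and> card RR \<le> K * (\<Delta> + 3) \<and>
    cd (fnP prog) (ctP prog) [solve_arg (en C)] arg + 5 * M + B ^ 16 \<le> M * (6 * max 1 (length C))"
  proof (cases "2 \<le> length C")
    case False
    then have l1: "length C \<le> 1" by simp
    then have t1: "tl C = []" by (cases C) auto
    have c1: "card ?C \<le> K * (\<Delta> + 3)" using card_length[of C] K2 l1 by linarith
    have "kt (keys ?C) W [(zero, 0)]" using zero_keys by (simp add: kt_def)
    from Leaf_spec[OF 1(2,3) c1 ts(1) _ _ _ represents_empty this] obtain R where
      R: "fn Leaf (leaf_arg C [(zero, 0)] ts) = Some (tb R)"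
      "represents {T \<in> set ts. fst T \<in> ?C} R" "kt (keys ?C) W R"
      "ct Leaf (leaf_arg C [(zero, 0)] ts) \<le> B ^ 11 * (length ts + 1)"
      using ts(2) by auto
    have v: "vd (fnP prog) [solve_arg (en C)] arg = Some (tb R)"
      using R(1) t1 by (cases C) (simp_all add: arg_def)
    have "cd (fnP prog) (ctP prog) [solve_arg (en C)] arg \<le> 100 + ct Zero (ee k es) +
       ct Leaf (leaf_arg C [(zero, 0)] ts)"
      using R(1) t1 by (cases C) (simp_all add: arg_def)
    moreover have "B ^ 11 * (length ts + 1) \<le> B ^ 12" using loop_le[OF ts(3), of 11] by simp
    moreover have mx: "max 1 (length C) = 1" using l1 by simp
    moreover have "100 + B ^ 3 + B ^ 12 + B ^ 16 \<le> M" unfolding M_def using B B_pows by linarith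
    ultimately have "cd (fnP prog) (ctP prog) [solve_arg (en C)] arg + 5 * M + B ^ 16 \<le> M * (6 * max 1 (length C))"
      unfolding mx using R(4) zc by linarith
    moreover have "tasks_from ?C = {T \<in> set ts. fst T \<in> ?C}" using ts(2) by (simp add: tasks_from_def)
    ultimately show ?thesis using v R(2,3) 1(2) c1 by metis
  next
    case True
    then have C0: "C \<noteq> []" "2 \<le> card ?C" and tl0: "tl C \<noteq> []"
      using 1(3) distinct_card[of C] by (auto simp: length_tl simp flip: length_greater_0_conv)
    obtain S where S: "S \<subseteq> ?C" "card S \<le> K" "ok_split es K ?C S"
      using exists_split[OF 1(2) C0(2) KB(1) 1(4)] by blast
    have lC: "length C \<le> length vs" using lenC 1(2,3) by blast
    have "2 * (length C + 1) ^ K \<le> 2 * (length vs + 1) ^ K"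
      using lC by (intro mult_le_mono2 power_mono) auto
    then have "2 * (length C + 1) ^ K \<le> B" using KB(3) by linarith
    from Split_spec[OF es slC[OF 1(2,3)] 1(3) C0(1) KB(2) this S, of 0 k] obtain ps where
      ps: "fn Split (VNum 0 ;; ee k es ;; en C) = Some (enc_list en ps)" "good_split es K ?C ps"
      "ct Split (VNum 0 ;; ee k es ;; en C) \<le> B ^ 15 * (K + 1)" by auto
    obtain S' where S': "S' \<subseteq> ?C" "card S' \<le> K" and part: "part es S' ?C ps"
      and two: "2 \<le> length ps" and cuts: "\<And>p. p \<in> set ps \<Longrightarrow> ecut es (set p) \<le> K"
      using ps(2) unfolding good_split_def by blast
    define RR where "RR = bd ?C \<union> nbs es V S'"
    have RRV: "RR \<subseteq> V" using bd_V by (auto simp: RR_def nbs_def)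
    have "card RR \<le> card (bd ?C) + card (nbs es V S')" unfolding RR_def by (rule card_Un_le)
    also have "\<dots> \<le> 2 * K + K * (\<Delta> + 1)"
      using card_bd[of ?C] 1(4) card_nbs[of S'] S' 1(2) mult_le_mono1[OF S'(2), of "\<Delta> + 1"]
      by (intro add_mono) (auto intro: order_trans)
    also have "\<dots> = K * (\<Delta> + 3)" by (simp add: algebra_simps)
    finally have cRR: "card RR \<le> K * (\<Delta> + 3)" .
    have lenps: "length (concat ps) = length C" "distinct (concat ps)" "set (concat ps) = ?C"
      using part 1(3) distinct_card[of "concat ps"] distinct_card[of C] by (auto simp: part_def simp del: set_concat)
    have "solved q \<and> q \<noteq> [] \<and> bd (set q) \<subseteq> RR" if q: "q \<in> set ps" for q
    proof -
      have qC: "set q \<subseteq> ?C" "distinct q" "q \<noteq> []" using part_piece[OF part q] by auto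
      have "length q < length C"
      proof -
        obtain xs ys where xy: "ps = xs @ q # ys" using q by (meson split_list)
        have "[] \<notin> set (xs @ ys)" using part xy by (auto simp: part_def)
        then have "length (xs @ ys) \<le> length (concat (xs @ ys))" by (rule length_le_concat)
        moreover have "1 \<le> length (xs @ ys)" using two xy by simp
        moreover have "length (concat ps) = length q + length (concat (xs @ ys))" by (simp add: xy)
        ultimately show ?thesis using lenps(1) by linarith
      qed
      then have "solved q" using 1(1) qC 1(2) cuts[OF q] by blast
      then show ?thesis using qC bd_piece[OF part q S'(1) 1(2)] by (auto simp: RR_def)
    qed
    from SolveAll_spec[OF this RRV cRR order.refl lenps(2)] obtain R where
      R: "fn SolveAll (solve_arg (enc_list en ps)) = Some (tb R)"
      "represents (tasks_from ?C) R" "kt (keys RR) W R"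
      "ct SolveAll (solve_arg (enc_list en ps)) + 4 * M * length ps \<le> M * (6 * length C + 1)"
      using lenps(1,3) by auto
    have v: "vd (fnP prog) [solve_arg (en C)] arg = Some (tb R)"
      using R(1) ps(1) tl0 by (cases C) (simp_all add: arg_def)
    have "cd (fnP prog) (ctP prog) [solve_arg (en C)] arg \<le> 100 +
       ct Split (VNum 0 ;; ee k es ;; en C) + ct SolveAll (solve_arg (enc_list en ps))"
      using R(1) ps(1) tl0 by (cases C) (simp_all add: arg_def)
    moreover have "B ^ 15 * (K + 1) \<le> B ^ 16" using loop_le[OF KB(2), of 15] by simp
    \<comment> \<open>Two pieces hand on at least \<open>8 * M\<close>: one \<open>M\<close> is used
      up by the empty list, \<open>5 * M\<close> become the credit of \<open>C\<close>, and the rest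
      covers the work at \<open>C\<close>.\<close>
    moreover have "ct SolveAll (solve_arg (enc_list en ps)) + 8 * M \<le> M * (6 * length C) + M"
    proof -
      have "4 * M * 2 \<le> 4 * M * length ps" using two by (intro mult_le_mono2)
      then have "ct SolveAll (solve_arg (enc_list en ps)) + 8 * M \<le> M * (6 * length C + 1)"
        using R(4) by linarith
      then show ?thesis by simp
    qed
    moreover have "100 + 2 * B ^ 16 \<le> M" unfolding M_def using B B_pows by linarith
    moreover have mx: "max 1 (length C) = length C" using True by simp
    ultimately have "cd (fnP prog) (ctP prog) [solve_arg (en C)] arg + 5 * M + B ^ 16 \<le> M * (6 * max 1 (length C))"
      unfolding mx using ps(3) by linarith
    then show ?thesis using v R(2,3) RRV cRR by blast
  qed
  then obtain T RR where T: "vd (fnP prog) [solve_arg (en C)] arg = Some (tb T)"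
    "represents (tasks_from ?C) T" "kt (keys RR) W T" "RR \<subseteq> V" "card RR \<le> K * (\<Delta> + 3)"
    "cd (fnP prog) (ctP prog) [solve_arg (en C)] arg + 5 * M + B ^ 16 \<le> M * (6 * max 1 (length C))" by blast
  have QR: "keyset m (keys RR)" using keyset_keys[OF T(4,5)] .
  have Qb: "keyset m (keys (bd ?C))" using keyset_keys[OF bdC] .
  define R where "R = mask mv T []"
  have rep: "represents (tasks_from ?C) R"
    unfolding R_def by (rule represents_mask[OF lmv _ T(2)]) (use mv_iff live_touch in blast)
  \<comment> \<open>Tasks from \<open>C\<close> use only edges near \<open>C\<close>, and the mask
    keeps only edges near \<open>V - C\<close>. By \<open>touch_both\<close> what remains is near
    the boundary.\<close>
  have inb: "vmask mv u \<in> keys (bd ?C)" if u: "(u, p) \<in> set T" for u p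
  proof -
    obtain ch where ch: "psol (tasks_from ?C) ch" "rep (tasks_from ?C) ch u"
      using representsD1[OF T(2) u] by blast
    have uk: "u \<in> keys ?C" using rep_keys[OF order.refl ch] .
    then have u': "length u = m" "\<And>i. i < m \<Longrightarrow> u ! i \<le> cs ! i"
      "\<And>i. i < m \<Longrightarrow> u ! i \<noteq> 0 \<Longrightarrow> touch (ball L ?C) i"
      using vle_iff by (auto simp: keys_def)
    have len: "length (vmask mv u) = m" using u'(1) lmv by simp
    moreover have "vle (vmask mv u) cs" unfolding vle_iff[OF len] using u' lmv by simp
    moreover have "touch (ball L (bd ?C)) i" if i: "i < m" "vmask mv u ! i \<noteq> 0" for i
    proof -
      have "mv ! i \<noteq> 0" "u ! i \<noteq> 0" using i u'(1) lmv by (auto split: if_splits)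
      then show ?thesis using touch_both[OF 1(2) i(1)] u'(3)[OF i(1)] mv_iff[OF i(1)] by blast
    qed
    ultimately show ?thesis by (simp add: keys_def)
  qed
  have kt: "kt (keys (bd ?C)) W R"
    unfolding R_def by (rule kt_tabrel[OF tabrel_mask kt_Nil]) (use inb ktD[OF T(3)] in auto)
  have vK: "fn Mask (en mv ;; VNum 0 ;; tb T) = Some (tb R)"
    using fn_Mask[OF lmv, of "[]" T] kt_wt[OF T(3) QR] by (simp add: R_def)
  have v: "fn Solve (solve_arg (en C)) = Some (tb R)"
    using T(1) vK vI vM by (subst fn_unfold) (simp add: body.simps arg_def[symmetric])
  have "ct Solve (solve_arg (en C)) \<le> 200 + ct Diff (en C ;; en vs) +
     ct Iter (VNum L ;; en (filter (\<lambda>x. x \<notin> ?C) vs) ;; ee k es ;; en vs) + ct Mvec (en R0 ;; ee k es) +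
     cd (fnP prog) (ctP prog) [solve_arg (en C)] arg + ct Mask (en mv ;; VNum 0 ;; tb T)"
    using T(1) vK vI vM by (subst ct_unfold[OF v]) (simp add: body.simps arg_def[symmetric])
  moreover have "ct Diff (en C ;; en vs) \<le> B ^ 5" using ct_Diff slC 1(2,3) vs(3) by blast
  moreover have "ct Iter (VNum L ;; en (filter (\<lambda>x. x \<notin> ?C) vs) ;; ee k es ;; en vs) \<le> B ^ 9"
    using ct_Iter[OF vs(3) es sl_filter[OF vs(3)] LB(1)] .
  moreover have "ct Mvec (en R0 ;; ee k es) \<le> B ^ 5" using ct_Mvec[OF slR0 es] .
  moreover have "ct Mask (en mv ;; VNum 0 ;; tb T) \<le> B ^ 7"
    using inb ktD[OF T(3)] by (intro ct_Mask[OF Qb lmv W_sn kt_st[OF T(3) QR W_sn] kt_length[OF T(3) QR]]) blast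
  moreover have "200 + B ^ 5 + B ^ 9 + B ^ 5 + B ^ 7 \<le> B ^ 16" using B B_pows by linarith
  ultimately have "ct Solve (solve_arg (en C)) + 5 * M \<le> M * (6 * max 1 (length C))"
    using T(6) by linarith
  then show ?case unfolding solved_def using v rep kt by blast
qed

end

context solver begin

text \<open>The whole vertex set has no boundary edges, so it satisfies the invariant of
  \<open>Solve_spec\<close>. All its usages are masked, and only the best profit remains.\<close>

lemma Main_spec:
  assumes q: "sn q"
  defines "x \<equiv> en vs ;; ee k es ;; te ts ;; VNum q ;; VNum L"
  shows "fn Main x = Some (bl (\<exists>ch. psol TS ch \<and> q \<le> profit TS ch))" "ct Main x \<le> B ^ 20"
proof -
  have e: "{(a, b) \<in> set es. (a \<in> V) \<noteq> (b \<in> V)} = {}" using edge_V by blast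
  have "ecut es (set vs) \<le> K" unfolding ecut_card vs(2) e by simp
  then have "solved vs" using Solve_spec[of vs] vs by simp
  then obtain R where R: "fn Solve (solve_arg (en vs)) = Some (tb R)" "represents (tasks_from V) R"
    "kt (keys (bd V)) W R" "ct Solve (solve_arg (en vs)) + 5 * M \<le> M * (6 * max 1 (length vs))"
    unfolding solved_def vs(2) by blast
  have all: "tasks_from V = TS" using TS_V by (auto simp: tasks_from_def)
  have vC: "fn Caps (ee k es) = Some (en cs)" by (simp add: cs(1))
  have "fn Main x = Some (bl (\<exists>y \<in> set R. q \<le> snd y))"
    using R(1) vC unfolding x_def by (subst fn_unfold) (simp add: body.simps)
  moreover have "(\<exists>y \<in> set R. q \<le> snd y) \<longleftrightarrow> (\<exists>ch. psol TS ch \<and> q \<le> profit TS ch)"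
  proof
    assume "\<exists>y \<in> set R. q \<le> snd y"
    then obtain u p where "(u, p) \<in> set R" "q \<le> p" by auto
    then show "\<exists>ch. psol TS ch \<and> q \<le> profit TS ch"
      using representsD1[OF R(2)] unfolding all by blast
  next
    assume "\<exists>ch. psol TS ch \<and> q \<le> profit TS ch"
    then obtain ch where ch: "psol TS ch" "q \<le> profit TS ch" by blast
    obtain u p where "(u, p) \<in> set R" "profit TS ch \<le> p"
      using representsD2[OF R(2)[unfolded all] ch(1)] by blast
    then show "\<exists>y \<in> set R. q \<le> snd y" using ch(2) by force
  qed
  ultimately show v: "fn Main x = Some (bl (\<exists>ch. psol TS ch \<and> q \<le> profit TS ch))" by simp
  have "bd V = {}" using edge_V by (auto simp: bd_def)
  then have Q: "keyset m (keys (bd V))" by (intro keyset_keys) auto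
  have "ct Main x \<le> 200 + ct Caps (ee k es) + ct Solve (solve_arg (en vs)) + ct Any (VNum q ;; tb R)"
    using R(1) vC unfolding x_def by (subst ct_unfold[OF v[unfolded x_def]]) (simp add: body.simps)
  moreover have "ct Caps (ee k es) \<le> B ^ 5" using cs mB by (intro ct_Caps) auto
  moreover have "ct Any (VNum q ;; tb R) \<le> B ^ 3"
    by (rule ct_Any[OF q kt_st[OF R(3) Q W_sn] kt_length[OF R(3) Q]])
  moreover have "M * (6 * max 1 (length vs)) \<le> B ^ 17 * (B * B)"
  proof -
    have "max 1 (length vs) \<le> B" using sl_length[OF vs(3)] B by simp
    then have "6 * max 1 (length vs) \<le> B * B" using B by (intro mult_le_mono) auto
    then show ?thesis unfolding M_def by (rule mult_le_mono2)
  qed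
  moreover have "B ^ 17 * (B * B) = B ^ 19" by (simp add: eval_nat_numeral)
  moreover have "100 * B ^ 18 \<le> B ^ 19" "100 * B ^ 19 \<le> B ^ 20" using B_pow[of 18] B_pow[of 19] by simp_all
  ultimately show "ct Main x \<le> B ^ 20" using R(4) B B_pows by linarith
qed

end

section \<open>From partial solutions to the flow problem\<close>

context flow begin

lemma unsplittable_flow_iff:
  assumes I: "verts I = V" "edges I = eset es" "tasks I = TS" "length_bound I = L"
    and cap: "cs = map (\<lambda>(u, v). capacity I {u, v}) es"
  shows "unsplittable_flow I \<longleftrightarrow> (\<exists>ch. psol TS ch \<and> target I \<le> profit TS ch)"
proof -
  define dem :: "task \<Rightarrow> nat" where "dem T = (case T of (s, t, d, w) \<Rightarrow> d)" for T
  define gain :: "task \<Rightarrow> nat" where "gain T = (case T of (s, t, d, w) \<Rightarrow> w)" for T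
  define walks :: "task \<Rightarrow> nat list set" where
    "walks T = (case T of (s, t, d, w) \<Rightarrow> wset es t d L s zero)" for T
  define isp :: "task \<Rightarrow> nat list \<Rightarrow> bool" where
    "isp T p = (case T of (s, t, d, w) \<Rightarrow> is_path V (eset es) s t p \<and> path_length p \<le> L)" for T p
  define ed :: "nat \<Rightarrow> nat set" where "ed i = {fst (es ! i), snd (es ! i)}" for i
  have opt: "opt T = insert (zero, 0) ((\<lambda>u. (u, gain T)) ` walks T)" for T
    by (auto simp: opt_def gain_def walks_def split: prod.splits)
  have edges: "eset es = ed ` {..<m}"
    by (force simp: eset_def ed_def in_set_conv_nth image_iff)
  have capi: "cs ! i = capacity I (ed i)" if "i < m" for i
    using that by (simp add: cap ed_def case_prod_unfold)
  have routing: "flow_routing I T' r \<longleftrightarrow> (\<forall>T \<in> T'. isp T (r T)) \<and>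
      (\<forall>i < m. (\<Sum>T \<in> {T \<in> T'. ed i \<in> path_edges (r T)}. dem T) \<le> cs ! i)" for T' r
    unfolding flow_routing_def I isp_def edges dem_def[symmetric]
    using capi by (auto simp: case_prod_unfold dem_def)
  have sums: "(\<Sum>T \<in> {T \<in> T'. ed i \<in> path_edges (r T)}. dem T) =
      (\<Sum>T \<in> T'. if ed i \<in> path_edges (r T) then dem T else 0)" if "T' \<subseteq> TS" for T' r i
    using finite_subset[OF that finTS] by (rule sum.inter_filter)
  have uf: "unsplittable_flow I \<longleftrightarrow>
      (\<exists>T' \<subseteq> TS. (\<exists>r. flow_routing I T' r) \<and> target I \<le> sum gain T')"
    unfolding unsplittable_flow_def I gain_def by (simp add: case_prod_unfold)
  show ?thesis unfolding uf
  proof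
    assume "\<exists>T' \<subseteq> TS. (\<exists>r. flow_routing I T' r) \<and> target I \<le> sum gain T'"
    then obtain T' r where T': "T' \<subseteq> TS" "target I \<le> sum gain T'" and fr: "flow_routing I T' r"
      by blast
    have r: "\<And>T. T \<in> T' \<Longrightarrow> isp T (r T)"
      "\<And>i. i < m \<Longrightarrow> (\<Sum>T \<in> T'. if ed i \<in> path_edges (r T) then dem T else 0) \<le> cs ! i"
      using fr unfolding routing sums[OF T'(1)] by blast+
    have "\<exists>v \<in> walks T. \<forall>i < m. v ! i = (if ed i \<in> path_edges (r T) then dem T else 0)" if "T \<in> T'" for T
    proof -
      obtain s t d w where T: "T = (s, t, d, w)" by (cases T)
      have "is_path V (eset es) s t (r T)" "path_length (r T) \<le> L" using r(1)[OF that] by (auto simp: isp_def T)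
      from path_wset[OF this, of zero d] obtain v where "v \<in> wset es t d L s zero"
        "\<And>i. i < m \<Longrightarrow> v ! i = zero ! i + (if ed i \<in> path_edges (r T) then d else 0)"
        unfolding ed_def by auto
      then show ?thesis by (intro bexI[of _ v]) (simp_all add: walks_def dem_def T)
    qed
    then obtain vec where vec: "\<And>T. T \<in> T' \<Longrightarrow> vec T \<in> walks T"
      "\<And>T i. T \<in> T' \<Longrightarrow> i < m \<Longrightarrow> vec T ! i = (if ed i \<in> path_edges (r T) then dem T else 0)"
      by metis
    define ch where "ch T = (if T \<in> T' then (vec T, gain T) else (zero, 0))" for T
    have "usage TS ch i \<le> cs ! i" if i: "i < m" for i
    proof -
      have "usage TS ch i = (\<Sum>T \<in> T'. fst (ch T) ! i)"
        unfolding usage_def using T'(1) finTS i by (intro sum.mono_neutral_right) (auto simp: ch_def)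
      also have "\<dots> = (\<Sum>T \<in> T'. if ed i \<in> path_edges (r T) then dem T else 0)"
        using vec(2) i by (intro sum.cong) (auto simp: ch_def)
      finally show ?thesis using r(2)[OF i] by simp
    qed
    then have "psol TS ch" using vec(1) by (auto simp: psol_def opt ch_def)
    moreover have "profit TS ch = sum gain T'"
      unfolding profit_def using T'(1) finTS
      by (subst sum.mono_neutral_right[of TS T']) (auto simp: ch_def intro: sum.cong)
    ultimately show "\<exists>ch. psol TS ch \<and> target I \<le> profit TS ch" using T'(2) by metis
  next
    assume "\<exists>ch. psol TS ch \<and> target I \<le> profit TS ch"
    then obtain ch where ch: "\<And>T. T \<in> TS \<Longrightarrow> ch T \<in> opt T"
      "\<And>i. i < m \<Longrightarrow> usage TS ch i \<le> cs ! i" "target I \<le> profit TS ch"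
      unfolding psol_def by blast
    \<comment> \<open>A choice does not record whether a task is routed. Every task whose option can
      be read as a walk is routed here, even if the option also means to drop it; the other tasks
      have profit 0.\<close>
    define T' where "T' = {T \<in> TS. fst (ch T) \<in> walks T \<and> snd (ch T) = gain T}"
    have T': "T' \<subseteq> TS" by (auto simp: T'_def)
    have "\<exists>p. isp T p \<and> (\<forall>i < m. (if ed i \<in> path_edges p then dem T else 0) \<le> fst (ch T) ! i)"
      if "T \<in> T'" for T
    proof -
      obtain s t d w where T: "T = (s, t, d, w)" by (cases T)
      have "fst (ch T) \<in> wset es t d L s zero" "s \<in> V"
        using that TS_V by (auto simp: T'_def walks_def T)
      from wset_path[OF this(1) _ this(2)] obtain p where
        "is_path V (eset es) s t p" "path_length p \<le> L"
        "\<forall>i < m. zero ! i + (if {fst (es ! i), snd (es ! i)} \<in> path_edges p then d else 0) \<le> fst (ch T) ! i"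
        by auto
      then show ?thesis by (intro exI[of _ p]) (auto simp: isp_def dem_def ed_def T)
    qed
    then obtain r where r: "\<And>T. T \<in> T' \<Longrightarrow> isp T (r T)"
      "\<And>T i. T \<in> T' \<Longrightarrow> i < m \<Longrightarrow> (if ed i \<in> path_edges (r T) then dem T else 0) \<le> fst (ch T) ! i"
      by metis
    have "(\<Sum>T \<in> T'. if ed i \<in> path_edges (r T) then dem T else 0) \<le> cs ! i" if i: "i < m" for i
    proof -
      have "(\<Sum>T \<in> T'. if ed i \<in> path_edges (r T) then dem T else 0) \<le> (\<Sum>T \<in> T'. fst (ch T) ! i)"
        using r(2) i by (intro sum_mono)
      also have "\<dots> \<le> usage TS ch i" unfolding usage_def using T' finTS by (intro sum_mono2) auto
      finally show ?thesis using ch(2)[OF i] by simp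
    qed
    then have "flow_routing I T' r" unfolding routing using r(1) sums[OF T'] by simp
    moreover have "profit TS ch \<le> sum gain T'"
    proof -
      have "snd (ch T) = 0" if "T \<in> TS - T'" for T
        using ch(1)[of T] that by (auto simp: opt T'_def)
      then have "profit TS ch = (\<Sum>T \<in> T'. snd (ch T))"
        unfolding profit_def using T' finTS by (intro sum.mono_neutral_right) auto
      also have "\<dots> = sum gain T'" by (intro sum.cong) (auto simp: T'_def)
      finally show ?thesis by simp
    qed
    ultimately show "\<exists>T' \<subseteq> TS. (\<exists>r. flow_routing I T' r) \<and> target I \<le> sum gain T'"
      using T' ch(3) by (meson le_trans)
  qed
qed

end

section \<open>Membership in XP\<close>

text \<open>
  Instances have size at least 2, so any computable bound on the number of table entries is
  dominated by a power of the size; the double exponential is easy to compute by doubling.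
\<close>

definition exponent :: "nat list \<Rightarrow> nat" where
  "exponent ks = 2 ^ (2 ^ (sum_list ks + 6))"

text \<open>Function 1 calls itself twice and takes exponential time, which is harmless because
  \<open>computable\<close> sets no time bound.\<close>

definition exponent_prog :: program where
  "exponent_prog = [Call 1 (Call 1 (Call 2 L0)),
    Cond L0 (Add (Call 1 (Sub L0 on)) (Call 1 (Sub L0 on))) on,
    Cond L0 (Add (Fst L0) (Call 2 (Snd L0))) (Const 6)]"

lemma computable_exponent: "computable exponent"
proof -
  let ?f = "fnP exponent_prog"
  have pow: "?f 1 (VNum n) = Some (VNum (2 ^ n))" for n
  proof (induction n)
    case 0
    show ?case by (subst fnP_unfold) (simp_all add: exponent_prog_def)
  next
    case (Suc n)
    then show ?case by (subst fnP_unfold) (simp_all add: exponent_prog_def del: One_nat_def)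
  qed
  have sm: "?f 2 (en ks) = Some (VNum (sum_list ks + 6))" for ks
    by (induction ks) (subst fnP_unfold, simp_all add: exponent_prog_def)+
  have "?f 0 (en ks) = Some (VNum (exponent ks))" for ks
    using pow sm by (subst fnP_unfold) (simp_all add: exponent_prog_def exponent_def del: One_nat_def)
  then show ?thesis unfolding computable_def
    using runs_fnP[of exponent_prog] by (metis exponent_prog_def list.distinct(1))
qed

text \<open>\<open>G\<close> is the exponent in \<open>B = z ^ G\<close>, where \<open>z\<close> is
  the instance size, and 20 is the power of \<open>B\<close> in \<open>Main_spec\<close>.\<close>

lemma poly_le_exponent: 
  fixes a D L K G :: nat
  assumes K: "K = 2 * (a + 1) * (D + 1)"
    and G: "G = K * (D + 3) * (D + 1) ^ (L + 1) + K + 2 * L + 10"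
  shows "20 * G \<le> exponent [a, D, L]"
proof -
  define s where "s = a + D + L"
  \<comment> \<open>An upper bound for \<open>a + 1\<close>, \<open>D + 3\<close> and
    \<open>L + 1\<close> alike, so that all products turn into powers of \<open>y\<close>.\<close>
  define y where "y = s + 3"
  have le: "a + 1 \<le> y" "D + 1 \<le> y" "D + 3 \<le> y" "L + 1 \<le> y" "1 \<le> y" by (auto simp: y_def s_def)
  have Ky: "K \<le> 2 * (y * y)" unfolding K using mult_le_mono[OF le(1,2)] by (simp add: algebra_simps)
  have yy: "y ^ n \<le> y ^ (y + 3)" if "n \<le> y + 3" for n using that le by (intro power_increasing) auto
  have "(D + 1) ^ (L + 1) \<le> y ^ y"
    using power_mono[OF le(2), of "L + 1"] power_increasing[OF le(4), of y] le(5) by simp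
  then have "K * (D + 3) * (D + 1) ^ (L + 1) \<le> 2 * (y * y) * y * y ^ y"
    using Ky le(3) by (intro mult_le_mono)
  also have "\<dots> = 2 * y ^ (y + 3)" by (simp add: power_add eval_nat_numeral algebra_simps)
  finally have 1: "K * (D + 3) * (D + 1) ^ (L + 1) \<le> 2 * y ^ (y + 3)" .
  have 2: "K \<le> 2 * y ^ (y + 3)" using Ky yy[of 2] by (simp add: power2_eq_square)
  have 3: "2 * L + 10 \<le> 10 * y ^ (y + 3)" using le yy[of 1] by (simp add: y_def s_def)
  have "20 * (p + K + 2 * L + 10) \<le> 280 * q" if "p \<le> 2 * q" "K \<le> 2 * q" "2 * L + 10 \<le> 10 * q" for p q
  proof -
    have "p + K + (2 * L + 10) \<le> 2 * q + 2 * q + 10 * q" by (intro add_mono that)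
    then show ?thesis by simp
  qed
  from this[OF 1 2 3] have "20 * G \<le> 280 * y ^ (y + 3)" unfolding G .
  also have "\<dots> \<le> 2 ^ 9 * (2 ^ y) ^ (y + 3)"
    by (intro mult_le_mono power_mono) (auto intro: less_imp_le less_exp)
  also have "\<dots> = 2 ^ (9 + y * (y + 3))" by (simp add: power_add power_mult)
  also have "\<dots> \<le> 2 ^ (2 ^ (s + 6))"
  proof -
    have "9 + (n + 3) * (n + 3 + 3) \<le> 2 ^ (n + 6)" for n :: nat
    proof (induction n)
      case (Suc n)
      have "9 + (Suc n + 3) * (Suc n + 3 + 3) \<le> 2 * (9 + (n + 3) * (n + 3 + 3))"
        by (simp add: algebra_simps)
      also have "\<dots> \<le> 2 * 2 ^ (n + 6)" by (rule mult_le_mono2[OF Suc])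
      also have "\<dots> = 2 ^ (Suc n + 6)" by (simp only: add_Suc power_Suc)
      finally show ?case .
    qed simp
    from this[of s] show ?thesis unfolding y_def by (intro power_increasing) auto
  qed
  finally show ?thesis by (simp add: exponent_def s_def add.assoc)
qed

lemma vsize_pos: "1 \<le> vsize v"
  by (cases v) auto

lemma length_less_vsize: "length xs < vsize (enc_list f xs)"
proof (induction xs)
  case (Cons x xs)
  then show ?case using vsize_pos[of "f x"] by simp
qed simp

lemma vsize_elem: "x \<in> set xs \<Longrightarrow> vsize (f x) \<le> vsize (enc_list f xs)"
  by (induction xs) auto

lemma less_vsize_unary: "n < vsize (enc_unary n)"
  using length_less_vsize[of "replicate n 0" VNum] by (simp add: enc_unary_def)

lemma less_two_power: "vsize (VNum n) \<le> z \<Longrightarrow> n < 2 ^ z"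
  using floorlog_leD[of 2 n z] by simp

theorem theorem4:
  "in_XP encodes_instance unsplittable_flow
    (\<lambda>I. [treewidth (verts I) (edges I), max_degree (verts I) (edges I), length_bound I])"
  unfolding in_XP_def
proof (intro exI[of _ prog] exI[of _ exponent] conjI computable_exponent allI impI)
  fix I x
  assume "encodes_instance I x"
  then obtain vs es ts where valid: "valid_instance I"
    and dvs: "distinct vs" "set vs = verts I"
    and des: "distinct (map (\<lambda>(u, v). {u, v}) es)" "eset es = edges I"
    and dts: "distinct ts" "set ts = tasks I"
    and x: "x = en vs ;; ee (\<lambda>u v. capacity I {u, v}) es ;; te ts ;; VNum (target I) ;; VNum (length_bound I)"
    unfolding encodes_instance_def eset_def by blast
  define V where "V = verts I"
  define TS where "TS = tasks I"
  define L where "L = length_bound I"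
  define k where "k u v = capacity I {u, v}" for u v
  define cs where "cs = map (\<lambda>(u, v). k u v) es"
  define z where "z = vsize x"
  define a where "a = treewidth V (eset es)"
  define D where "D = max_degree V (eset es)"
  define K where "K = 2 * (a + 1) * (D + 1)"
  \<comment> \<open>One exponent for all budgets: the product bounds the number of keys,
    \<open>K\<close> serves the search for a split, \<open>2 * L\<close> the enumeration of walks,
    and 10 the fixed powers of \<open>z\<close>.\<close>
  define G where "G = K * (D + 3) * (D + 1) ^ (L + 1) + K + 2 * L + 10"
  define B where "B = z ^ G"
  define W where "W = (\<Sum>(s, t, d, w) \<in> TS. w)"
  have x': "x = en vs ;; ee k es ;; te ts ;; VNum (target I) ;; VNum L"
    unfolding x L_def k_def ..
  have sizes: "vsize (en vs) \<le> z" "vsize (ee k es) \<le> z" "vsize (te ts) \<le> z"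
    "vsize (VNum (target I)) \<le> z" "vsize (VNum L) \<le> z"
    unfolding z_def x' by simp_all
  have z9: "9 \<le> z" unfolding z_def x'
    using vsize_pos[of "en vs"] vsize_pos[of "ee k es"] vsize_pos[of "te ts"]
      vsize_pos[of "VNum (target I)"] vsize_pos[of "VNum L"]
    by (simp del: vsize.simps(1))
  have zpow: "z ^ i \<le> B" if "i \<le> G" for i unfolding B_def using that z9 by (intro power_increasing) auto
  have G10: "10 \<le> G" by (simp add: G_def)
  have zB: "z \<le> B" "z ^ 2 \<le> B" using zpow[of 1] zpow[of 2] G10 by auto
  have z2: "2 * z + 3 \<le> z ^ 2" using z9 mult_le_mono1[OF z9, of z] unfolding power2_eq_square by linarith
  \<comment> \<open>\<open>L * d\<close> and the sum of all profits need about twice as many bits as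
    the numbers of the input; the 3 leaves room for the factor 2 in \<open>2 * W\<close>.\<close>
  have eight: "(2 :: nat) ^ (2 * z + 3) = 8 * (2 ^ z * 2 ^ z)"
    by (simp only: power_add power_mult[symmetric] mult_2) simp
  have two_z: "n < 2 ^ B" if "n < 2 ^ (2 * z + 3)" for n :: nat
    using that power_increasing[of "2 * z + 3" B "2 :: nat"] z2 zB(2) by (simp del: power_increasing_iff)
  have sn: "n < 2 ^ B" if "vsize (VNum n) \<le> z" for n
    by (rule two_z, rule less_le_trans[OF less_two_power[OF that]]) (intro power_increasing, auto)
  have lens: "length vs < z" "length es < z" "length ts < z"
    using length_less_vsize[of vs VNum] length_less_vsize[of es] length_less_vsize[of ts] sizes(1,2,3)
    by (meson less_le_trans)+
  have vs_size: "vsize (VNum v) \<le> z" if "v \<in> set vs" for v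
    using vsize_elem[OF that, of VNum] sizes(1) by simp
  have es_size: "vsize (VNum u) \<le> z \<and> vsize (VNum v) \<le> z \<and> k u v < z" if "(u, v) \<in> set es" for u v
  proof -
    have "vsize (VNum u ;; VNum v ;; enc_unary (k u v)) \<le> z"
      using vsize_elem[OF that, of "\<lambda>(u, v). VNum u ;; VNum v ;; enc_unary (k u v)"] sizes(2) by simp
    then show ?thesis using less_vsize_unary[of "k u v"] by simp
  qed
  have ts_size: "vsize (VNum s) \<le> z \<and> vsize (VNum t) \<le> z \<and> vsize (VNum d) \<le> z \<and> vsize (VNum w) \<le> z"
    if "(s, t, d, w) \<in> TS" for s t d w
  proof -
    have "(s, t, d, w) \<in> set ts" using that dts(2) by (simp add: TS_def)
    from vsize_elem[OF this, of "\<lambda>(s, t, d, w). VNum s ;; VNum t ;; VNum d ;; VNum w"]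
    show ?thesis using sizes(3) by simp
  qed
  have simple: "simple_graph V (eset es)" using valid des(2) by (simp add: valid_instance_def V_def)
  interpret edge_list V es by unfold_locales (fact simple, fact des(1))
  interpret flow V es cs TS L
    using valid by unfold_locales (auto simp: valid_instance_def cs_def TS_def V_def)
  interpret budget B
    by unfold_locales (use power_mono[OF z9, of 3] zpow[of 3] G10 in simp)
  have csz: "\<forall>c \<in> set cs. c \<le> z - 1" using es_size by (force simp: cs_def)
  have Kz: "K < z ^ K" 
    by (rule less_le_trans[OF less_exp]) (use z9 in \<open>intro power_mono, auto\<close>)
  have solver: "solver V es cs TS L B vs ts k K W"
  proof unfold_locales
    show "distinct vs" "distinct ts" "set vs = V" "set ts = TS"
      using dvs dts by (simp_all add: V_def TS_def)
    show "sl vs" using lens(1) zB(1) sn vs_size by (auto simp: sl_def)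
    show "length ts < B" using lens(3) zB(1) by simp
    show "cs = map (\<lambda>(u, v). k u v) es" by (simp add: cs_def)
    show "\<forall>x \<in> set cs. x < B" using csz z9 zB(1) by fastforce
    show "se es" using lens(2) zB(1) sn es_size by (auto simp: se_def)
    \<comment> \<open>\<open>L\<close> is written in binary and may be exponential in the size of
      the input; being a parameter, it may enter the exponent.\<close>
    have "L < 2 ^ L" by (rule less_exp)
    also have "\<dots> \<le> z ^ L" using z9 by (intro power_mono) auto
    also have "\<dots> \<le> B" by (rule zpow) (simp add: G_def)
    finally show "L < B" .
    have "(2 * m + 3) ^ (L + 1) \<le> (z ^ 2) ^ (L + 1)"
      using lens(2) z2 by (intro power_mono) auto
    also have "\<dots> = z ^ (2 * (L + 1))" by (rule power_mult[symmetric])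
    also have "\<dots> \<le> B" by (rule zpow) (simp add: G_def)
    finally show "(2 * m + 3) ^ (L + 1) \<le> B" .
    show "K = 2 * (treewidth V (eset es) + 1) * (\<Delta> + 1)" by (simp add: K_def a_def D_def)
    show "K < B" using Kz zpow[of K] by (simp add: G_def)
    have "2 * (length vs + 1) ^ K \<le> z * z ^ K"
      using lens(1) z9 by (intro mult_le_mono power_mono) auto
    also have "\<dots> = z ^ (K + 1)" by simp
    also have "\<dots> \<le> B" by (rule zpow) (simp add: G_def)
    finally show "2 * (length vs + 1) ^ K \<le> B" .
    show "card (keys R) < B" if R: "R \<subseteq> V" "card R \<le> K * (\<Delta> + 3)" for R
    proof -
      have "card (keys R) \<le> (z - 1 + 1) ^ (card R * (\<Delta> + 1) ^ Suc L)"
        by (rule card_keys(2)[OF R(1) csz])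
      also have "\<dots> \<le> z ^ (K * (D + 3) * (D + 1) ^ (L + 1))"
        using z9 R(2) by (auto intro!: power_increasing mult_le_mono simp: D_def)
      also have "\<dots> < B" unfolding B_def
        using z9 by (intro power_strict_increasing) (auto simp: G_def)
      finally show ?thesis .
    qed
    show "s < 2 ^ B \<and> t < 2 ^ B \<and> d < 2 ^ B \<and> w < 2 ^ B \<and> L * d < 2 ^ B"
      if "(s, t, d, w) \<in> TS" for s t d w
    proof -
      have "L * d < 2 ^ z * 2 ^ z"
        using less_two_power[OF sizes(5)] less_two_power[of d z] ts_size[OF that]
        by (intro mult_strict_mono) auto
      also have "\<dots> \<le> 2 ^ (2 * z + 3)" using eight by simp
      finally have "L * d < 2 ^ B" by (rule two_z)
      then show ?thesis using ts_size[OF that] sn[of s] sn[of t] sn[of d] sn[of w] by simp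
    qed
    show "W = (\<Sum>(s, t, d, w) \<in> TS. w)" by (simp add: W_def)
    have "W \<le> card TS * 2 ^ z"
      unfolding W_def using ts_size less_two_power
      by (intro order_trans[OF sum_bounded_above[of TS _ "2 ^ z"]]) (force intro: less_imp_le)+
    also have "card TS = length ts" using dts distinct_card[of ts] by (simp add: TS_def)
    also have "length ts * 2 ^ z \<le> 2 ^ z * 2 ^ z"
      using lens(3) less_exp[of z] by (intro mult_le_mono1) linarith
    finally have "W \<le> 2 ^ z * 2 ^ z" .
    moreover have "0 < (2 :: nat) ^ z * 2 ^ z" by simp
    ultimately have "2 * W < 2 ^ (2 * z + 3)" unfolding eight by linarith
    then show "2 * W < 2 ^ B" by (rule two_z)
  qed
  interpret solver V es cs TS L B vs ts k K W by (fact solver)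
  note main = Main_spec[OF sn[OF sizes(4)], folded x']
  have iff: "unsplittable_flow I \<longleftrightarrow> (\<exists>ch. psol TS ch \<and> target I \<le> profit TS ch)"
    by (rule unsplittable_flow_iff) (simp_all add: V_def des(2) TS_def L_def cs_def k_def)
  have "runs prog x (VNum (if unsplittable_flow I then 1 else 0)) (ct Main x)"
    using runs_fnP[of prog x] main(1) iff by (simp add: prog_def names_def ix.simps of_bool_def)
  moreover have "ct Main x \<le> vsize x ^ exponent [treewidth (verts I) (edges I), max_degree (verts I) (edges I), length_bound I]"
  proof -
    have "ct Main x \<le> z ^ (20 * G)" using main(2) by (simp add: B_def power_mult mult.commute flip: power_mult)
    also have "\<dots> \<le> z ^ exponent [a, D, L]"
      using z9 poly_le_exponent[OF K_def G_def] by (intro power_increasing) auto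
    finally show ?thesis by (simp add: z_def a_def D_def L_def V_def des(2))
  qed
  ultimately show "\<exists>t. runs prog x (VNum (if unsplittable_flow I then 1 else 0)) t \<and>
      t \<le> vsize x ^ exponent [treewidth (verts I) (edges I), max_degree (verts I) (edges I), length_bound I]"
    by blast
qed

end
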